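(* Let $\Omega\subset\mathbb{R}^N$ be a bounded smooth domain and $p>1$. Let $h:[0,\infty)\to[0,\infty)$ and $g:\Omega\times\mathbb{R}\to\mathbb{R}$ be functions, and set $H(t):=\int_0^t h(s)\,ds$ and $G(x,t):=\int_0^t g(x,s)\,ds$. Consider $$I(u)=\frac1p\int_\Omega H(|\nabla u|^p)\,dx-\int_\Omega G(x,u)\,dx,\qquad u\in W^{1,p}_0(\Omega).$$ Assume: (H1) $h$ is continuous, bounded, and non-decreasing. (H2) The map $u\mapsto\int_\Omega G(x,u)\,dx$ is Fréchet differentiable in $W^{1,p}_0(\Omega)$ and its derivative (at $u$) evaluated at $v\in W^{1,p}_0(\Omega)$ is $\int_\Omega g(x,u)v\,dx$. (H3) For every $x\in\Omega$, the function $t\mapsto G(x,t^{1/p})$ is concave on $[0,\infty)$. (H4) Every critical point $u\ge0$ of $I$ belongs to $C(\overline\Omega)$; and given any positive critical points $u,v$ of $I$, there exists $\delta\ge1$ such that $\delta^{-1}v\le u\le\delta v$ in $\Omega$. Let $A$ be the set of positive critical points of $I$. If $A\ne\emptyset$, then the following holds: (i) $I$ is constant on $A$. (ii) If $h$ is (strictly) increasing, or the function in (H3) is strictly concave, then $A$ is a singleton. (iii) If $h>0$ on $(0,\infty)$, then $A\subset\{\alpha u_0:\alpha\in(0,\infty)\}$ for some $u_0\in A$. (iv) If (H4) is assumed only for the elements of a (nonempty) subset $A'\subset A$ (i.e. every $u\in A'$ lies in $C(\overline\Omega)$ and any $u,v\in A'$ satisfy $\delta^{-1}v\le u\le\delta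 v$ in $\Omega$ for some $\delta\ge1$), then (i)–(iii) hold with $A$ replaced by $A'$.
   Context: Critical points of $I$ are exactly the weak solutions $u\in W^{1,p}_0(\Omega)$ of $-\mathrm{div}(h(|\nabla u|^p)|\nabla u|^{p-2}\nabla u)=g(x,u)$ in $\Omega$, $u=0$ on $\partial\Omega$, i.e. $\int_\Omega h(|\nabla u|^p)|\nabla u|^{p-2}\nabla u\cdot\nabla v\,dx-\int_\Omega g(x,u)v\,dx=0$ for all $v\in W^{1,p}_0(\Omega)$. Positive means $u>0$ in $\Omega$. *)

theory Defs
  imports "HOL-Analysis.Analysis"
begin

text \<open>Throughout, a function on an open set \<Omega> is encoded as a total function, all integrals and
  null sets are with respect to Lebesgue measure, and Euclidean N-space is a type of class
  \<^class>\<open>euclidean_space\<close>.\<close>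

section \<open>Smooth functions, smooth domains\<close>

primrec Ck :: "nat \<Rightarrow> ('a::euclidean_space \<Rightarrow> real) \<Rightarrow> bool" where
  "Ck 0 f \<longleftrightarrow> continuous_on UNIV f"
| "Ck (Suc k) f \<longleftrightarrow>
     (\<forall>x. f differentiable (at x)) \<and> (\<forall>i\<in>Basis. Ck k (\<lambda>x. frechet_derivative f (at x) i))"

definition smooth :: "('a::euclidean_space \<Rightarrow> real) \<Rightarrow> bool" where
  "smooth f \<longleftrightarrow> (\<forall>k. Ck k f)"

text \<open>Near each boundary point the domain is the strict epigraph of a smooth function, in the
  direction of some unit vector \<open>e\<close> (the argument of \<open>\<gamma>\<close> is the projection to the orthogonal
  complement of \<open>e\<close>).\<close>

definition smooth_domain :: "'a::euclidean_space set \<Rightarrow> bool" where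
  "smooth_domain \<Omega> \<longleftrightarrow> open \<Omega> \<and> connected \<Omega> \<and> \<Omega> \<noteq> {} \<and>
     (\<forall>x\<in>frontier \<Omega>. \<exists>r>0. \<exists>e. \<exists>\<gamma>. norm e = 1 \<and> smooth \<gamma> \<and>
        \<Omega> \<inter> ball x r = {y \<in> ball x r. \<gamma> (y - (y \<bullet> e) *\<^sub>R e) < y \<bullet> e})"

section \<open>Sobolev spaces\<close>

definition test_function :: "'a::euclidean_space set \<Rightarrow> ('a \<Rightarrow> real) \<Rightarrow> bool" where
  "test_function \<Omega> \<phi> \<longleftrightarrow> smooth \<phi> \<and> compact (closure {x. \<phi> x \<noteq> 0}) \<and> closure {x. \<phi> x \<noteq> 0} \<subseteq> \<Omega>"

definition locally_integrable ::
    "'a::euclidean_space set \<Rightarrow> ('a \<Rightarrow> 'b::euclidean_space) \<Rightarrow> bool" where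
  "locally_integrable \<Omega> f \<longleftrightarrow> (\<forall>K. compact K \<and> K \<subseteq> \<Omega> \<longrightarrow> set_integrable lebesgue K f)"

definition has_weak_gradient ::
    "'a::euclidean_space set \<Rightarrow> ('a \<Rightarrow> real) \<Rightarrow> ('a \<Rightarrow> 'a) \<Rightarrow> bool" where
  "has_weak_gradient \<Omega> u w \<longleftrightarrow> locally_integrable \<Omega> u \<and> locally_integrable \<Omega> w \<and>
     (\<forall>\<phi>. test_function \<Omega> \<phi> \<longrightarrow> (\<forall>i\<in>Basis.
        (LINT x:\<Omega>|lebesgue. u x * frechet_derivative \<phi> (at x) i) =
        - (LINT x:\<Omega>|lebesgue. (w x \<bullet> i) * \<phi> x)))"

text \<open>A weak gradient is unique up to null sets; it is used only inside integrals, so the choice is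
  immaterial.\<close>

definition weak_grad :: "'a::euclidean_space set \<Rightarrow> ('a \<Rightarrow> real) \<Rightarrow> 'a \<Rightarrow> 'a" where
  "weak_grad \<Omega> u = (SOME w. has_weak_gradient \<Omega> u w)"

definition in_Lp ::
    "real \<Rightarrow> 'a::euclidean_space set \<Rightarrow> ('a \<Rightarrow> 'b::euclidean_space) \<Rightarrow> bool" where
  "in_Lp p \<Omega> f \<longleftrightarrow>
     set_borel_measurable lebesgue \<Omega> f \<and> set_integrable lebesgue \<Omega> (\<lambda>x. norm (f x) powr p)"

definition sobolev :: "real \<Rightarrow> 'a::euclidean_space set \<Rightarrow> ('a \<Rightarrow> real) set" where
  "sobolev p \<Omega> = {u. in_Lp p \<Omega> u \<and> (\<exists>w. has_weak_gradient \<Omega> u w \<and> in_Lp p \<Omega> w)}"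

definition sobolev_norm :: "real \<Rightarrow> 'a::euclidean_space set \<Rightarrow> ('a \<Rightarrow> real) \<Rightarrow> real" where
  "sobolev_norm p \<Omega> u =
     ((LINT x:\<Omega>|lebesgue. \<bar>u x\<bar> powr p) + (LINT x:\<Omega>|lebesgue. norm (weak_grad \<Omega> u x) powr p))
       powr (1 / p)"

text \<open>The closure of the test functions in the Sobolev space. Its elements are representatives of
  the usual classes modulo null sets; they are normalised to vanish outside \<Omega>, so that equality
  on \<Omega> is equality of functions.\<close>

definition sobolev0 :: "real \<Rightarrow> 'a::euclidean_space set \<Rightarrow> ('a \<Rightarrow> real) set" where
  "sobolev0 p \<Omega> = {u \<in> sobolev p \<Omega>. (\<forall>x. x \<notin> \<Omega> \<longrightarrow> u x = 0) \<and>
     (\<forall>\<epsilon>>0. \<exists>\<phi>. test_function \<Omega> \<phi> \<and> sobolev_norm p \<Omega> (\<lambda>x. u x - \<phi> x) < \<epsilon>)}"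

text \<open>\<^term>\<open>has_frechet_derivative0 p \<Omega> F L u\<close>: the functional \<open>F\<close> on the space
  \<^term>\<open>sobolev0 p \<Omega>\<close> has the Frechet derivative \<open>L\<close> at \<open>u\<close>.\<close>

definition has_frechet_derivative0 ::
    "real \<Rightarrow> 'a::euclidean_space set \<Rightarrow> (('a \<Rightarrow> real) \<Rightarrow> real) \<Rightarrow> (('a \<Rightarrow> real) \<Rightarrow> real) \<Rightarrow>
     ('a \<Rightarrow> real) \<Rightarrow> bool" where
  "has_frechet_derivative0 p \<Omega> F L u \<longleftrightarrow>
     (\<forall>v\<in>sobolev0 p \<Omega>. \<forall>w\<in>sobolev0 p \<Omega>. \<forall>a b.
        L (\<lambda>x. a * v x + b * w x) = a * L v + b * L w) \<and>
     (\<exists>C. \<forall>v\<in>sobolev0 p \<Omega>. \<bar>L v\<bar> \<le> C * sobolev_norm p \<Omega> v) \<and>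
     (\<forall>\<epsilon>>0. \<exists>d>0. \<forall>v\<in>sobolev0 p \<Omega>. sobolev_norm p \<Omega> v < d \<longrightarrow>
        \<bar>F (\<lambda>x. u x + v x) - F u - L v\<bar> \<le> \<epsilon> * sobolev_norm p \<Omega> v)"

section \<open>The functional and its critical points\<close>

text \<open>The oriented integral from 0 to \<open>t\<close>; \<open>t\<close> may be negative. \<open>H\<close> is \<^term>\<open>integral_from_0 h\<close> and
  \<open>G x\<close> is \<^term>\<open>integral_from_0 (g x)\<close>.\<close>

definition integral_from_0 :: "(real \<Rightarrow> real) \<Rightarrow> real \<Rightarrow> real" where
  "integral_from_0 f t = (LINT s=0..ereal t|lebesgue. f s)"

definition potential ::
    "'a::euclidean_space set \<Rightarrow> ('a \<Rightarrow> real \<Rightarrow> real) \<Rightarrow> ('a \<Rightarrow> real) \<Rightarrow> real" where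
  "potential \<Omega> g u = (LINT x:\<Omega>|lebesgue. integral_from_0 (g x) (u x))"

definition energy ::
    "real \<Rightarrow> 'a::euclidean_space set \<Rightarrow> (real \<Rightarrow> real) \<Rightarrow> ('a \<Rightarrow> real \<Rightarrow> real) \<Rightarrow> ('a \<Rightarrow> real) \<Rightarrow> real"
    where
  "energy p \<Omega> h g u =
     (1 / p) * (LINT x:\<Omega>|lebesgue. integral_from_0 h (norm (weak_grad \<Omega> u x) powr p))
     - potential \<Omega> g u"

definition critical_point ::
    "real \<Rightarrow> 'a::euclidean_space set \<Rightarrow> (real \<Rightarrow> real) \<Rightarrow> ('a \<Rightarrow> real \<Rightarrow> real) \<Rightarrow> ('a \<Rightarrow> real) \<Rightarrow> bool"
    where
  "critical_point p \<Omega> h g u \<longleftrightarrow>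
     u \<in> sobolev0 p \<Omega> \<and> has_frechet_derivative0 p \<Omega> (energy p \<Omega> h g) (\<lambda>v. 0) u"

text \<open>Positivity is meant at every point of \<Omega>. For a class modulo null sets this is a condition on
  its continuous representative: positivity almost everywhere would be a weaker condition, as a
  continuous function may vanish on a null set. Hence a class that has a continuous representative
  is represented by it.\<close>

definition regular_rep :: "'a::euclidean_space set \<Rightarrow> ('a \<Rightarrow> real) \<Rightarrow> bool" where
  "regular_rep \<Omega> u \<longleftrightarrow>
     ((\<exists>w. continuous_on \<Omega> w \<and> (AE x in lebesgue. x \<in> \<Omega> \<longrightarrow> u x = w x)) \<longrightarrow> continuous_on \<Omega> u)"

definition positive_critical_points ::
    "real \<Rightarrow> 'a::euclidean_space set \<Rightarrow> (real \<Rightarrow> real) \<Rightarrow> ('a \<Rightarrow> real \<Rightarrow> real) \<Rightarrow> ('a \<Rightarrow> real) set"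
    where
  "positive_critical_points p \<Omega> h g =
     {u. critical_point p \<Omega> h g u \<and> regular_rep \<Omega> u \<and> (\<forall>x\<in>\<Omega>. 0 < u x)}"

section \<open>Hypotheses\<close>

definition potential_differentiable ::
    "real \<Rightarrow> 'a::euclidean_space set \<Rightarrow> ('a \<Rightarrow> real \<Rightarrow> real) \<Rightarrow> bool" where
  "potential_differentiable p \<Omega> g \<longleftrightarrow>
     (\<forall>u\<in>sobolev0 p \<Omega>.
        set_integrable lebesgue \<Omega> (\<lambda>x. integral_from_0 (g x) (u x)) \<and>
        (\<forall>v\<in>sobolev0 p \<Omega>. set_integrable lebesgue \<Omega> (\<lambda>x. g x (u x) * v x)) \<and>
        has_frechet_derivative0 p \<Omega> (potential \<Omega> g) (\<lambda>v. LINT x:\<Omega>|lebesgue. g x (u x) * v x) u)"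

definition strictly_concave_on :: "real set \<Rightarrow> (real \<Rightarrow> real) \<Rightarrow> bool" where
  "strictly_concave_on S f \<longleftrightarrow> convex S \<and>
     (\<forall>x\<in>S. \<forall>y\<in>S. \<forall>t. x \<noteq> y \<and> 0 < t \<and> t < 1 \<longrightarrow>
        (1 - t) * f x + t * f y < f ((1 - t) * x + t * y))"

text \<open>Membership in the space of continuous functions on the closure, for a class modulo null
  sets.\<close>

definition in_C_closure :: "'a::euclidean_space set \<Rightarrow> ('a \<Rightarrow> real) \<Rightarrow> bool" where
  "in_C_closure \<Omega> u \<longleftrightarrow>
     (\<exists>w. continuous_on (closure \<Omega>) w \<and> (AE x in lebesgue. x \<in> \<Omega> \<longrightarrow> u x = w x))"

definition comparable_on :: "'a::euclidean_space set \<Rightarrow> ('a \<Rightarrow> real) \<Rightarrow> ('a \<Rightarrow> real) \<Rightarrow> bool" where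
  "comparable_on \<Omega> u v \<longleftrightarrow> (\<exists>\<delta>\<ge>1. \<forall>x\<in>\<Omega>. inverse \<delta> * v x \<le> u x \<and> u x \<le> \<delta> * v x)"

end

theory Submission
  imports Defs
begin

text \<open>Two positive critical points \<open>u\<close> and \<open>v\<close> are joined by the path
  \<open>\<sigma>\<^sub>t = ((1 - t) u\<^sup>p + t v\<^sup>p)\<^bsup>1/p\<^esup>\<close>. The hidden convexity inequality
  \<open>|\<nabla>\<sigma>\<^sub>t|\<^sup>p \<le> (1 - t) |\<nabla>u|\<^sup>p + t |\<nabla>v|\<^sup>p\<close>, together with the convexity and monotonicity of \<open>H\<close>
  and (H3), gives \<open>I(\<sigma>\<^sub>t) \<le> (1 - t) I(u) + t I(v)\<close>. Since \<open>v \<le> \<delta> u\<close>, the norm of \<open>\<sigma>\<^sub>t - u\<close> is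
  \<open>O(t)\<close>, so \<open>I(\<sigma>\<^sub>t) = I(u) + o(t)\<close> and hence \<open>I(u) \<le> I(v)\<close>: a critical point minimises \<open>I\<close> among the
  positive functions that it dominates. By symmetry \<open>I(u) = I(v)\<close>, and \<open>\<sigma>\<close> at \<open>t = 1/2\<close> is dominated
  as well, so every inequality used is an equality almost everywhere. Equality in
  the concavity of \<open>G\<close> gives \<open>u = v\<close> in the strict case, and equality in the hidden convexity gives
  \<open>\<nabla>u / u = \<nabla>v / v\<close>, i.e. \<open>\<nabla>(ln u - ln v) = 0\<close>.\<close>

section \<open>Smooth functions\<close>

text \<open>The costly point is that the means belong to the Sobolev space: \<open>sobolev0\<close>
  is a closure of test functions, and the power mean is not smooth where an argument vanishes, while
  test functions approximating u and v do vanish. The mean is homogeneous of degree one, so its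
  partial derivatives are bounded; regularisations with the same bound give a chain rule inside the
  closure. The logarithm has no such bound, so ln u - ln v is tested only against compactly
  supported functions, where continuity keeps u and v away from 0. Its constancy then follows by
  translating test functions, without mollification.

  Positivity of h on the positive half-line makes H strictly increasing, which turns equality of the
  H-terms into equality in the hidden convexity. If h is strictly increasing, H is moreover strictly
  convex, so for u = \<alpha> v the norms of both gradients agree a.e.; if \<alpha> \<noteq> 1, the
  gradient of v vanishes, which the zero boundary values exclude.\<close>

lemma Ck_SucI:
  assumes "\<And>x. (f has_derivative f' x) (at x)"
    and "\<And>i. i \<in> Basis \<Longrightarrow> Ck k (\<lambda>x. f' x i)"
  shows "Ck (Suc k) f"
proof -
  have "frechet_derivative f (at x) = f' x" for x
    using frechet_derivative_at[OF assms(1)] by metis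
  then show ?thesis using assms by (auto simp: differentiable_def)
qed

lemma Ck_Suc_has_derivative:
  "Ck (Suc k) f \<Longrightarrow> (f has_derivative frechet_derivative f (at x)) (at x)"
  by (simp add: frechet_derivative_works[symmetric])

lemma Ck_Suc_imp: "Ck (Suc k) f \<Longrightarrow> Ck k f"
proof (induction k arbitrary: f)
  case 0
  then show ?case
    by (auto intro!: differentiable_imp_continuous_on simp: differentiable_on_def differentiable_at_withinI)
next
  case (Suc k)
  then show ?case by (metis Ck.simps(2))
qed

lemma Ck_const [simp]: "Ck k (\<lambda>x. c)"
proof (induction k arbitrary: c)
  case (Suc k)
  show ?case by (rule Ck_SucI[where f' = "\<lambda>x y. 0"]) (auto simp: Suc)
qed auto

lemma Ck_inner_left [simp]: "Ck k (\<lambda>x. x \<bullet> e)"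
proof (cases k)
  case (Suc k)
  show ?thesis unfolding Suc
    by (rule Ck_SucI[where f' = "\<lambda>x y. y \<bullet> e"]) (auto intro!: derivative_eq_intros)
qed (auto intro!: continuous_intros)

lemma Ck_add: "Ck k f \<Longrightarrow> Ck k g \<Longrightarrow> Ck k (\<lambda>x. f x + g x)"
proof (induction k arbitrary: f g)
  case (Suc k)
  show ?case
  proof (rule Ck_SucI)
    show "((\<lambda>x. f x + g x) has_derivative
        (\<lambda>y. frechet_derivative f (at x) y + frechet_derivative g (at x) y)) (at x)" for x
      using Suc.prems by (intro derivative_intros Ck_Suc_has_derivative)
  qed (use Suc in auto)
qed (auto intro: continuous_intros)

lemma Ck_mult: "Ck k f \<Longrightarrow> Ck k g \<Longrightarrow> Ck k (\<lambda>x. f x * g x)"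
proof (induction k arbitrary: f g)
  case (Suc k)
  have fg: "Ck k f" "Ck k g" using Suc.prems Ck_Suc_imp by blast+
  show ?case
  proof (rule Ck_SucI)
    show "((\<lambda>x. f x * g x) has_derivative
        (\<lambda>y. f x * frechet_derivative g (at x) y + frechet_derivative f (at x) y * g x)) (at x)" for x
      using Suc.prems by (intro derivative_intros Ck_Suc_has_derivative)
  qed (use Suc fg in \<open>auto intro!: Ck_add\<close>)
qed (auto intro: continuous_intros)

lemma Ck_power: "Ck k f \<Longrightarrow> Ck k (\<lambda>x. f x ^ n)"
  by (induction n) (auto intro: Ck_mult)

lemma Ck_prod: "(\<And>i. i \<in> I \<Longrightarrow> Ck k (f i)) \<Longrightarrow> Ck k (\<lambda>x. \<Prod>i\<in>I. f i x)"
  by (induction I rule: infinite_finite_induct) (auto intro: Ck_mult)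

lemma Ck_powr: "Ck k f \<Longrightarrow> (\<And>x. f x > 0) \<Longrightarrow> Ck k (\<lambda>x. f x powr r)"
proof (induction k arbitrary: f r)
  case 0
  then show ?case by (auto intro!: continuous_intros simp: less_imp_neq[symmetric])
next
  case (Suc k)
  have f: "Ck k f" using Suc.prems Ck_Suc_imp by blast
  show ?case
  proof (rule Ck_SucI)
    show "((\<lambda>x. f x powr r) has_derivative
        (\<lambda>y. r * f x powr (r - 1) * frechet_derivative f (at x) y)) (at x)" for x
      using Suc.prems(1) Suc.prems(2)[of x]
      by (auto intro!: derivative_eq_intros Ck_Suc_has_derivative simp: powr_diff field_simps)
  qed (use Suc f in \<open>auto intro!: Ck_mult\<close>)
qed

lemma Ck_ln: "Ck k f \<Longrightarrow> (\<And>x. f x > 0) \<Longrightarrow> Ck k (\<lambda>x. ln (f x))"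
proof (cases k)
  case 0
  then show "Ck k f \<Longrightarrow> (\<And>x. f x > 0) \<Longrightarrow> Ck k (\<lambda>x. ln (f x))"
    by (auto intro!: continuous_intros simp: less_imp_neq[symmetric])
next
  case (Suc j)
  assume f: "Ck k f" and pos: "\<And>x. f x > 0"
  have fj: "Ck j f" using f Ck_Suc_imp Suc by blast
  show "Ck k (\<lambda>x. ln (f x))" unfolding Suc
  proof (rule Ck_SucI)
    show "((\<lambda>x. ln (f x)) has_derivative
        (\<lambda>y. f x powr (- 1) * frechet_derivative f (at x) y)) (at x)" for x
      using pos[of x] f Suc
      by (auto intro!: derivative_eq_intros Ck_Suc_has_derivative simp: powr_minus field_simps)
  qed (use f Suc in \<open>intro Ck_mult Ck_powr fj pos, simp\<close>)
qed

lemma Ck_translate: "Ck k f \<Longrightarrow> Ck k (\<lambda>x. f (x + c))"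
proof (induction k arbitrary: f)
  case 0
  then show ?case by (auto intro!: continuous_on_compose2[where f = "\<lambda>x. x + c"] continuous_intros)
next
  case (Suc k)
  show ?case
  proof (rule Ck_SucI)
    show "((\<lambda>x. f (x + c)) has_derivative frechet_derivative f (at (x + c))) (at x)" for x
      using has_derivative_compose[OF has_derivative_add_const[OF has_derivative_ident, of c]
          Ck_Suc_has_derivative[OF Suc.prems], of x] by simp
  qed (use Suc in auto)
qed

text \<open>The powers of \<open>1/x\<close> make the family closed under differentiation.\<close>

definition flat :: "nat \<Rightarrow> real \<Rightarrow> real" where
  "flat m x = (if x > 0 then exp (- inverse x) * inverse x ^ m else 0)"

lemma flat_tendsto_0: "(flat m \<longlongrightarrow> 0) (at 0)"
proof -
  have *: "((\<lambda>x. exp (- inverse x) * inverse x ^ m) \<longlongrightarrow> 0) (at_right (0::real))"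
  proof -
    have "((\<lambda>y::real. y ^ m / exp y) \<longlongrightarrow> 0) at_top" by (rule tendsto_power_div_exp_0)
    then have "((\<lambda>x::real. inverse x ^ m / exp (inverse x)) \<longlongrightarrow> 0) (at_right 0)"
      using filterlim_compose filterlim_inverse_at_top_right by blast
    then show ?thesis by (simp add: exp_minus field_simps)
  qed
  have "(flat m \<longlongrightarrow> 0) (at_right 0)"
    by (rule Lim_transform_eventually[OF *])
      (auto simp: flat_def eventually_at_right_field intro: exI[of _ 1])
  moreover have "(flat m \<longlongrightarrow> 0) (at_left 0)"
    by (rule Lim_transform_eventually[OF tendsto_const])
      (auto simp: flat_def eventually_at_left_field intro: exI[of _ "-1"])
  ultimately show ?thesis by (simp add: filterlim_at_split)
qed

lemma flat_DERIV:
  "(flat m has_field_derivative (flat (m + 2) x - m * flat (m + 1) x)) (at x)"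
proof -
  consider "x > 0" | "x < 0" | "x = 0" by linarith
  then show ?thesis
  proof cases
    case 1
    have "((\<lambda>x. exp (- inverse x) * inverse x ^ m) has_field_derivative
        (flat (m + 2) x - m * flat (m + 1) x)) (at x)"
    proof (cases m)
      case 0
      then show ?thesis using 1
        by (auto intro!: derivative_eq_intros simp: flat_def power2_eq_square field_simps)
    next
      case (Suc n)
      have "inverse x * inverse x ^ (n - Suc 0) = inverse x ^ n \<or> n = 0"
        by (cases n) auto
      then show ?thesis using 1 Suc
        by (auto intro!: derivative_eq_intros simp: flat_def algebra_simps)
    qed
    then show ?thesis
      by (rule has_field_derivative_transform_within_open[where S = "{0<..}"])
        (use 1 in \<open>auto simp: flat_def\<close>)
  next
    case 2
    have "((\<lambda>x. 0) has_field_derivative (flat (m + 2) x - m * flat (m + 1) x)) (at x)"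
      using 2 by (auto simp: flat_def)
    then show ?thesis
      by (rule has_field_derivative_transform_within_open[where S = "{..<0}"])
        (use 2 in \<open>auto simp: flat_def\<close>)
  next
    case 3
    \<comment> \<open>Dividing by h only adds one more factor 1/h, so the difference quotient at 0
      is again a member of the family and tends to 0.\<close>
    have "(\<lambda>h. (flat m (0 + h) - flat m 0) / h) = flat (Suc m)"
      by (auto simp: fun_eq_iff flat_def divide_inverse)
    then show ?thesis
      using 3 flat_tendsto_0[of "Suc m"] by (simp add: DERIV_def) (simp add: flat_def)
  qed
qed

lemma Ck_flat: "Ck k f \<Longrightarrow> Ck k (\<lambda>x. flat m (f x))"
proof (induction k arbitrary: f m)
  case 0
  have "continuous_on UNIV (flat m)"
    using flat_DERIV DERIV_isCont continuous_at_imp_continuous_on by blast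
  then show ?case using 0 by (auto intro: continuous_on_compose2)
next
  case (Suc k)
  have f: "Ck k f" using Suc.prems Ck_Suc_imp by blast
  show ?case
  proof (rule Ck_SucI)
    show "((\<lambda>x. flat m (f x)) has_derivative
        (\<lambda>y. (flat (m + 2) (f x) + (- real m) * flat (m + 1) (f x)) * frechet_derivative f (at x) y)) (at x)" for x
      using has_derivative_compose[OF Ck_Suc_has_derivative[OF Suc.prems, of x]
          has_field_derivative_imp_has_derivative[OF flat_DERIV[of m "f x"]]]
      by (simp add: algebra_simps)
  qed (use Suc f in \<open>simp only: Ck.simps, intro Ck_mult Ck_add Ck_const Suc.IH, auto\<close>)
qed

lemma smooth_const [simp]: "smooth (\<lambda>x. c)"
  and smooth_inner_left [simp]: "smooth (\<lambda>x. x \<bullet> e)"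
  and smooth_add: "smooth f \<Longrightarrow> smooth g \<Longrightarrow> smooth (\<lambda>x. f x + g x)"
  and smooth_mult: "smooth f \<Longrightarrow> smooth g \<Longrightarrow> smooth (\<lambda>x. f x * g x)"
  and smooth_power: "smooth f \<Longrightarrow> smooth (\<lambda>x. f x ^ n)"
  and smooth_prod: "(\<And>i. i \<in> I \<Longrightarrow> smooth (F i)) \<Longrightarrow> smooth (\<lambda>x. \<Prod>i\<in>I. F i x)"
  and smooth_powr: "smooth f \<Longrightarrow> (\<And>x. f x > 0) \<Longrightarrow> smooth (\<lambda>x. f x powr r)"
  and smooth_ln: "smooth f \<Longrightarrow> (\<And>x. f x > 0) \<Longrightarrow> smooth (\<lambda>x. ln (f x))"
  and smooth_translate: "smooth f \<Longrightarrow> smooth (\<lambda>x. f (x + a))"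
  and smooth_flat: "smooth f \<Longrightarrow> smooth (\<lambda>x. flat m (f x))"
  by (simp_all add: smooth_def Ck_add Ck_mult Ck_power Ck_prod Ck_powr Ck_ln Ck_translate Ck_flat)

lemma smooth_diff: "smooth f \<Longrightarrow> smooth g \<Longrightarrow> smooth (\<lambda>x. f x - g x)"
  using smooth_add[of f "\<lambda>x. -1 * g x"] smooth_mult[of "\<lambda>x. -1" g] by simp

lemma smooth_has_derivative:
  "smooth f \<Longrightarrow> (f has_derivative frechet_derivative f (at x)) (at x)"
  unfolding smooth_def using Ck_Suc_has_derivative by blast

lemma smooth_continuous_on: "smooth f \<Longrightarrow> continuous_on S f"
  unfolding smooth_def by (metis Ck.simps(1) continuous_on_subset subset_UNIV)

lemma smooth_frechet_derivative:
  "smooth f \<Longrightarrow> i \<in> Basis \<Longrightarrow> smooth (\<lambda>x. frechet_derivative f (at x) i)"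
  unfolding smooth_def by (metis Ck.simps(2))

section \<open>Gradient vectors of smooth functions\<close>

definition grad :: "('a::euclidean_space \<Rightarrow> real) \<Rightarrow> 'a \<Rightarrow> 'a" where
  "grad f x = (\<Sum>i\<in>Basis. frechet_derivative f (at x) i *\<^sub>R i)"

lemma grad_inner_Basis: "i \<in> Basis \<Longrightarrow> grad f x \<bullet> i = frechet_derivative f (at x) i"
  unfolding grad_def by simp

lemma frechet_derivative_eq_grad:
  assumes "f differentiable (at x)"
  shows "frechet_derivative f (at x) y = grad f x \<bullet> y"
proof -
  have "linear (frechet_derivative f (at x))"
    using assms by (rule linear_frechet_derivative)
  then have "frechet_derivative f (at x) (\<Sum>i\<in>Basis. (y \<bullet> i) *\<^sub>R i) =
      (\<Sum>i\<in>Basis. (y \<bullet> i) *\<^sub>R frechet_derivative f (at x) i)"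
    by (simp add: linear_sum linear_scale)
  then show ?thesis
    unfolding euclidean_representation grad_def inner_sum_left inner_scaleR_left
    by (simp add: inner_commute mult.commute)
qed

lemma smooth_has_derivative_grad: "smooth f \<Longrightarrow> (f has_derivative (\<lambda>y. grad f x \<bullet> y)) (at x)"
  using smooth_has_derivative[of f x] frechet_derivative_eq_grad[of f x]
  by (metis (no_types, lifting) differentiableI ext)

lemma grad_eqI:
  assumes "(f has_derivative (\<lambda>y. w \<bullet> y)) (at x)"
  shows "grad f x = w"
proof -
  have "frechet_derivative f (at x) = (\<lambda>y. w \<bullet> y)"
    using frechet_derivative_at[OF assms] by simp
  then show ?thesis by (simp add: grad_def euclidean_representation)
qed

lemma continuous_on_grad: "smooth f \<Longrightarrow> continuous_on S (grad f)"
  unfolding grad_def[abs_def]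
  by (intro continuous_intros smooth_continuous_on smooth_frechet_derivative)

section \<open>Test functions\<close>

lemma test_functionI:
  assumes "smooth \<phi>" "compact K" "K \<subseteq> \<Omega>" "\<And>x. x \<notin> K \<Longrightarrow> \<phi> x = 0"
  shows "test_function \<Omega> \<phi>"
proof -
  have "closure {x. \<phi> x \<noteq> 0} \<subseteq> K"
    using assms by (intro closure_minimal compact_imp_closed) auto
  then show ?thesis unfolding test_function_def
    using assms compact_Int_closed[of K "closure {x. \<phi> x \<noteq> 0}"] by (auto simp: Int_absorb1)
qed

text \<open>Off its support a test function vanishes on an open set, so its gradient is 0 there as
  well. All later uses of compact support go through this form.\<close>

lemma test_function_support:
  assumes "test_function \<Omega> \<phi>"
  shows "\<exists>K. compact K \<and> K \<subseteq> \<Omega> \<and> (\<forall>x. x \<notin> K \<longrightarrow> \<phi> x = 0 \<and> grad \<phi> x = 0)"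
proof -
  define K where "K = closure {x. \<phi> x \<noteq> 0}"
  have K: "compact K" "K \<subseteq> \<Omega>" using assms by (simp_all add: test_function_def K_def)
  have cl: "closed K" by (simp add: K_def)
  have z: "\<phi> x = 0" if "x \<notin> K" for x
    using that unfolding K_def using closure_subset[of "{x. \<phi> x \<noteq> 0}"] by blast
  have "grad \<phi> x = 0" if "x \<notin> K" for x
  proof (rule grad_eqI)
    have "((\<lambda>x. 0) has_derivative (\<lambda>y. 0 \<bullet> y)) (at x)" by simp
    then show "(\<phi> has_derivative (\<lambda>y. 0 \<bullet> y)) (at x)"
      by (rule has_derivative_transform_within_open[where s = "- K"]) (use that z cl in auto)
  qed
  then show ?thesis using K z by blast
qed

lemma test_function_smooth: "test_function \<Omega> \<phi> \<Longrightarrow> smooth \<phi>"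
  by (simp add: test_function_def)

lemma test_function_mult:
  assumes "test_function \<Omega> \<phi>" "smooth \<zeta>"
  shows "test_function \<Omega> (\<lambda>x. \<phi> x * \<zeta> x)"
proof -
  obtain K where K: "compact K" "K \<subseteq> \<Omega>" "\<And>x. x \<notin> K \<Longrightarrow> \<phi> x = 0"
    using test_function_support[OF assms(1)] by blast
  show ?thesis
    by (rule test_functionI[OF _ K(1,2)])
      (use assms K in \<open>auto intro: smooth_mult test_function_smooth\<close>)
qed

text \<open>The union of the two supports serves as support because F vanishes at the origin. This
  is why the regularised mean and the regularised logarithm are later shifted by a constant.\<close>

lemma test_function_binary:
  assumes "test_function \<Omega> \<phi>" "test_function \<Omega> \<psi>"
    and "smooth (\<lambda>x. F (\<phi> x) (\<psi> x))" "F 0 0 = 0"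
  shows "test_function \<Omega> (\<lambda>x. F (\<phi> x) (\<psi> x))"
proof -
  obtain K where K: "compact K" "K \<subseteq> \<Omega>" "\<And>x. x \<notin> K \<Longrightarrow> \<phi> x = 0"
    using test_function_support[OF assms(1)] by blast
  obtain L where L: "compact L" "L \<subseteq> \<Omega>" "\<And>x. x \<notin> L \<Longrightarrow> \<psi> x = 0"
    using test_function_support[OF assms(2)] by blast
  show ?thesis
    by (rule test_functionI[of _ "K \<union> L"]) (use assms K L in auto)
qed

lemma test_function_translate:
  assumes "test_function \<Omega> \<phi>" and "\<And>x. x \<in> \<Omega> \<Longrightarrow> x - c \<in> \<Omega>'"
  shows "test_function \<Omega>' (\<lambda>x. \<phi> (x + c))"
proof -
  obtain K where K: "compact K" "K \<subseteq> \<Omega>" "\<And>x. x \<notin> K \<Longrightarrow> \<phi> x = 0"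
    using test_function_support[OF assms(1)] by blast
  show ?thesis
  proof (rule test_functionI)
    show "smooth (\<lambda>x. \<phi> (x + c))" by (intro smooth_translate test_function_smooth[OF assms(1)])
    show "compact ((\<lambda>x. x - c) ` K)" by (intro compact_continuous_image continuous_intros K)
    show "(\<lambda>x. x - c) ` K \<subseteq> \<Omega>'" using K assms by auto
    show "\<phi> (x + c) = 0" if "x \<notin> (\<lambda>x. x - c) ` K" for x
      using that K(3) by (metis add_diff_cancel imageI)
  qed
qed

section \<open>Gradients of translates and products, integrals of gradients\<close>

lemma grad_translate: "smooth f \<Longrightarrow> grad (\<lambda>x. f (x + c)) x = grad f (x + c)"
  using has_derivative_compose[OF has_derivative_add_const[OF has_derivative_ident, of c]
      smooth_has_derivative_grad]
  by (intro grad_eqI) (auto simp: o_def)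

lemma grad_mult:
  assumes "smooth f" "smooth g"
  shows "grad (\<lambda>x. f x * g x) x = f x *\<^sub>R grad g x + g x *\<^sub>R grad f x"
  by (rule grad_eqI) (auto intro!: derivative_eq_intros smooth_has_derivative_grad assms
    simp: inner_add_left)

text \<open>Differentiation along translations takes the place of the divergence theorem. With g = 1
  it shows that gradients of test functions have integral 0; with g a continuous function orthogonal
  to all gradients it shows that g is locally constant.\<close>

lemma DERIV_integral_translate:
  fixes f :: "'a::euclidean_space \<Rightarrow> real"
  assumes g: "continuous_on (cbox a b) g" and f: "smooth f"
  shows "((\<lambda>s. integral (cbox a b) (\<lambda>x. g x * f (x + s *\<^sub>R e))) has_field_derivative
    integral (cbox a b) (\<lambda>x. g x * (grad f (x + s *\<^sub>R e) \<bullet> e))) (at s)"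
proof (rule leibniz_rule_field_derivative[where U = UNIV])
  have line: "((\<lambda>s. x + s *\<^sub>R e) has_derivative (\<lambda>h. h *\<^sub>R e)) (at s)" for x s
    by (auto intro!: derivative_eq_intros)
  show "((\<lambda>s. g x * f (x + s *\<^sub>R e)) has_field_derivative g x * (grad f (x + s *\<^sub>R e) \<bullet> e)) (at s)"
    for x s
  proof -
    have "((\<lambda>s. f (x + s *\<^sub>R e)) has_field_derivative (grad f (x + s *\<^sub>R e) \<bullet> e)) (at s)"
      by (rule has_derivative_imp_has_field_derivative[OF
            has_derivative_compose[OF line smooth_has_derivative_grad[OF f]]]) simp
    then show ?thesis by (rule DERIV_cmult)
  qed
  show "(\<lambda>x. g x * f (x + s *\<^sub>R e)) integrable_on cbox a b" for s
    by (intro integrable_continuous continuous_intros g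
        continuous_on_compose2[OF smooth_continuous_on[OF f, of UNIV]]) auto
  show "continuous_on (UNIV \<times> cbox a b) (\<lambda>(s, x). g x * (grad f (x + s *\<^sub>R e) \<bullet> e))"
    unfolding split_beta
    by (intro continuous_intros continuous_on_compose2[OF g]
        continuous_on_compose2[OF continuous_on_grad[OF f, of UNIV]]) auto
qed auto

lemma integral_cbox_eq_UNIV:
  fixes f :: "'a::euclidean_space \<Rightarrow> real"
  assumes "\<And>x. x \<notin> cbox a b \<Longrightarrow> f x = 0"
  shows "integral (cbox a b) f = integral UNIV f"
  using assms by (intro integral_spike_set) (auto intro: negligible_subset[of "{}"])

text \<open>The integral of \<phi> is unchanged by translation, and the derivative of the translated
  integral at s = 0 is the integral of the directional derivative.\<close>

lemma integral_grad_test_function: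
  fixes \<phi> :: "'a::euclidean_space \<Rightarrow> real"
  assumes "test_function \<Omega> \<phi>"
  shows "integral UNIV (\<lambda>x. grad \<phi> x \<bullet> e) = 0"
proof -
  obtain K where K: "compact K" "\<And>x. x \<notin> K \<Longrightarrow> \<phi> x = 0" "\<And>x. x \<notin> K \<Longrightarrow> grad \<phi> x = 0"
    using test_function_support[OF assms] by blast
  \<comment> \<open>The box must contain the supports of all translates by s e with |s| \<le> 1, so
    that the integral over the fixed box is constant for s near 0.\<close>
  have "compact ((\<lambda>(x, s). x - s *\<^sub>R e) ` (K \<times> {-1..1}))"
    unfolding split_beta by (intro compact_continuous_image continuous_intros compact_Times K) auto
  then obtain b where b: "(\<lambda>(x, s). x - s *\<^sub>R e) ` (K \<times> {-1..1}) \<subseteq> cbox (- b) b"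
    using bounded_subset_cbox_symmetric[OF compact_imp_bounded] by blast
  have z: "x \<in> cbox (- b) b" if "x + s *\<^sub>R e \<in> K" "\<bar>s\<bar> \<le> 1" for x s
    using b that by (force simp: image_subset_iff abs_le_iff)
  have const: "integral (cbox (- b) b) (\<lambda>x. 1 * \<phi> (x + s *\<^sub>R e)) = integral UNIV \<phi>" if "s \<in> {-1<..<1}" for s
  proof -
    have "integral (cbox (- b) b) (\<lambda>x. \<phi> (x + s *\<^sub>R e)) =
        integral (cbox (- b + s *\<^sub>R e) (b + s *\<^sub>R e)) \<phi>"
      using integral_shift_cbox_plus[of "- b" b \<phi> "s *\<^sub>R e"] by (simp add: o_def add.commute)
    also have "\<dots> = integral UNIV \<phi>"
    proof (rule integral_cbox_eq_UNIV)
      fix x assume "x \<notin> cbox (- b + s *\<^sub>R e) (b + s *\<^sub>R e)"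
      then have "x - s *\<^sub>R e \<notin> cbox (- b) b" by (auto simp: mem_box algebra_simps inner_simps)
      then show "\<phi> x = 0" using z[of "x - s *\<^sub>R e" s] K that by (cases "x \<in> K") (auto simp: abs_le_iff)
    qed
    finally show ?thesis by simp
  qed
  have "((\<lambda>s. integral UNIV \<phi>) has_field_derivative
      integral (cbox (- b) b) (\<lambda>x. 1 * (grad \<phi> (x + 0 *\<^sub>R e) \<bullet> e))) (at 0)"
    by (rule has_field_derivative_transform_within_open[OF
          DERIV_integral_translate[of "- b" b "\<lambda>x. 1", OF _ test_function_smooth[OF assms]],
          where S = "{-1<..<1}"]) (use const in auto)
  then have "integral (cbox (- b) b) (\<lambda>x. grad \<phi> x \<bullet> e) = 0"
    using DERIV_unique[OF _ DERIV_const] by fastforce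
  moreover have "integral (cbox (- b) b) (\<lambda>x. grad \<phi> x \<bullet> e) = integral UNIV (\<lambda>x. grad \<phi> x \<bullet> e)"
    using z[of _ 0] K(3) by (intro integral_cbox_eq_UNIV) (metis abs_zero add.right_neutral inner_zero_left scale_zero_left zero_le_one)
  ultimately show ?thesis by simp
qed

section \<open>The fundamental lemma of the calculus of variations\<close>

text \<open>\<open>flat 0\<close> is exp(-1/x) for positive x. Inside the open box the scaling by
  \<open>Suc n\<close> drives every factor up to 1, while outside some factor stays 0, so these are
  smooth approximations of the indicator function bounded by 1.\<close>

definition box_bump :: "'a::euclidean_space \<Rightarrow> 'a \<Rightarrow> nat \<Rightarrow> 'a \<Rightarrow> real" where
  "box_bump a b n x =
    (\<Prod>i\<in>Basis. flat 0 (real (Suc n) * (x \<bullet> i - a \<bullet> i)) * flat 0 (real (Suc n) * (b \<bullet> i - x \<bullet> i)))"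

lemma flat_nonneg: "0 \<le> flat m x"
  by (simp add: flat_def)

lemma flat_le_1: "flat 0 x \<le> 1"
  by (simp add: flat_def)

lemma box_bump_bounded: "\<bar>box_bump a b n x\<bar> \<le> 1"
  unfolding box_bump_def abs_prod
  by (intro prod_le_1) (auto simp: abs_mult flat_nonneg flat_le_1 mult_le_one)

lemma box_bump_eq_0: "x \<notin> box a b \<Longrightarrow> box_bump a b n x = 0"
  unfolding box_bump_def
  by (rule prod_zero) (auto simp: mem_box flat_def zero_less_mult_iff)

lemma test_function_box_bump:
  assumes "cbox a b \<subseteq> \<Omega>"
  shows "test_function \<Omega> (box_bump a b n)"
proof (rule test_functionI)
  show "smooth (box_bump a b n)"
    unfolding box_bump_def[abs_def]
    by (intro smooth_prod smooth_mult smooth_flat smooth_diff smooth_const smooth_inner_left)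
  show "box_bump a b n x = 0" if "x \<notin> cbox a b" for x
    using that box_subset_cbox by (intro box_bump_eq_0) blast
qed (use assms in auto)

lemma box_bump_LIMSEQ: "(\<lambda>n. box_bump a b n x) \<longlonglongrightarrow> indicat_real (box a b) x"
proof (cases "x \<in> box a b")
  case True
  have *: "(\<lambda>n. flat 0 (real (Suc n) * c)) \<longlonglongrightarrow> 1" if "c > 0" for c
  proof -
    have "(\<lambda>n. exp (- (inverse (real (Suc n)) * inverse c))) \<longlonglongrightarrow> exp (- (0 * inverse c))"
      by (intro tendsto_intros LIMSEQ_inverse_real_of_nat)
    then show ?thesis using that by (simp add: flat_def inverse_mult_distrib)
  qed
  have "(\<lambda>n. box_bump a b n x) \<longlonglongrightarrow> (\<Prod>i\<in>(Basis::'a set). 1 * 1)"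
    unfolding box_bump_def using True
    by (intro tendsto_prod tendsto_mult *) (auto simp: mem_box)
  then show ?thesis using True by simp
qed (simp add: box_bump_eq_0)

section \<open>Integrals over a set as integrals for the restricted measure\<close>

lemma set_integrable_lebesgue_on:
  fixes f :: "'a::euclidean_space \<Rightarrow> 'b::euclidean_space"
  assumes "S \<in> sets lebesgue"
  shows "set_integrable lebesgue S f \<longleftrightarrow> integrable (lebesgue_on S) f"
  unfolding set_integrable_def using assms by (subst integrable_restrict_space) auto

lemma set_integral_lebesgue_on:
  fixes f :: "'a::euclidean_space \<Rightarrow> 'b::euclidean_space"
  assumes "S \<in> sets lebesgue"
  shows "(LINT x:S|lebesgue. f x) = integral\<^sup>L (lebesgue_on S) f"
  unfolding set_lebesgue_integral_def using assms by (subst integral_restrict_space) auto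

lemma set_borel_measurable_lebesgue_on:
  fixes f :: "'a::euclidean_space \<Rightarrow> 'b::euclidean_space"
  assumes "S \<in> sets lebesgue"
  shows "set_borel_measurable lebesgue S f \<longleftrightarrow> f \<in> borel_measurable (lebesgue_on S)"
  unfolding set_borel_measurable_def using assms by (subst borel_measurable_restrict_space_iff) auto

lemma AE_lebesgue_on:
  assumes "S \<in> sets lebesgue"
  shows "(AE x in lebesgue_on S. P x) \<longleftrightarrow> (AE x in lebesgue. x \<in> S \<longrightarrow> P x)"
  using assms by (subst AE_restrict_space_iff) auto

text \<open>Open boxes form an intersection-stable generator of the Borel sets, and the sets over
  which F integrates to 0 form a Dynkin system; complements need that the total integral is 0. Hence
  F and 0 have the same integral over every Borel set.\<close>

lemma AE_eq_0_if_integral_boxes_eq_0: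
  fixes F :: "'a::euclidean_space \<Rightarrow> real"
  assumes F: "integrable lborel F"
    and zero: "integral\<^sup>L lborel F = 0" "\<And>a b. (LINT x:box a b|lborel. F x) = 0"
  shows "AE x in lborel. F x = 0"
proof -
  have si: "set_integrable lborel A F" if "A \<in> sets borel" for A
    using that F unfolding set_integrable_def by (intro integrable_mult_indicator) auto
  have "(LINT x:A|lborel. F x) = 0" if A: "A \<in> sets borel" for A
  proof -
    let ?G = "range (\<lambda>(a, b). box a b :: 'a set)"
    have borel: "sets borel = sigma_sets UNIV ?G"
      by (subst borel_eq_box) simp
    have "Int_stable ?G"
      unfolding Int_stable_def by (auto simp: box_Int_box)
    moreover have "?G \<subseteq> Pow UNIV" by simp
    ultimately show ?thesis
      using A[unfolded borel]
    proof (induction rule: sigma_sets_induct_disjoint)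
      case (basic A)
      then show ?case using zero by auto
    next
      case empty
      show ?case by (simp add: set_lebesgue_integral_def)
    next
      case (compl A)
      then have A: "A \<in> sets borel" by (simp add: borel)
      have "integral\<^sup>L lborel F = (LINT x:(A \<union> (UNIV - A))|lborel. F x)"
        by (simp add: set_lebesgue_integral_def)
      also have "\<dots> = (LINT x:A|lborel. F x) + (LINT x:(UNIV - A)|lborel. F x)"
        using A by (intro set_integral_Un si) auto
      finally show ?case using compl zero by simp
    next
      case (union A)
      then have A: "A i \<in> sets borel" for i by (auto simp: borel)
      have "(LINT x:(\<Union>i. A i)|lborel. F x) = (\<Sum>i. (LINT x:A i|lborel. F x))"
        using A union(1) by (intro lebesgue_integral_countable_add si)
          (auto simp: disjoint_family_on_def)
      then show ?case using union by simp
    qed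
  qed
  then have "(LINT x:A|lborel. F x) = (LINT x:A|lborel. 0)" if "A \<in> sets lborel" for A
    using that by simp
  then show ?thesis
    using density_unique_real[OF F, of "\<lambda>x. 0"] by simp
qed

text \<open>The bumps are test functions tending to the indicator of the open box, so dominated
  convergence carries the orthogonality over to that indicator.\<close>

lemma integral_box_eq_0_if_orthogonal:
  fixes f :: "'a::euclidean_space \<Rightarrow> real"
  assumes f: "locally_integrable \<Omega> f" and sub: "cbox a b \<subseteq> \<Omega>"
    and orth: "\<And>\<phi>. test_function \<Omega> \<phi> \<Longrightarrow> (LINT x:\<Omega>|lebesgue. f x * \<phi> x) = 0"
  shows "(LINT x:box a b|lebesgue. f x) = 0"
proof -
  \<comment> \<open>As f is only locally integrable, it is cut off to the closed box, which gives an
    integrable majorant.\<close>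
  let ?f = "\<lambda>x. indicat_real (cbox a b) x *\<^sub>R f x" and ?b = "box_bump a b"
  have fi: "integrable lebesgue ?f"
    using f sub unfolding locally_integrable_def set_integrable_def by auto
  have z: "(\<integral>x. ?b n x * ?f x \<partial>lebesgue) = 0" for n
  proof -
    have "(\<integral>x. ?b n x * ?f x \<partial>lebesgue) =
        (LINT x:\<Omega>|lebesgue. f x * ?b n x)"
      unfolding set_lebesgue_integral_def
    proof (rule Bochner_Integration.integral_cong)
      fix x
      show "?b n x * ?f x =
          indicat_real \<Omega> x *\<^sub>R (f x * ?b n x)"
        using sub box_subset_cbox[of a b] box_bump_eq_0[of x a b n]
        by (cases "x \<in> box a b") (auto simp: indicator_def)
    qed simp
    then show ?thesis using orth[OF test_function_box_bump[OF sub]] by simp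
  qed
  have "(\<lambda>n. \<integral>x. ?b n x * ?f x \<partial>lebesgue)
      \<longlonglongrightarrow> (\<integral>x. indicator (box a b) x * ?f x \<partial>lebesgue)"
  proof (rule integral_dominated_convergence)
    have c: "continuous_on UNIV (box_bump a b n)" for n
      using test_function_box_bump[of a b UNIV n] smooth_continuous_on test_function_smooth by blast
    show "(\<lambda>x. ?b n x * ?f x) \<in> borel_measurable lebesgue" for n
      using borel_measurable_continuous_onI[OF c, of n] fi
      by (intro borel_measurable_times borel_measurable_integrable[OF fi])
        (simp add: measurable_completion)
    show "(\<lambda>x. indicator (box a b) x * ?f x) \<in> borel_measurable lebesgue"
      by (intro borel_measurable_times borel_measurable_integrable[OF fi] borel_measurable_indicator) auto
    show "integrable lebesgue (\<lambda>x. norm (?f x))"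
      using fi by (rule integrable_norm)
    show "AE x in lebesgue. (\<lambda>n. ?b n x * ?f x) \<longlonglongrightarrow>
        indicator (box a b) x * ?f x"
      by (intro AE_I2 tendsto_intros box_bump_LIMSEQ)
    show "AE x in lebesgue. norm (?b n x * ?f x) \<le>
        norm (?f x)" for n
      using box_bump_bounded[of a b n] by (intro AE_I2) (auto simp: abs_mult intro: mult_left_le_one_le)
  qed
  then have "(\<integral>x. indicator (box a b) x * ?f x \<partial>lebesgue) = 0"
    by (simp only: z LIMSEQ_const_iff)
  moreover have "indicator (box a b) x * ?f x = indicator (box a b) x *\<^sub>R f x" for x
    using box_subset_cbox[of a b] by (auto simp: indicator_def)
  ultimately show ?thesis by (simp only: set_lebesgue_integral_def)
qed

lemma AE_eq_0_on_box_if_orthogonal: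
  fixes f :: "'a::euclidean_space \<Rightarrow> real"
  assumes f: "locally_integrable \<Omega> f" and sub: "cbox c d \<subseteq> \<Omega>"
    and orth: "\<And>\<phi>. test_function \<Omega> \<phi> \<Longrightarrow> (LINT x:\<Omega>|lebesgue. f x * \<phi> x) = 0"
  shows "AE x in lebesgue. x \<in> box c d \<longrightarrow> f x = 0"
proof -
  define F where "F x = indicator (box c d) x *\<^sub>R f x" for x
  have "set_integrable lebesgue (cbox c d) f"
    using f sub unfolding locally_integrable_def by auto
  then have F: "integrable lebesgue F"
    unfolding F_def[abs_def] set_integrable_def[symmetric]
    by (rule set_integrable_subset) (auto simp: box_subset_cbox)
  \<comment> \<open>The argument over boxes concerns the Borel measure \<open>lborel\<close>, so the
    Lebesgue measurable F is replaced by a Borel function equal to it almost everywhere.\<close>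
  obtain F' where F': "F' \<in> borel_measurable lborel" "AE x in lborel. F x = F' x"
    using completion_ex_borel_measurable_real[OF borel_measurable_integrable[OF F]] by auto
  have ae: "AE x in lebesgue. F x = F' x" using F'(2) by (rule AE_completion)
  have F'm: "F' \<in> borel_measurable lebesgue" using F'(1) by (rule measurable_completion)
  have F'i: "integrable lborel F'"
    using integrable_cong_AE_imp[OF F F'm] ae F'(1) by (simp add: integrable_completion)
  have box: "(LINT x:box a b|lborel. F' x) = 0" for a b
  proof -
    have eq1: "(LINT x:box a b|lborel. F' x) = (LINT x:box a b|lebesgue. F' x)"
      unfolding set_lebesgue_integral_def
      by (intro integral_completion[symmetric] borel_measurable_scaleR borel_measurable_indicator F'(1)) simp
    have eq2: "(LINT x:box a b|lebesgue. F' x) = (LINT x:box a b|lebesgue. F x)"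
      unfolding set_lebesgue_integral_def
    proof (rule integral_cong_AE)
      show "(\<lambda>x. indicat_real (box a b) x *\<^sub>R F' x) \<in> borel_measurable lebesgue"
        "(\<lambda>x. indicat_real (box a b) x *\<^sub>R F x) \<in> borel_measurable lebesgue"
        by (intro borel_measurable_scaleR borel_measurable_indicator F'm
            borel_measurable_integrable[OF F]; simp)+
    qed (use ae in auto)
    have eq3: "(LINT x:box a b|lebesgue. F x) = (LINT x:box a b \<inter> box c d|lebesgue. f x)"
      unfolding set_lebesgue_integral_def
      by (rule Bochner_Integration.integral_cong[OF refl]) (simp only: F_def indicator_inter_arith scaleR_scaleR)
    have eq4: "(LINT x:box a b \<inter> box c d|lebesgue. f x) = 0"
    proof (cases "box a b \<inter> box c d = {}")
      case False
      obtain a' b' where ab: "box a b \<inter> box c d = box a' b'"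
        using box_Int_box[of a b c d] by (rule that)
      have "closure (box a' b') = cbox a' b'"
        using False ab by (intro closure_box) simp
      moreover have "closure (box a' b') \<subseteq> cbox c d"
        unfolding ab[symmetric] using box_subset_cbox[of c d] by (intro closure_minimal) auto
      ultimately have "cbox a' b' \<subseteq> cbox c d" by simp
      then show ?thesis
        unfolding ab using sub by (intro integral_box_eq_0_if_orthogonal[OF f _ orth]) auto
    qed (simp add: set_lebesgue_integral_def)
    show ?thesis unfolding eq1 eq2 eq3 eq4 ..
  qed
  have "integral\<^sup>L lborel F' = integral\<^sup>L lebesgue F'" using F'(1) by (simp add: integral_completion)
  also have "\<dots> = integral\<^sup>L lebesgue F"
    by (rule integral_cong_AE) (use F'm borel_measurable_integrable[OF F] ae in auto)
  also have "\<dots> = (LINT x:box c d|lebesgue. f x)"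
    by (simp add: F_def[abs_def] set_lebesgue_integral_def)
  also have "\<dots> = 0"
    by (rule integral_box_eq_0_if_orthogonal[OF f sub orth])
  finally have "AE x in lborel. F' x = 0"
    by (intro AE_eq_0_if_integral_boxes_eq_0 F'i box)
  then have "AE x in lebesgue. F' x = 0" by (rule AE_completion)
  with ae show ?thesis
    by eventually_elim (auto simp: F_def)
qed

lemma AE_eq_0_if_orthogonal:
  fixes f :: "'a::euclidean_space \<Rightarrow> real"
  assumes "open \<Omega>" and f: "locally_integrable \<Omega> f"
    and orth: "\<And>\<phi>. test_function \<Omega> \<phi> \<Longrightarrow> (LINT x:\<Omega>|lebesgue. f x * \<phi> x) = 0"
  shows "AE x in lebesgue. x \<in> \<Omega> \<longrightarrow> f x = 0"
proof -
  obtain D where D: "countable D" "D \<subseteq> Pow \<Omega>" "\<And>X. X \<in> D \<Longrightarrow> \<exists>a b. X = cbox a b" "\<Union> D = \<Omega>"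
    using open_countable_Union_open_cbox[OF \<open>open \<Omega>\<close>] by metis
  have "\<forall>X\<in>D. AE x in lebesgue. x \<in> X \<longrightarrow> f x = 0"
  proof
    fix X assume X: "X \<in> D"
    then obtain a b where ab: "X = cbox a b" using D by metis
    have "AE x in lebesgue. x \<in> box a b \<longrightarrow> f x = 0"
      using X D ab by (intro AE_eq_0_on_box_if_orthogonal[OF f _ orth]) auto
    \<comment> \<open>The covering consists of closed boxes, the previous result is about open ones;
      the frontiers are null sets and there are countably many.\<close>
    moreover have "AE x in lebesgue. x \<notin> cbox a b - box a b"
      using negligible_frontier_interval[of a b] by (intro AE_not_in) (simp add: negligible_iff_null_sets)
    ultimately show "AE x in lebesgue. x \<in> X \<longrightarrow> f x = 0"
      by eventually_elim (auto simp: ab)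
  qed
  then have "AE x in lebesgue. \<forall>X\<in>D. x \<in> X \<longrightarrow> f x = 0"
    by (rule AE_ball_countable[OF D(1), THEN iffD2])
  then show ?thesis
  proof eventually_elim
    case (elim x)
    then show ?case unfolding D(4)[symmetric] by blast
  qed
qed

section \<open>Convergence in the p-th mean\<close>

definition Lp :: "'b measure \<Rightarrow> real \<Rightarrow> ('b \<Rightarrow> 'c::euclidean_space) \<Rightarrow> bool" where
  "Lp M p f \<longleftrightarrow> f \<in> borel_measurable M \<and> integrable M (\<lambda>x. norm (f x) powr p)"

abbreviation Lp_int :: "'b measure \<Rightarrow> real \<Rightarrow> ('b \<Rightarrow> 'c::euclidean_space) \<Rightarrow> real" where
  "Lp_int M p f \<equiv> \<integral>x. norm (f x) powr p \<partial>M"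

definition Lp_null :: "'b measure \<Rightarrow> real \<Rightarrow> (nat \<Rightarrow> 'b \<Rightarrow> 'c::euclidean_space) \<Rightarrow> bool" where
  "Lp_null M p f \<longleftrightarrow> (\<forall>n. Lp M p (f n)) \<and> (\<lambda>n. Lp_int M p (f n)) \<longlonglongrightarrow> 0"

text \<open>This crude bound replaces the Minkowski inequality. The factor 2^p does no harm, because
  only finiteness and convergence to 0 are derived from it.\<close>

lemma norm_add_powr_le:
  assumes "0 \<le> p"
  shows "norm (a + b) powr p \<le> 2 powr p * (norm a powr p + norm b powr p)"
proof -
  have "norm (a + b) powr p \<le> (2 * max (norm a) (norm b)) powr p"
    using assms norm_triangle_ineq[of a b] by (intro powr_mono2) auto
  also have "\<dots> = 2 powr p * max (norm a) (norm b) powr p" by (simp add: powr_mult le_max_iff_disj)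
  also have "\<dots> \<le> 2 powr p * (norm a powr p + norm b powr p)"
    by (intro mult_left_mono) (auto simp: max_def)
  finally show ?thesis .
qed

lemma Lp_bound:
  assumes "Lp M p g" "f \<in> borel_measurable M" "AE x in M. norm (f x) \<le> C * norm (g x)" "0 \<le> C" "0 \<le> p"
  shows "Lp M p f"
    and "Lp_int M p f \<le> C powr p * Lp_int M p g"
proof -
  have *: "AE x in M. norm (f x) powr p \<le> C powr p * norm (g x) powr p"
    using assms(3)
  proof eventually_elim
    case (elim x)
    then have "norm (f x) powr p \<le> (C * norm (g x)) powr p"
      using assms by (intro powr_mono2) auto
    then show ?case using assms by (simp add: powr_mult)
  qed
  have i: "integrable M (\<lambda>x. C powr p * norm (g x) powr p)"
    using assms(1) by (simp add: Lp_def)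
  have f: "integrable M (\<lambda>x. norm (f x) powr p)"
    by (rule Bochner_Integration.integrable_bound[OF i])
      (use assms(2) * in \<open>auto\<close>)
  then show "Lp M p f" using assms(2) by (simp add: Lp_def)
  show "Lp_int M p f \<le> C powr p * Lp_int M p g"
    using integral_mono_AE[OF f i *] by simp
qed

lemma Lp_add:
  assumes "Lp M p f" "Lp M p g" "0 \<le> p"
  shows "Lp M p (\<lambda>x. f x + g x)"
    and "(\<integral>x. norm (f x + g x) powr p \<partial>M) \<le>
      2 powr p * (Lp_int M p f + Lp_int M p g)"
proof -
  have m: "(\<lambda>x. f x + g x) \<in> borel_measurable M"
    using assms by (auto simp: Lp_def)
  have i: "integrable M (\<lambda>x. 2 powr p * (norm (f x) powr p + norm (g x) powr p))"
    using assms by (simp add: Lp_def)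
  have *: "norm (f x + g x) powr p \<le> 2 powr p * (norm (f x) powr p + norm (g x) powr p)" for x
    by (rule norm_add_powr_le[OF assms(3)])
  have f: "integrable M (\<lambda>x. norm (f x + g x) powr p)"
    by (rule Bochner_Integration.integrable_bound[OF i])
      (use m * in \<open>auto\<close>)
  then show "Lp M p (\<lambda>x. f x + g x)" using m by (simp add: Lp_def)
  show "(\<integral>x. norm (f x + g x) powr p \<partial>M) \<le>
      2 powr p * (Lp_int M p f + Lp_int M p g)"
    using integral_mono[OF f i *] assms by (simp add: Lp_def)
qed

lemma Lp_scaleR: "Lp M p f \<Longrightarrow> 0 \<le> p \<Longrightarrow> Lp M p (\<lambda>x. c *\<^sub>R f x)"
  by (rule Lp_bound(1)[where C = "\<bar>c\<bar>"]) (auto simp: Lp_def)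

lemma Lp_diff: "Lp M p f \<Longrightarrow> Lp M p g \<Longrightarrow> 0 \<le> p \<Longrightarrow> Lp M p (\<lambda>x. f x - g x)"
  using Lp_add(1)[of M p f "\<lambda>x. -1 *\<^sub>R g x"] Lp_scaleR[of M p g "-1"] by simp

lemma Lp_cong_AE:
  assumes "Lp M p f" "g \<in> borel_measurable M" "AE x in M. f x = g x" "0 \<le> p"
  shows "Lp M p g"
proof (rule Lp_bound(1)[OF assms(1,2), of 1])
  show "AE x in M. norm (g x) \<le> 1 * norm (f x)"
    using assms(3) by eventually_elim simp
qed (simp_all add: assms)

lemma Lp_null_add:
  assumes "Lp_null M p f" "Lp_null M p g" "0 \<le> p"
  shows "Lp_null M p (\<lambda>n x. f n x + g n x)"
  unfolding Lp_null_def
proof (intro conjI allI)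
  show "Lp M p (\<lambda>x. f n x + g n x)" for n
    using assms by (intro Lp_add) (auto simp: Lp_null_def)
  have "(\<lambda>n. 2 powr p * (Lp_int M p (f n) + Lp_int M p (g n)))
      \<longlonglongrightarrow> 2 powr p * (0 + 0)"
    using assms unfolding Lp_null_def by (intro tendsto_intros) auto
  then have lim: "(\<lambda>n. 2 powr p * (Lp_int M p (f n) + Lp_int M p (g n)))
      \<longlonglongrightarrow> 0" by simp
  show "(\<lambda>n. \<integral>x. norm (f n x + g n x) powr p \<partial>M) \<longlonglongrightarrow> 0"
    by (rule tendsto_sandwich[OF _ _ tendsto_const lim])
      (use assms in \<open>auto intro!: always_eventually Lp_add(2) simp: Lp_null_def\<close>)
qed

lemma Lp_null_bound:
  assumes "Lp_null M p g" "\<And>n. f n \<in> borel_measurable M"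
    "\<And>n. AE x in M. norm (f n x) \<le> C * norm (g n x)" "0 \<le> C" "0 \<le> p"
  shows "Lp_null M p f"
  unfolding Lp_null_def
proof (intro conjI allI)
  show "Lp M p (f n)" for n
    using assms by (intro Lp_bound(1)[of M p "g n" "f n" C]) (auto simp: Lp_null_def)
  have "(\<lambda>n. C powr p * Lp_int M p (g n)) \<longlonglongrightarrow> C powr p * 0"
    using assms unfolding Lp_null_def by (intro tendsto_intros) auto
  then have lim: "(\<lambda>n. C powr p * Lp_int M p (g n)) \<longlonglongrightarrow> 0" by simp
  show "(\<lambda>n. Lp_int M p (f n)) \<longlonglongrightarrow> 0"
    by (rule tendsto_sandwich[OF _ _ tendsto_const lim])
      (use assms in \<open>auto intro!: always_eventually intro: Lp_bound(2)[OF _ assms(2,3)] simp: Lp_null_def\<close>)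
qed

lemma Lp_null_dominated:
  fixes f :: "nat \<Rightarrow> 'b \<Rightarrow> 'c::euclidean_space"
  assumes "Lp M p g" "\<And>n. f n \<in> borel_measurable M"
    "\<And>n. AE x in M. norm (f n x) \<le> C * norm (g x)"
    "AE x in M. (\<lambda>n. f n x) \<longlonglongrightarrow> 0" "0 \<le> C" "0 < p"
  shows "Lp_null M p f"
  unfolding Lp_null_def
proof (intro conjI allI)
  have p: "0 \<le> p" using assms by simp
  show "Lp M p (f n)" for n
    by (rule Lp_bound(1)[OF assms(1-3,5) p])
  have "(\<lambda>n. Lp_int M p (f n)) \<longlonglongrightarrow> (\<integral>x. 0 \<partial>M)"
  proof (rule integral_dominated_convergence[where w = "\<lambda>x. C powr p * norm (g x) powr p"])
    show "integrable M (\<lambda>x. C powr p * norm (g x) powr p)"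
      using assms(1) by (simp add: Lp_def)
    show "AE x in M. (\<lambda>n. norm (f n x) powr p) \<longlonglongrightarrow> 0"
      using assms(4)
    proof eventually_elim
      case (elim x)
      then have "(\<lambda>n. norm (f n x)) \<longlonglongrightarrow> 0" by (rule tendsto_norm_zero)
      then show ?case using \<open>0 < p\<close> by (intro tendsto_zero_powrI[of _ _ _ p]) auto
    qed
    show "AE x in M. norm (norm (f n x) powr p) \<le> C powr p * norm (g x) powr p" for n
      using assms(3)[of n]
    proof eventually_elim
      case (elim x)
      then have "norm (f n x) powr p \<le> (C * norm (g x)) powr p"
        using p by (intro powr_mono2) auto
      then show ?case using assms by (simp add: powr_mult)
    qed
  qed (use assms(2) in \<open>auto\<close>)
  then show "(\<lambda>n. Lp_int M p (f n)) \<longlonglongrightarrow> 0" by simp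
qed

lemma Lp_null_subseq: "Lp_null M p f \<Longrightarrow> strict_mono r \<Longrightarrow> Lp_null M p (\<lambda>n. f (r n))"
  unfolding Lp_null_def using LIMSEQ_subseq_LIMSEQ unfolding o_def by blast

lemma Lp_null_AE_subseq:
  assumes "Lp_null M p f" "0 < p"
  shows "\<exists>r. strict_mono r \<and> (AE x in M. (\<lambda>n. f (r n) x) \<longlonglongrightarrow> 0)"
proof -
  have "\<exists>r. strict_mono r \<and> (AE x in M. (\<lambda>n. norm (f (r n) x) powr p) \<longlonglongrightarrow> 0)"
    using assms unfolding Lp_null_def Lp_def
    by (intro tendsto_L1_AE_subseq) auto
  then obtain r where r: "strict_mono r" "AE x in M. (\<lambda>n. norm (f (r n) x) powr p) \<longlonglongrightarrow> 0" by blast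
  from r(2) have "AE x in M. (\<lambda>n. f (r n) x) \<longlonglongrightarrow> 0"
  proof eventually_elim
    case (elim x)
    have "(\<lambda>n. (norm (f (r n) x) powr p) powr (1 / p)) \<longlonglongrightarrow> 0"
      using elim \<open>0 < p\<close> by (intro tendsto_zero_powrI[OF elim tendsto_const]) auto
    then have "(\<lambda>n. norm (f (r n) x)) \<longlonglongrightarrow> 0"
      using \<open>0 < p\<close> by (simp add: powr_powr)
    then show ?case by (rule tendsto_norm_zero_cancel)
  qed
  with r(1) show ?thesis by blast
qed

text \<open>For x > e the ratio x/e is at least 1, so x \<le> x (x/e)^(p-1). On a space of finite
  measure this gives control of the mean by the p-th mean without the Hoelder inequality.\<close>

lemma le_add_powr:
  fixes x :: real
  assumes "0 < e" "1 \<le> p" "0 \<le> x"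
  shows "x \<le> e + e powr (1 - p) * x powr p"
proof (cases "x \<le> e")
  case False
  then have "x powr (1 - p) \<le> e powr (1 - p)"
    using assms by (intro powr_mono2') auto
  then have "x powr (1 - p) * x powr p \<le> e powr (1 - p) * x powr p"
    by (intro mult_right_mono) auto
  then show ?thesis using False assms by (simp add: powr_add[symmetric])
qed (use assms in \<open>simp add: add_increasing2\<close>)

lemma (in finite_measure) Lp_imp_integrable:
  assumes "Lp M p f" "1 \<le> p"
  shows "integrable M f"
proof (rule Bochner_Integration.integrable_bound)
  show "integrable M (\<lambda>x. 1 + norm (f x) powr p)"
    using assms by (simp add: Lp_def)
  show "AE x in M. norm (f x) \<le> norm (1 + norm (f x) powr p)"
    using le_add_powr[of 1 p] assms by (intro AE_I2) auto
qed (use assms in \<open>simp add: Lp_def\<close>)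

lemma (in finite_measure) Lp_null_imp_L1:
  assumes "Lp_null M p f" "1 \<le> p"
  shows "(\<lambda>n. \<integral>x. norm (f n x) \<partial>M) \<longlonglongrightarrow> 0"
proof (rule LIMSEQ_I)
  fix r :: real assume r: "0 < r"
  \<comment> \<open>The constant term then contributes less than r/2. The summand 1 keeps the
    denominator positive if the space has measure 0.\<close>
  define e where "e = r / (2 * (measure M (space M) + 1))"
  have e: "0 < e" using r by (auto simp: e_def intro!: divide_pos_pos add_nonneg_pos)
  have "e * measure M (space M) < r / 2"
  proof -
    have "measure M (space M) + 1 > 0" by (intro add_nonneg_pos) auto
    then show ?thesis using r by (simp add: e_def field_simps)
  qed
  moreover have "(\<lambda>n. e powr (1 - p) * Lp_int M p (f n)) \<longlonglongrightarrow> e powr (1 - p) * 0"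
    using assms unfolding Lp_null_def by (intro tendsto_intros) auto
  then have lim: "(\<lambda>n. e powr (1 - p) * Lp_int M p (f n)) \<longlonglongrightarrow> 0"
    by simp
  obtain N where N: "\<And>n. n \<ge> N \<Longrightarrow> e powr (1 - p) * Lp_int M p (f n) < r / 2"
    using order_tendstoD(2)[OF lim, of "r / 2"] r unfolding eventually_sequentially by (auto simp del: powr_gt_zero)
  have bnd: "(\<integral>x. norm (f n x) \<partial>M) \<le> e * measure M (space M) + e powr (1 - p) * Lp_int M p (f n)" for n
  proof -
    have L: "Lp M p (f n)" using assms by (simp add: Lp_null_def)
    have "(\<integral>x. norm (f n x) \<partial>M) \<le> (\<integral>x. e + e powr (1 - p) * norm (f n x) powr p \<partial>M)"
    proof (rule integral_mono)
      show "integrable M (\<lambda>x. norm (f n x))"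
        by (intro integrable_norm Lp_imp_integrable[OF L assms(2)])
      show "integrable M (\<lambda>x. e + e powr (1 - p) * norm (f n x) powr p)"
        using L by (simp add: Lp_def)
      show "norm (f n x) \<le> e + e powr (1 - p) * norm (f n x) powr p" for x
        by (rule le_add_powr[OF e assms(2)]) simp
    qed
    also have "\<dots> = e * measure M (space M) + e powr (1 - p) * Lp_int M p (f n)"
      using L by (simp add: Lp_def)
    finally show ?thesis .
  qed
  have "(\<integral>x. norm (f n x) \<partial>M) < r" if "n \<ge> N" for n
    using bnd[of n] N[OF that] \<open>e * measure M (space M) < r / 2\<close> by linarith
  then show "\<exists>no. \<forall>n\<ge>no. norm ((\<integral>x. norm (f n x) \<partial>M) - 0) < r"
    by auto
qed

lemma (in finite_measure) Lp_null_integral_mult: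
  fixes f :: "nat \<Rightarrow> 'a \<Rightarrow> real"
  assumes "Lp_null M p f" "1 \<le> p" "z \<in> borel_measurable M" "\<And>x. x \<in> space M \<Longrightarrow> \<bar>z x\<bar> \<le> B"
  shows "(\<lambda>n. \<integral>x. f n x * z x \<partial>M) \<longlonglongrightarrow> 0"
proof (rule tendsto_rabs_zero_cancel, rule tendsto_sandwich[OF _ _ tendsto_const])
  have "(\<lambda>n. B * (\<integral>x. norm (f n x) \<partial>M)) \<longlonglongrightarrow> B * 0"
    by (intro tendsto_intros Lp_null_imp_L1[OF assms(1,2)])
  then show "(\<lambda>n. B * (\<integral>x. norm (f n x) \<partial>M)) \<longlonglongrightarrow> 0" by simp
  have fi: "integrable M (f n)" for n
    using assms by (intro Lp_imp_integrable[of p]) (auto simp: Lp_null_def)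
  have le: "norm (f n x * z x) \<le> B * norm (f n x)" if "x \<in> space M" for n x
    using mult_right_mono[OF assms(4)[OF that], of "\<bar>f n x\<bar>"] by (simp add: abs_mult mult.commute)
  have int: "integrable M (\<lambda>x. f n x * z x)" for n
  proof (rule Bochner_Integration.integrable_bound)
    show "integrable M (\<lambda>x. B * norm (f n x))" using fi by auto
    show "AE x in M. norm (f n x * z x) \<le> norm (B * norm (f n x))"
      by (intro AE_I2 order_trans[OF le]) auto
  qed (intro borel_measurable_times borel_measurable_integrable[OF fi] assms(3))
  have "\<bar>\<integral>x. f n x * z x \<partial>M\<bar> \<le> B * (\<integral>x. norm (f n x) \<partial>M)" for n
  proof -
    have 1: "norm (\<integral>x. f n x * z x \<partial>M) \<le> (\<integral>x. norm (f n x * z x) \<partial>M)"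
      by (rule integral_norm_bound)
    have 2: "(\<integral>x. norm (f n x * z x) \<partial>M) \<le> (\<integral>x. B * norm (f n x) \<partial>M)"
      by (rule integral_mono[OF integrable_norm[OF int] integrable_mult_right[OF integrable_norm[OF fi]] le])
    show ?thesis using order_trans[OF 1 2] by simp
  qed
  then show "\<forall>\<^sub>F n in sequentially. \<bar>\<integral>x. f n x * z x \<partial>M\<bar> \<le> B * (\<integral>x. norm (f n x) \<partial>M)"
    by simp
qed simp

section \<open>Weak gradients and the Sobolev space\<close>

text \<open>By completeness of Lebesgue measure. It is needed because \<open>weak_grad\<close> is
  chosen arbitrarily and known only up to null sets.\<close>

lemma borel_measurable_lebesgue_on_AE:
  fixes f :: "'a::euclidean_space \<Rightarrow> 'b::euclidean_space"
  assumes S: "S \<in> sets lebesgue" and f: "f \<in> borel_measurable (lebesgue_on S)"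
    and ae: "AE x in lebesgue_on S. f x = g x"
  shows "g \<in> borel_measurable (lebesgue_on S)"
proof -
  have "(\<lambda>x. indicator S x *\<^sub>R f x) \<in> borel_measurable lebesgue"
    using f S set_borel_measurable_lebesgue_on[OF S, of f] by (simp add: set_borel_measurable_def)
  moreover have "AE x in lebesgue. indicator S x *\<^sub>R f x = indicator S x *\<^sub>R g x"
    using ae unfolding AE_lebesgue_on[OF S] by eventually_elim (auto simp: indicator_def)
  ultimately have "(\<lambda>x. indicator S x *\<^sub>R g x) \<in> borel_measurable lebesgue"
    by (rule borel_measurable_AE)
  then show ?thesis
    using set_borel_measurable_lebesgue_on[OF S, of g] by (simp add: set_borel_measurable_def)
qed

lemma locally_integrable_compact_support:
  fixes f :: "'a::euclidean_space \<Rightarrow> 'b::euclidean_space"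
  assumes f: "locally_integrable \<Omega> f" and K: "compact K" "K \<subseteq> \<Omega>"
    and c: "continuous_on UNIV c" "\<And>x. x \<notin> K \<Longrightarrow> c x = 0"
  shows "set_integrable lebesgue \<Omega> (\<lambda>x. c x *\<^sub>R f x)"
proof -
  have "compact (c ` K)" using c K by (blast intro: compact_continuous_image continuous_on_subset)
  then obtain B where B: "\<And>x. x \<in> K \<Longrightarrow> norm (c x) \<le> B"
    by (fastforce dest!: compact_imp_bounded simp: bounded_iff)
  have fK: "integrable lebesgue (\<lambda>x. indicator K x *\<^sub>R f x)"
    using f K unfolding locally_integrable_def set_integrable_def by blast
  have cm: "c \<in> borel_measurable lebesgue"
    using borel_measurable_continuous_onI[OF c(1)] by (simp add: measurable_completion)
  have "integrable lebesgue (\<lambda>x. c x *\<^sub>R (indicator K x *\<^sub>R f x))"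
  proof (rule Bochner_Integration.integrable_bound)
    show "integrable lebesgue (\<lambda>x. B *\<^sub>R norm (indicator K x *\<^sub>R f x))"
      by (intro integrable_scaleR_right integrable_norm fK)
    show "AE x in lebesgue. norm (c x *\<^sub>R indicat_real K x *\<^sub>R f x) \<le>
        norm (B *\<^sub>R norm (indicat_real K x *\<^sub>R f x))"
    proof (rule AE_I2)
      fix x
      show "norm (c x *\<^sub>R indicat_real K x *\<^sub>R f x) \<le> norm (B *\<^sub>R norm (indicat_real K x *\<^sub>R f x))"
        using B[of x] by (cases "x \<in> K") (auto intro: mult_right_mono)
    qed
  qed (intro borel_measurable_scaleR cm borel_measurable_integrable[OF fK])
  moreover have "c x *\<^sub>R (indicator K x *\<^sub>R f x) = indicator \<Omega> x *\<^sub>R (c x *\<^sub>R f x)" for x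
    using K c(2)[of x] by (cases "x \<in> K") (auto simp: indicator_def)
  ultimately show ?thesis by (simp only: set_integrable_def)
qed

locale bounded_open =
  fixes \<Omega> :: "'a::euclidean_space set" and p :: real
  assumes open_dom: "open \<Omega>" and bounded_dom: "bounded \<Omega>" and p_gt_1: "1 < p"
begin

abbreviation "M \<equiv> lebesgue_on \<Omega>"

lemma sets_dom [simp]: "\<Omega> \<in> sets lebesgue"
  using open_dom by auto

lemma p_nonneg: "0 \<le> p" and p_pos: "0 < p" and p_ge_1: "1 \<le> p"
  using p_gt_1 by auto

text \<open>Boundedness of the domain makes its measure finite, so that p-integrable functions are
  integrable and convergence in the p-th mean implies convergence in mean.\<close>

sublocale finite_measure M
  by (intro finite_measure_lebesgue_on lmeasurable_open bounded_dom open_dom)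

lemma in_Lp_iff: "in_Lp p \<Omega> f \<longleftrightarrow> Lp M p f"
  by (simp add: in_Lp_def Lp_def set_borel_measurable_lebesgue_on set_integrable_lebesgue_on)

lemma continuous_measurable: "continuous_on UNIV f \<Longrightarrow> f \<in> borel_measurable M"
  by (rule continuous_imp_measurable_on_sets_lebesgue) (auto intro: continuous_on_subset)

lemma continuous_bounded:
  assumes "continuous_on UNIV f"
  shows "\<exists>B. \<forall>x\<in>\<Omega>. norm (f x) \<le> B"
proof -
  have "bounded (f ` closure \<Omega>)"
    using bounded_dom assms
    by (intro compact_imp_bounded compact_continuous_image) (auto intro: continuous_on_subset)
  then show ?thesis using closure_subset[of \<Omega>] unfolding bounded_iff by blast
qed

lemma Lp_bounded:
  assumes "f \<in> borel_measurable M" "\<And>x. x \<in> \<Omega> \<Longrightarrow> norm (f x) \<le> B"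
  shows "Lp M p f"
proof (rule Lp_bound(1)[of M p "\<lambda>x. 1::real" f "\<bar>B\<bar>"])
  show "AE x in M. norm (f x) \<le> \<bar>B\<bar> * norm (1::real)"
    by (rule AE_I2) (use assms(2) in fastforce)
qed (use assms(1) p_nonneg in \<open>auto simp: Lp_def\<close>)

lemma continuous_Lp:
  assumes "continuous_on UNIV f" shows "Lp M p f"
proof -
  obtain B where "\<forall>x\<in>\<Omega>. norm (f x) \<le> B" using continuous_bounded[OF assms] by blast
  then show ?thesis by (intro Lp_bounded continuous_measurable assms) auto
qed

lemma smooth_Lp: "smooth f \<Longrightarrow> Lp M p f" and grad_Lp: "smooth f \<Longrightarrow> Lp M p (grad f)"
  by (auto intro: continuous_Lp smooth_continuous_on continuous_on_grad)

lemma Lp_mult_continuous_integrable: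
  fixes f c :: "'a \<Rightarrow> real"
  assumes f: "Lp M p f" and c: "continuous_on UNIV c"
  shows "integrable M (\<lambda>x. f x * c x)"
proof -
  obtain B where B: "\<forall>x\<in>\<Omega>. norm (c x) \<le> B" using continuous_bounded[OF c] by blast
  have fi: "integrable M f" by (rule Lp_imp_integrable[OF f p_ge_1])
  show ?thesis
  proof (rule Bochner_Integration.integrable_bound)
    show "integrable M (\<lambda>x. B * norm (f x))"
      by (intro integrable_mult_right integrable_norm fi)
    show "AE x in M. norm (f x * c x) \<le> norm (B * norm (f x))"
    proof (rule AE_I2)
      fix x assume "x \<in> space M"
      then have "\<bar>c x\<bar> \<le> \<bar>B\<bar>" using B by force
      then show "norm (f x * c x) \<le> norm (B * norm (f x))"
        by (simp add: abs_mult mult.commute mult_right_mono)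
    qed
  qed (intro borel_measurable_times continuous_measurable c borel_measurable_integrable[OF fi])
qed

lemma Lp_inner: "Lp M p f \<Longrightarrow> Lp M p (\<lambda>x. f x \<bullet> e)"
proof (rule Lp_bound(1)[of M p f _ "norm e"])
  show "AE x in M. norm (f x \<bullet> e) \<le> norm e * norm (f x)"
    using Cauchy_Schwarz_ineq2[of "f _" e] by (intro AE_I2) (simp add: mult.commute)
qed (auto simp: p_nonneg Lp_def)

lemma Lp_imp_locally_integrable:
  assumes "Lp M p f" shows "locally_integrable \<Omega> f"
  unfolding locally_integrable_def
proof (intro allI impI)
  fix K assume K: "compact K \<and> K \<subseteq> \<Omega>"
  have "set_integrable lebesgue \<Omega> f"
    using Lp_imp_integrable[OF assms p_ge_1] by (simp add: set_integrable_lebesgue_on)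
  then show "set_integrable lebesgue K f"
    by (rule set_integrable_subset) (use K in \<open>auto simp: compact_imp_closed\<close>)
qed

text \<open>The product of \<phi> and \<zeta> is again a test function, so the integral of its
  gradient vanishes. The factor \<zeta> ranges over all smooth functions, coordinate functions
  included.\<close>

lemma test_function_by_parts:
  assumes \<phi>: "test_function \<Omega> \<phi>" and \<zeta>: "smooth \<zeta>"
  shows "(\<integral>x. \<phi> x * (grad \<zeta> x \<bullet> e) \<partial>M) = - (\<integral>x. (grad \<phi> x \<bullet> e) * \<zeta> x \<partial>M)"
proof -
  let ?c = "\<lambda>x. \<phi> x * \<zeta> x"
  note s = test_function_smooth[OF \<phi>]
  have t: "test_function \<Omega> ?c" by (rule test_function_mult[OF \<phi> \<zeta>])
  obtain K where K: "compact K \<and> K \<subseteq> \<Omega> \<and> (\<forall>x. x \<notin> K \<longrightarrow> \<phi> x * \<zeta> x = 0 \<and> grad ?c x = 0)"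
    using test_function_support[OF t] by blast
  have i1: "integrable M (\<lambda>x. \<phi> x * (grad \<zeta> x \<bullet> e))"
    by (intro Lp_mult_continuous_integrable smooth_Lp s continuous_intros continuous_on_grad \<zeta>)
  have i2: "integrable M (\<lambda>x. (grad \<phi> x \<bullet> e) * \<zeta> x)"
    by (intro Lp_mult_continuous_integrable Lp_inner grad_Lp s smooth_continuous_on \<zeta>)
  have eq: "grad ?c x \<bullet> e = \<phi> x * (grad \<zeta> x \<bullet> e) + (grad \<phi> x \<bullet> e) * \<zeta> x" for x
    by (simp add: grad_mult s \<zeta> inner_add_left)
  have "(\<integral>x. grad ?c x \<bullet> e \<partial>M) = integral \<Omega> (\<lambda>x. grad ?c x \<bullet> e)"
    unfolding eq by (rule lebesgue_integral_eq_integral) (use i1 i2 in auto)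
  also have "\<dots> = integral UNIV (\<lambda>x. grad ?c x \<bullet> e)"
  proof (rule integral_spike_set)
    have "{x \<in> \<Omega> - UNIV. grad ?c x \<bullet> e \<noteq> 0} = {}" "{x \<in> UNIV - \<Omega>. grad ?c x \<bullet> e \<noteq> 0} = {}"
      using K by fastforce+
    then show "negligible {x \<in> \<Omega> - UNIV. grad ?c x \<bullet> e \<noteq> 0}" "negligible {x \<in> UNIV - \<Omega>. grad ?c x \<bullet> e \<noteq> 0}"
      by (simp_all only: negligible_empty)
  qed
  also have "\<dots> = 0" by (rule integral_grad_test_function[OF t])
  finally show ?thesis using i1 i2 by (simp add: eq)
qed

text \<open>For a function vanishing outside the domain, \<open>W u S\<close> says that it belongs to the closure of the
  test functions and has gradient \<open>S\<close>.\<close>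

definition W :: "('a \<Rightarrow> real) \<Rightarrow> ('a \<Rightarrow> 'a) \<Rightarrow> bool" where
  "W u S \<longleftrightarrow> Lp M p u \<and> Lp M p S \<and> (\<exists>\<phi>. (\<forall>n. test_function \<Omega> (\<phi> n)) \<and>
     Lp_null M p (\<lambda>n x. u x - \<phi> n x) \<and> Lp_null M p (\<lambda>n x. S x - grad (\<phi> n) x))"

text \<open>The identity passes to the limit from the approximating test functions, since \<zeta>
  and its gradient are bounded on the bounded domain. That \<zeta> may be nonzero at the boundary
  expresses the zero boundary values of u.\<close>

lemma W_by_parts:
  assumes W: "W u S" and \<zeta>: "smooth \<zeta>"
  shows "(\<integral>x. u x * (grad \<zeta> x \<bullet> e) \<partial>M) = - (\<integral>x. (S x \<bullet> e) * \<zeta> x \<partial>M)"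
proof -
  obtain \<phi> where \<phi>: "\<And>n. test_function \<Omega> (\<phi> n)" "Lp_null M p (\<lambda>n x. u x - \<phi> n x)"
    "Lp_null M p (\<lambda>n x. S x - grad (\<phi> n) x)" and u: "Lp M p u" and S: "Lp M p S"
    using W unfolding W_def by blast
  note s = test_function_smooth[OF \<phi>(1)]
  have cz: "continuous_on UNIV \<zeta>" and cg: "continuous_on UNIV (\<lambda>x. grad \<zeta> x \<bullet> e)"
    by (intro continuous_intros continuous_on_grad smooth_continuous_on \<zeta>)+
  obtain B1 where B1: "\<forall>x\<in>\<Omega>. norm (\<zeta> x) \<le> B1" using continuous_bounded[OF cz] by blast
  obtain B2 where B2: "\<forall>x\<in>\<Omega>. norm (grad \<zeta> x \<bullet> e) \<le> B2" using continuous_bounded[OF cg] by blast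
  have null: "Lp_null M p (\<lambda>n x. (S x - grad (\<phi> n) x) \<bullet> e)"
  proof (rule Lp_null_bound[OF \<phi>(3), of _ "norm e"])
    show "(\<lambda>x. (S x - grad (\<phi> n) x) \<bullet> e) \<in> borel_measurable M" for n
      using Lp_inner[OF Lp_diff[OF S grad_Lp[OF s] p_nonneg]] by (simp add: Lp_def)
    show "AE x in M. norm ((S x - grad (\<phi> n) x) \<bullet> e) \<le> norm e * norm (S x - grad (\<phi> n) x)" for n
      using Cauchy_Schwarz_ineq2[of "S _ - grad (\<phi> n) _" e] by (intro AE_I2) (simp add: mult.commute)
  qed (auto simp: p_nonneg)
  have l1: "(\<lambda>n. \<integral>x. (u x - \<phi> n x) * (grad \<zeta> x \<bullet> e) \<partial>M) \<longlonglongrightarrow> 0"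
    by (rule Lp_null_integral_mult[OF \<phi>(2) p_ge_1 continuous_measurable[OF cg], of B2]) (use B2 in auto)
  have l2: "(\<lambda>n. \<integral>x. ((S x - grad (\<phi> n) x) \<bullet> e) * \<zeta> x \<partial>M) \<longlonglongrightarrow> 0"
    by (rule Lp_null_integral_mult[OF null p_ge_1 continuous_measurable[OF cz], of B1]) (use B1 in auto)
  \<comment> \<open>The terms with \<phi> cancel by integration by parts, so a sequence tending to 0
    is constant, and its value is the claimed defect.\<close>
  have "(\<integral>x. (u x - \<phi> n x) * (grad \<zeta> x \<bullet> e) \<partial>M) + (\<integral>x. ((S x - grad (\<phi> n) x) \<bullet> e) * \<zeta> x \<partial>M) =
      (\<integral>x. u x * (grad \<zeta> x \<bullet> e) \<partial>M) + (\<integral>x. (S x \<bullet> e) * \<zeta> x \<partial>M)" for n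
  proof -
    have i1: "integrable M (\<lambda>x. u x * (grad \<zeta> x \<bullet> e))"
      using u cg by (rule Lp_mult_continuous_integrable)
    have i2: "integrable M (\<lambda>x. \<phi> n x * (grad \<zeta> x \<bullet> e))"
      using smooth_Lp[OF s] cg by (rule Lp_mult_continuous_integrable)
    have i3: "integrable M (\<lambda>x. (S x \<bullet> e) * \<zeta> x)"
      by (rule Lp_mult_continuous_integrable[OF Lp_inner[OF S] cz])
    have i4: "integrable M (\<lambda>x. (grad (\<phi> n) x \<bullet> e) * \<zeta> x)"
      by (rule Lp_mult_continuous_integrable[OF Lp_inner[OF grad_Lp[OF s]] cz])
    have a1: "(\<integral>x. (u x - \<phi> n x) * (grad \<zeta> x \<bullet> e) \<partial>M) = (\<integral>x. u x * (grad \<zeta> x \<bullet> e) \<partial>M) - (\<integral>x. \<phi> n x * (grad \<zeta> x \<bullet> e) \<partial>M)"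
      unfolding left_diff_distrib by (rule Bochner_Integration.integral_diff[OF i1 i2])
    have a2: "(\<integral>x. ((S x - grad (\<phi> n) x) \<bullet> e) * \<zeta> x \<partial>M) = (\<integral>x. (S x \<bullet> e) * \<zeta> x \<partial>M) - (\<integral>x. (grad (\<phi> n) x \<bullet> e) * \<zeta> x \<partial>M)"
      unfolding left_diff_distrib inner_diff_left by (rule Bochner_Integration.integral_diff[OF i3 i4])
    show ?thesis
      unfolding a1 a2 using test_function_by_parts[OF \<phi>(1)[of n] \<zeta>, of e] by linarith
  qed
  then have "(\<lambda>n. (\<integral>x. u x * (grad \<zeta> x \<bullet> e) \<partial>M) + (\<integral>x. (S x \<bullet> e) * \<zeta> x \<partial>M)) \<longlonglongrightarrow> 0 + 0"
    using tendsto_add[OF l1 l2] by simp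
  then show ?thesis by (simp add: LIMSEQ_const_iff)
qed

section \<open>Uniqueness and differences of weak gradients\<close>

lemma has_weak_gradient_iff:
  "has_weak_gradient \<Omega> u w \<longleftrightarrow> locally_integrable \<Omega> u \<and> locally_integrable \<Omega> w \<and>
     (\<forall>\<phi>. test_function \<Omega> \<phi> \<longrightarrow> (\<forall>i\<in>Basis.
        (\<integral>x. u x * (grad \<phi> x \<bullet> i) \<partial>M) = - (\<integral>x. (w x \<bullet> i) * \<phi> x \<partial>M)))"
  by (simp add: has_weak_gradient_def set_integral_lebesgue_on grad_inner_Basis)

lemma W_has_weak_gradient: "W u S \<Longrightarrow> has_weak_gradient \<Omega> u S"
  unfolding has_weak_gradient_iff
  by (intro conjI allI impI ballI W_by_parts test_function_smooth Lp_imp_locally_integrable)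
    (simp_all add: W_def)

lemma integrable_mult_test_function:
  fixes f :: "'a \<Rightarrow> 'b::euclidean_space"
  assumes f: "locally_integrable \<Omega> f" and \<phi>: "test_function \<Omega> \<phi>"
  shows "integrable M (\<lambda>x. \<phi> x *\<^sub>R f x)" "integrable M (\<lambda>x. (grad \<phi> x \<bullet> e) *\<^sub>R f x)"
proof -
  obtain K where K: "compact K \<and> K \<subseteq> \<Omega> \<and> (\<forall>x. x \<notin> K \<longrightarrow> \<phi> x = 0 \<and> grad \<phi> x = 0)"
    using test_function_support[OF \<phi>] by blast
  have c: "continuous_on UNIV \<phi>" "continuous_on UNIV (\<lambda>x. grad \<phi> x \<bullet> e)"
    by (intro continuous_intros continuous_on_grad smooth_continuous_on test_function_smooth[OF \<phi>])+
  show "integrable M (\<lambda>x. \<phi> x *\<^sub>R f x)" "integrable M (\<lambda>x. (grad \<phi> x \<bullet> e) *\<^sub>R f x)"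
    unfolding set_integrable_lebesgue_on[OF sets_dom, symmetric]
    by (rule locally_integrable_compact_support[OF f, of K]; use K c in simp)+
qed

lemma locally_integrable_diff:
  assumes "locally_integrable \<Omega> f" "locally_integrable \<Omega> g"
  shows "locally_integrable \<Omega> (\<lambda>x. f x - g x)"
  using assms unfolding locally_integrable_def by (blast intro: set_integral_diff(1))

lemma locally_integrable_inner:
  assumes "locally_integrable \<Omega> f"
  shows "locally_integrable \<Omega> (\<lambda>x. f x \<bullet> e)"
  unfolding locally_integrable_def
proof (intro allI impI)
  fix K assume "compact K \<and> K \<subseteq> \<Omega>"
  then have "integrable lebesgue (\<lambda>x. indicator K x *\<^sub>R f x)"
    using assms unfolding locally_integrable_def set_integrable_def by blast
  then have "integrable lebesgue (\<lambda>x. (indicator K x *\<^sub>R f x) \<bullet> e)"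
    by (rule integrable_inner_left)
  then show "set_integrable lebesgue K (\<lambda>x. f x \<bullet> e)" by (simp add: set_integrable_def)
qed

text \<open>Each component of the difference of two weak gradients is orthogonal to all test
  functions, so the fundamental lemma applies.\<close>

lemma has_weak_gradient_unique:
  assumes "has_weak_gradient \<Omega> u w" "has_weak_gradient \<Omega> u w'"
  shows "AE x in M. w x = w' x"
proof -
  have li: "locally_integrable \<Omega> w" "locally_integrable \<Omega> w'"
    using assms by (simp_all add: has_weak_gradient_iff)
  have "AE x in M. w x \<bullet> i - w' x \<bullet> i = 0" if i: "i \<in> Basis" for i
    unfolding AE_lebesgue_on[OF sets_dom]
  proof (rule AE_eq_0_if_orthogonal[OF open_dom])
    show "locally_integrable \<Omega> (\<lambda>x. w x \<bullet> i - w' x \<bullet> i)"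
      by (intro locally_integrable_diff locally_integrable_inner li)
    fix \<phi> assume \<phi>: "test_function \<Omega> \<phi>"
    have int: "integrable M (\<lambda>x. (w x \<bullet> i) * \<phi> x)" "integrable M (\<lambda>x. (w' x \<bullet> i) * \<phi> x)"
      using integrable_mult_test_function(1)[OF locally_integrable_inner[OF li(1)] \<phi>]
        integrable_mult_test_function(1)[OF locally_integrable_inner[OF li(2)] \<phi>]
      by (simp_all add: mult.commute)
    have "(\<integral>x. u x * (grad \<phi> x \<bullet> i) \<partial>M) = - (\<integral>x. (w x \<bullet> i) * \<phi> x \<partial>M)"
      "(\<integral>x. u x * (grad \<phi> x \<bullet> i) \<partial>M) = - (\<integral>x. (w' x \<bullet> i) * \<phi> x \<partial>M)"
      using assms \<phi> i unfolding has_weak_gradient_iff by blast+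
    moreover have "(\<integral>x. (w x \<bullet> i - w' x \<bullet> i) * \<phi> x \<partial>M) =
        (\<integral>x. (w x \<bullet> i) * \<phi> x \<partial>M) - (\<integral>x. (w' x \<bullet> i) * \<phi> x \<partial>M)"
      unfolding left_diff_distrib by (rule Bochner_Integration.integral_diff[OF int])
    ultimately show "(LINT x:\<Omega>|lebesgue. (w x \<bullet> i - w' x \<bullet> i) * \<phi> x) = 0"
      unfolding set_integral_lebesgue_on[OF sets_dom] by linarith
  qed
  then have "AE x in M. \<forall>i\<in>Basis. w x \<bullet> i - w' x \<bullet> i = 0"
    by (intro AE_finite_allI) auto
  then show ?thesis
    by eventually_elim (auto intro: euclidean_eqI)
qed

lemma has_weak_gradient_diff:
  assumes "has_weak_gradient \<Omega> u w" "has_weak_gradient \<Omega> v w'"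
  shows "has_weak_gradient \<Omega> (\<lambda>x. u x - v x) (\<lambda>x. w x - w' x)"
  unfolding has_weak_gradient_iff
proof (intro conjI allI impI ballI)
  have li: "locally_integrable \<Omega> w" "locally_integrable \<Omega> w'"
     "locally_integrable \<Omega> u" "locally_integrable \<Omega> v"
    using assms by (simp_all add: has_weak_gradient_iff)
  then show "locally_integrable \<Omega> (\<lambda>x. u x - v x)" "locally_integrable \<Omega> (\<lambda>x. w x - w' x)"
    by (simp_all add: locally_integrable_diff)
  fix \<phi> and i :: 'a assume \<phi>: "test_function \<Omega> \<phi>" and i: "i \<in> Basis"
  have int: "integrable M (\<lambda>x. (w x \<bullet> i) * \<phi> x)" "integrable M (\<lambda>x. (w' x \<bullet> i) * \<phi> x)"
    "integrable M (\<lambda>x. u x * (grad \<phi> x \<bullet> i))" "integrable M (\<lambda>x. v x * (grad \<phi> x \<bullet> i))"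
    using integrable_mult_test_function(1)[OF locally_integrable_inner[OF li(1)] \<phi>]
      integrable_mult_test_function(1)[OF locally_integrable_inner[OF li(2)] \<phi>]
      integrable_mult_test_function(2)[OF li(3) \<phi>] integrable_mult_test_function(2)[OF li(4) \<phi>]
    by (simp_all add: mult.commute)
  have "(\<integral>x. u x * (grad \<phi> x \<bullet> i) \<partial>M) = - (\<integral>x. (w x \<bullet> i) * \<phi> x \<partial>M)"
    "(\<integral>x. v x * (grad \<phi> x \<bullet> i) \<partial>M) = - (\<integral>x. (w' x \<bullet> i) * \<phi> x \<partial>M)"
    using assms \<phi> i by (simp_all add: has_weak_gradient_iff)
  moreover have "(\<integral>x. (u x - v x) * (grad \<phi> x \<bullet> i) \<partial>M) =
      (\<integral>x. u x * (grad \<phi> x \<bullet> i) \<partial>M) - (\<integral>x. v x * (grad \<phi> x \<bullet> i) \<partial>M)"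
    unfolding left_diff_distrib by (rule Bochner_Integration.integral_diff[OF int(3,4)])
  moreover have "(\<integral>x. ((w x - w' x) \<bullet> i) * \<phi> x \<partial>M) =
      (\<integral>x. (w x \<bullet> i) * \<phi> x \<partial>M) - (\<integral>x. (w' x \<bullet> i) * \<phi> x \<partial>M)"
    unfolding left_diff_distrib inner_diff_left by (rule Bochner_Integration.integral_diff[OF int(1,2)])
  ultimately show "(\<integral>x. (u x - v x) * (grad \<phi> x \<bullet> i) \<partial>M) = - (\<integral>x. ((w x - w' x) \<bullet> i) * \<phi> x \<partial>M)"
    by linarith
qed

section \<open>The space \<open>sobolev0\<close> expressed through \<open>W\<close>\<close>

lemma weak_grad_eq:
  assumes "has_weak_gradient \<Omega> u S"
  shows "AE x in M. weak_grad \<Omega> u x = S x"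
proof -
  have "has_weak_gradient \<Omega> u (weak_grad \<Omega> u)"
    unfolding weak_grad_def by (rule someI[of "has_weak_gradient \<Omega> u", OF assms])
  then show ?thesis using assms by (rule has_weak_gradient_unique)
qed

lemma sobolev_norm_eq:
  assumes "has_weak_gradient \<Omega> u S" "S \<in> borel_measurable M"
  shows "sobolev_norm p \<Omega> u =
    ((\<integral>x. \<bar>u x\<bar> powr p \<partial>M) + Lp_int M p S) powr (1 / p)"
proof -
  note ae = weak_grad_eq[OF assms(1)]
  have "weak_grad \<Omega> u \<in> borel_measurable M"
    by (rule borel_measurable_lebesgue_on_AE[OF sets_dom assms(2)]) (use ae in eventually_elim, simp)
  then have "(\<integral>x. norm (weak_grad \<Omega> u x) powr p \<partial>M) = Lp_int M p S"
    using assms(2) by (intro integral_cong_AE) (use ae in \<open>auto elim: eventually_mono\<close>)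
  then show ?thesis by (simp add: sobolev_norm_def set_integral_lebesgue_on)
qed

lemma test_function_has_weak_gradient:
  assumes "test_function \<Omega> \<phi>" shows "has_weak_gradient \<Omega> \<phi> (grad \<phi>)"
  unfolding has_weak_gradient_iff
  by (intro conjI allI impI ballI test_function_by_parts[OF assms] test_function_smooth
      Lp_imp_locally_integrable smooth_Lp grad_Lp test_function_smooth[OF assms])

text \<open>Approximants with error below 1/(n+1) give the required sequence, because the p-th power
  of the Sobolev norm bounds both error integrals.\<close>

lemma sobolev0_imp_W:
  assumes "u \<in> sobolev0 p \<Omega>"
  shows "W u (weak_grad \<Omega> u)"
proof -
  obtain S where S: "has_weak_gradient \<Omega> u S" "Lp M p S" and u: "Lp M p u"
    using assms by (auto simp: sobolev0_def sobolev_def in_Lp_iff)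
  \<comment> \<open>The chosen gradient need not be the p-integrable one supplied by membership in
    \<open>sobolev\<close>; uniqueness up to null sets transfers measurability and integrability to
    it.\<close>
  let ?S = "weak_grad \<Omega> u"
  have hw: "has_weak_gradient \<Omega> u ?S"
    unfolding weak_grad_def by (rule someI[of "has_weak_gradient \<Omega> u", OF S(1)])
  have m: "?S \<in> borel_measurable M"
    by (rule borel_measurable_lebesgue_on_AE[OF sets_dom _ has_weak_gradient_unique[OF S(1) hw]])
      (use S(2) in \<open>simp add: Lp_def\<close>)
  have LS: "Lp M p ?S"
    by (rule Lp_cong_AE[OF S(2) m has_weak_gradient_unique[OF S(1) hw] p_nonneg])
  have "\<forall>n. \<exists>\<phi>. test_function \<Omega> \<phi> \<and> sobolev_norm p \<Omega> (\<lambda>x. u x - \<phi> x) < inverse (real (Suc n))"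
    using assms unfolding sobolev0_def by simp
  from choice[OF this] obtain \<phi>
    where *: "\<forall>n. test_function \<Omega> (\<phi> n) \<and> sobolev_norm p \<Omega> (\<lambda>x. u x - \<phi> n x) < inverse (real (Suc n))" ..
  have \<phi>: "test_function \<Omega> (\<phi> n)"
    and small: "sobolev_norm p \<Omega> (\<lambda>x. u x - \<phi> n x) < inverse (real (Suc n))" for n
    using * by simp_all
  note s = test_function_smooth[OF \<phi>]
  have L1: "Lp M p (\<lambda>x. u x - \<phi> n x)" and L2: "Lp M p (\<lambda>x. ?S x - grad (\<phi> n) x)" for n
    by (rule Lp_diff[OF u smooth_Lp[OF s] p_nonneg], rule Lp_diff[OF LS grad_Lp[OF s] p_nonneg])
  let ?a = "\<lambda>n. \<integral>x. norm (u x - \<phi> n x) powr p \<partial>M"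
  let ?b = "\<lambda>n. \<integral>x. norm (?S x - grad (\<phi> n) x) powr p \<partial>M"
  have nn: "0 \<le> ?a n" "0 \<le> ?b n" for n by simp_all
  have le: "?a n + ?b n \<le> inverse (real (Suc n)) powr p" for n
  proof -
    have "sobolev_norm p \<Omega> (\<lambda>x. u x - \<phi> n x) = ((\<integral>x. \<bar>u x - \<phi> n x\<bar> powr p \<partial>M) + ?b n) powr (1 / p)"
      by (rule sobolev_norm_eq[OF has_weak_gradient_diff[OF hw test_function_has_weak_gradient[OF \<phi>]]])
        (use L2[of n] in \<open>simp add: Lp_def\<close>)
    then have "(?a n + ?b n) powr (1 / p) \<le> inverse (real (Suc n))"
      using small[of n] unfolding real_norm_def by linarith
    then have "((?a n + ?b n) powr (1 / p)) powr p \<le> inverse (real (Suc n)) powr p"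
      by (intro powr_mono2 p_nonneg) auto
    then show ?thesis using nn[of n] p_pos by (simp add: powr_powr)
  qed
  have lim: "(\<lambda>n. inverse (real (Suc n)) powr p) \<longlonglongrightarrow> 0"
    by (rule tendsto_zero_powrI[OF LIMSEQ_inverse_real_of_nat tendsto_const]) (auto simp: p_pos)
  have "?a \<longlonglongrightarrow> 0" "?b \<longlonglongrightarrow> 0"
  proof -
    show "?a \<longlonglongrightarrow> 0"
    proof (rule tendsto_sandwich[OF _ _ tendsto_const lim])
      show "\<forall>\<^sub>F n in sequentially. ?a n \<le> inverse (real (Suc n)) powr p"
        by (intro always_eventually allI order_trans[OF _ le] add_increasing2 nn order_refl)
    qed simp
    show "?b \<longlonglongrightarrow> 0"
    proof (rule tendsto_sandwich[OF _ _ tendsto_const lim])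
      show "\<forall>\<^sub>F n in sequentially. ?b n \<le> inverse (real (Suc n)) powr p"
        by (intro always_eventually allI order_trans[OF _ le] add_increasing nn order_refl)
    qed simp
  qed
  then show ?thesis unfolding W_def Lp_null_def using u LS \<phi> L1 L2 by blast
qed

lemma W_imp_sobolev0:
  assumes W: "W u S" and out: "\<And>x. x \<notin> \<Omega> \<Longrightarrow> u x = 0"
  shows "u \<in> sobolev0 p \<Omega>"
proof -
  obtain \<phi> where \<phi>: "\<And>n. test_function \<Omega> (\<phi> n)" "Lp_null M p (\<lambda>n x. u x - \<phi> n x)"
    "Lp_null M p (\<lambda>n x. S x - grad (\<phi> n) x)" and u: "Lp M p u" and S: "Lp M p S"
    using W unfolding W_def by blast
  note hw = W_has_weak_gradient[OF W]
  let ?a = "\<lambda>n. \<integral>x. norm (u x - \<phi> n x) powr p \<partial>M"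
  let ?b = "\<lambda>n. \<integral>x. norm (S x - grad (\<phi> n) x) powr p \<partial>M"
  have nrm: "sobolev_norm p \<Omega> (\<lambda>x. u x - \<phi> n x) = (?a n + ?b n) powr (1 / p)" for n
    unfolding real_norm_def
    by (rule sobolev_norm_eq[OF has_weak_gradient_diff[OF hw test_function_has_weak_gradient[OF \<phi>(1)]]])
      (use \<phi>(3) in \<open>simp add: Lp_def Lp_null_def\<close>)
  have "(\<lambda>n. ?a n + ?b n) \<longlonglongrightarrow> 0 + 0"
    using \<phi>(2,3) unfolding Lp_null_def by (intro tendsto_add) simp_all
  then have lim: "(\<lambda>n. ?a n + ?b n) \<longlonglongrightarrow> 0" by simp
  have "(\<lambda>n. (?a n + ?b n) powr (1 / p)) \<longlonglongrightarrow> 0"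
    by (rule tendsto_zero_powrI[OF lim tendsto_const]) (auto simp: p_pos)
  then have lim: "(\<lambda>n. sobolev_norm p \<Omega> (\<lambda>x. u x - \<phi> n x)) \<longlonglongrightarrow> 0"
    unfolding nrm .
  have approx: "\<exists>\<phi>. test_function \<Omega> \<phi> \<and> sobolev_norm p \<Omega> (\<lambda>x. u x - \<phi> x) < \<epsilon>" if "\<epsilon> > 0" for \<epsilon>
    using eventually_happens'[OF sequentially_bot order_tendstoD(2)[OF lim that]] \<phi>(1) by blast
  have "u \<in> sobolev p \<Omega>"
    using hw u S by (auto simp: sobolev_def in_Lp_iff)
  then show ?thesis
    unfolding sobolev0_def by (simp add: out approx)
qed

end

section \<open>The chain rule\<close>

text \<open>A mean value estimate: two partial derivatives bounded by C give a differential of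
  operator norm at most 2C, and the norm of a pair is at most the sum of its entries.\<close>

lemma lipschitz_from_partials:
  fixes F :: "real \<Rightarrow> real \<Rightarrow> real"
  assumes der: "\<And>z. ((\<lambda>z. F (fst z) (snd z)) has_derivative
      (\<lambda>h. A (fst z) (snd z) * fst h + B (fst z) (snd z) * snd h)) (at z)"
    and bound: "\<And>a b. \<bar>A a b\<bar> \<le> C" "\<And>a b. \<bar>B a b\<bar> \<le> C"
  shows "\<bar>F a b - F a' b'\<bar> \<le> 2 * C * (\<bar>a - a'\<bar> + \<bar>b - b'\<bar>)"
proof -
  have C: "0 \<le> C" using bound(1)[of 0 0] by linarith
  have "norm (F (fst (a, b)) (snd (a, b)) - F (fst (a', b')) (snd (a', b'))) \<le> 2 * C * norm ((a, b) - (a', b'))"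
  proof (rule differentiable_bound[where S = UNIV])
    show "((\<lambda>z. F (fst z) (snd z)) has_derivative
      (\<lambda>h. A (fst z) (snd z) * fst h + B (fst z) (snd z) * snd h)) (at z within UNIV)" for z
      using der by simp
    show "onorm (\<lambda>h. A (fst z) (snd z) * fst h + B (fst z) (snd z) * snd h) \<le> 2 * C" for z
    proof (rule onorm_bound)
      fix h :: "real \<times> real"
      have "norm (A (fst z) (snd z) * fst h + B (fst z) (snd z) * snd h) \<le>
          \<bar>A (fst z) (snd z)\<bar> * norm (fst h) + \<bar>B (fst z) (snd z)\<bar> * norm (snd h)"
        using abs_triangle_ineq by (simp add: abs_mult[symmetric])
      also have "\<dots> \<le> C * norm h + C * norm h"
        using norm_fst_le[of "fst h" "snd h"] norm_snd_le[of "snd h" "fst h"]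
        by (intro add_mono mult_mono bound C) auto
      finally show "norm (A (fst z) (snd z) * fst h + B (fst z) (snd z) * snd h) \<le> 2 * C * norm h"
        by simp
    qed (use C in simp)
  qed auto
  also have "\<dots> \<le> 2 * C * (\<bar>a - a'\<bar> + \<bar>b - b'\<bar>)"
    using norm_Pair_le[of "a - a'" "b - b'"] C by (intro mult_left_mono) auto
  finally show ?thesis by simp
qed

context bounded_open
begin

text \<open>The difference splits as (a0 - a n) S + a n (S - G n). The first term tends to 0 by
  dominated convergence with majorant 2C |S|, the second because the coefficients are uniformly
  bounded.\<close>

lemma Lp_null_scaleR:
  fixes G :: "nat \<Rightarrow> 'a \<Rightarrow> 'c::euclidean_space"
  assumes S: "Lp M p S" and G: "\<And>n. G n \<in> borel_measurable M" "Lp_null M p (\<lambda>n x. S x - G n x)"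
    and a: "\<And>n. a n \<in> borel_measurable M" "a0 \<in> borel_measurable M"
    and bound: "\<And>n x. \<bar>a n x\<bar> \<le> C"
    and lim: "AE x in M. (\<lambda>n. a n x) \<longlonglongrightarrow> a0 x"
  shows "Lp_null M p (\<lambda>n x. a0 x *\<^sub>R S x - a n x *\<^sub>R G n x)"
    and "Lp M p (\<lambda>x. a0 x *\<^sub>R S x)"
proof -
  have C: "0 \<le> C" using bound[of 0 undefined] by linarith
  have Sm: "S \<in> borel_measurable M" using S by (simp add: Lp_def)
  have a0: "AE x in M. \<bar>a0 x\<bar> \<le> C"
    using lim
  proof eventually_elim
    case (elim x)
    then show ?case
      using bound by (intro LIMSEQ_le_const2[OF tendsto_rabs]) auto
  qed
  show "Lp M p (\<lambda>x. a0 x *\<^sub>R S x)"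
  proof (rule Lp_bound(1)[OF S _ _ C p_nonneg])
    show "AE x in M. norm (a0 x *\<^sub>R S x) \<le> C * norm (S x)"
      using a0 by eventually_elim (simp add: mult_right_mono)
  qed (intro borel_measurable_scaleR a Sm)
  have "Lp_null M p (\<lambda>n x. (a0 x - a n x) *\<^sub>R S x)"
  proof (rule Lp_null_dominated[OF S])
    show "AE x in M. norm ((a0 x - a n x) *\<^sub>R S x) \<le> (2 * C) * norm (S x)" for n
      using a0
    proof eventually_elim
      case (elim x)
      then have "\<bar>a0 x - a n x\<bar> \<le> 2 * C" using bound[of n x] by linarith
      then show ?case by (simp add: mult_right_mono)
    qed
    show "AE x in M. (\<lambda>n. (a0 x - a n x) *\<^sub>R S x) \<longlonglongrightarrow> 0"
      using lim
    proof eventually_elim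
      case (elim x)
      have "(\<lambda>n. (a0 x - a n x) *\<^sub>R S x) \<longlonglongrightarrow> (a0 x - a0 x) *\<^sub>R S x"
        by (intro tendsto_intros elim)
      then show ?case by simp
    qed
  qed (use C p_pos in \<open>auto intro!: borel_measurable_scaleR borel_measurable_diff a Sm\<close>)
  moreover have "Lp_null M p (\<lambda>n x. a n x *\<^sub>R (S x - G n x))"
  proof (rule Lp_null_bound[OF G(2) _ _ C p_nonneg])
    show "AE x in M. norm (a n x *\<^sub>R (S x - G n x)) \<le> C * norm (S x - G n x)" for n
      using bound by (intro AE_I2) (simp add: mult_right_mono)
  qed (intro borel_measurable_scaleR borel_measurable_diff a Sm G)
  ultimately have "Lp_null M p (\<lambda>n x. (a0 x - a n x) *\<^sub>R S x + a n x *\<^sub>R (S x - G n x))"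
    by (rule Lp_null_add[OF _ _ p_nonneg])
  then show "Lp_null M p (\<lambda>n x. a0 x *\<^sub>R S x - a n x *\<^sub>R G n x)"
    by (simp add: algebra_simps)
qed

lemma W_sequence:
  assumes "W u S"
  shows "\<exists>\<phi>. (\<forall>n. test_function \<Omega> (\<phi> n)) \<and> Lp_null M p (\<lambda>n x. u x - \<phi> n x) \<and>
    Lp_null M p (\<lambda>n x. S x - grad (\<phi> n) x) \<and> (AE x in M. (\<lambda>n. \<phi> n x) \<longlonglongrightarrow> u x)"
proof -
  obtain \<phi> where \<phi>: "\<And>n. test_function \<Omega> (\<phi> n)" "Lp_null M p (\<lambda>n x. u x - \<phi> n x)"
    "Lp_null M p (\<lambda>n x. S x - grad (\<phi> n) x)"
    using assms unfolding W_def by blast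
  obtain r where r: "strict_mono r" "AE x in M. (\<lambda>n. u x - \<phi> (r n) x) \<longlonglongrightarrow> 0"
    using Lp_null_AE_subseq[OF \<phi>(2) p_pos] by blast
  have "AE x in M. (\<lambda>n. \<phi> (r n) x) \<longlonglongrightarrow> u x"
    using r(2)
  proof eventually_elim
    case (elim x)
    have "(\<lambda>n. u x - (u x - \<phi> (r n) x)) \<longlonglongrightarrow> u x - 0"
      by (intro tendsto_intros elim)
    then show ?case by simp
  qed
  then show ?thesis
    using \<phi>(1) Lp_null_subseq[OF \<phi>(2) r(1)] Lp_null_subseq[OF \<phi>(3) r(1)]
    by (intro exI[of _ "\<lambda>n. \<phi> (r n)"]) simp
qed

text \<open>The approximants are \<open>F n\<close> applied to the n-th test functions, so
  regularisation and approximation advance together. The test functions may take any real values,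
  hence each \<open>F n\<close> has to be smooth on the whole plane; their limits u and v are
  positive, hence convergence to \<open>F0\<close>, \<open>A0\<close>, \<open>B0\<close> is asked
  only at positive points, along arbitrary convergent arguments. The error is split at
  \<open>F n (u x) (v x)\<close>: one part is handled by dominated convergence, the other by the
  uniform Lipschitz bound.\<close>

lemma W_chain:
  fixes F A B :: "nat \<Rightarrow> real \<Rightarrow> real \<Rightarrow> real" and F0 A0 B0 :: "real \<Rightarrow> real \<Rightarrow> real"
  assumes u: "W u Su" and v: "W v Sv" and pos: "\<And>x. x \<in> \<Omega> \<Longrightarrow> 0 < u x \<and> 0 < v x"
    and smooth: "\<And>n f g. smooth f \<Longrightarrow> smooth g \<Longrightarrow> smooth (\<lambda>x::'a. F n (f x) (g x))"
    and zero: "\<And>n. F n 0 0 = 0"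
    and der: "\<And>n z. ((\<lambda>z. F n (fst z) (snd z)) has_derivative
      (\<lambda>h. A n (fst z) (snd z) * fst h + B n (fst z) (snd z) * snd h)) (at z)"
    and bound: "\<And>n a b. \<bar>A n a b\<bar> \<le> C" "\<And>n a b. \<bar>B n a b\<bar> \<le> C"
    and meas: "\<And>n (f::'a \<Rightarrow> real) g. f \<in> borel_measurable M \<Longrightarrow> g \<in> borel_measurable M \<Longrightarrow>
        (\<lambda>x. F n (f x) (g x)) \<in> borel_measurable M \<and> (\<lambda>x. A n (f x) (g x)) \<in> borel_measurable M \<and>
        (\<lambda>x. B n (f x) (g x)) \<in> borel_measurable M"
    and meas0: "\<And>(f::'a \<Rightarrow> real) g. f \<in> borel_measurable M \<Longrightarrow> g \<in> borel_measurable M \<Longrightarrow>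
        (\<lambda>x. F0 (f x) (g x)) \<in> borel_measurable M \<and> (\<lambda>x. A0 (f x) (g x)) \<in> borel_measurable M \<and>
        (\<lambda>x. B0 (f x) (g x)) \<in> borel_measurable M"
    and lim: "\<And>a b r s. 0 < a \<Longrightarrow> 0 < b \<Longrightarrow> r \<longlonglongrightarrow> a \<Longrightarrow> s \<longlonglongrightarrow> b \<Longrightarrow>
        (\<lambda>n. F n (r n) (s n)) \<longlonglongrightarrow> F0 a b \<and> (\<lambda>n. A n (r n) (s n)) \<longlonglongrightarrow> A0 a b \<and>
        (\<lambda>n. B n (r n) (s n)) \<longlonglongrightarrow> B0 a b"
  shows "W (\<lambda>x. F0 (u x) (v x)) (\<lambda>x. A0 (u x) (v x) *\<^sub>R Su x + B0 (u x) (v x) *\<^sub>R Sv x)"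
proof -
  obtain \<phi> where \<phi>: "\<And>n. test_function \<Omega> (\<phi> n)" "Lp_null M p (\<lambda>n x. u x - \<phi> n x)"
    "Lp_null M p (\<lambda>n x. Su x - grad (\<phi> n) x)" "AE x in M. (\<lambda>n. \<phi> n x) \<longlonglongrightarrow> u x"
    using W_sequence[OF u] by blast
  obtain \<psi> where \<psi>: "\<And>n. test_function \<Omega> (\<psi> n)" "Lp_null M p (\<lambda>n x. v x - \<psi> n x)"
    "Lp_null M p (\<lambda>n x. Sv x - grad (\<psi> n) x)" "AE x in M. (\<lambda>n. \<psi> n x) \<longlonglongrightarrow> v x"
    using W_sequence[OF v] by blast
  note s\<phi> = test_function_smooth[OF \<phi>(1)] and s\<psi> = test_function_smooth[OF \<psi>(1)]
  have L: "Lp M p u" "Lp M p v" "Lp M p Su" "Lp M p Sv"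
    using u v by (simp_all add: W_def)
  have m: "u \<in> borel_measurable M" "v \<in> borel_measurable M"
    using L by (simp_all add: Lp_def)
  have mt: "\<phi> n \<in> borel_measurable M" "\<psi> n \<in> borel_measurable M"
    "grad (\<phi> n) \<in> borel_measurable M" "grad (\<psi> n) \<in> borel_measurable M" for n
    by (rule continuous_measurable, intro smooth_continuous_on continuous_on_grad s\<phi> s\<psi>)+
  have C: "0 \<le> C" using bound(1)[of 0 0 0] by linarith
  have lip: "\<bar>F n a b - F n a' b'\<bar> \<le> 2 * C * (\<bar>a - a'\<bar> + \<bar>b - b'\<bar>)" for n a b a' b'
    by (rule lipschitz_from_partials[OF der bound])
  let ?A = "\<lambda>n x. A n (\<phi> n x) (\<psi> n x)" and ?B = "\<lambda>n x. B n (\<phi> n x) (\<psi> n x)"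
  let ?Fl = "\<lambda>x. F0 (u x) (v x)" and ?Al = "\<lambda>x. A0 (u x) (v x)" and ?Bl = "\<lambda>x. B0 (u x) (v x)"
    and ?F = "\<lambda>n x. F n (u x) (v x)"
  define \<eta> where "\<eta> n x = F n (\<phi> n x) (\<psi> n x)" for n x
  have test: "test_function \<Omega> (\<eta> n)" for n
    unfolding \<eta>_def[abs_def]
    by (rule test_function_binary[OF \<phi>(1) \<psi>(1) smooth[OF s\<phi> s\<psi>] zero])
  have grad: "grad (\<eta> n) x = ?A n x *\<^sub>R grad (\<phi> n) x + ?B n x *\<^sub>R grad (\<psi> n) x" for n x
  proof (rule grad_eqI)
    have "((\<lambda>x. (\<phi> n x, \<psi> n x)) has_derivative (\<lambda>y. (grad (\<phi> n) x \<bullet> y, grad (\<psi> n) x \<bullet> y))) (at x)"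
      by (intro has_derivative_Pair smooth_has_derivative_grad s\<phi> s\<psi>)
    from has_derivative_compose[OF this der[of n]]
    show "(\<eta> n has_derivative (\<lambda>y. (?A n x *\<^sub>R grad (\<phi> n) x +
        ?B n x *\<^sub>R grad (\<psi> n) x) \<bullet> y)) (at x)"
      by (simp add: \<eta>_def[abs_def] inner_add_left)
  qed
  have lim_ae: "AE x in M. (\<lambda>n. ?A n x) \<longlonglongrightarrow> ?Al x \<and>
      (\<lambda>n. ?B n x) \<longlonglongrightarrow> ?Bl x \<and> (\<lambda>n. ?F n x) \<longlonglongrightarrow> ?Fl x"
    using \<phi>(4) \<psi>(4) AE_space[of M]
  proof eventually_elim
    case (elim x)
    then have "0 < u x" "0 < v x" using pos by auto
    then show ?case using lim elim by (blast intro: tendsto_const)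
  qed
  have Luv: "Lp M p (\<lambda>x. \<bar>u x\<bar> + \<bar>v x\<bar>)"
    by (rule Lp_add(1)[OF Lp_bound(1)[OF L(1), of _ 1] Lp_bound(1)[OF L(2), of _ 1] p_nonneg])
      (use m p_nonneg in auto)
  \<comment> \<open>The Lipschitz bound together with the value 0 at the origin gives linear growth,
    which supplies the majorant |u| + |v|.\<close>
  have b\<eta>: "\<bar>?F n x\<bar> \<le> 2 * C * (\<bar>u x\<bar> + \<bar>v x\<bar>)" for n x
    using lip[of n "u x" "v x" 0 0] by (simp add: zero)
  have b0: "AE x in M. \<bar>?Fl x\<bar> \<le> 2 * C * (\<bar>u x\<bar> + \<bar>v x\<bar>)"
    using lim_ae
  proof eventually_elim
    case (elim x)
    then have "(\<lambda>n. \<bar>?F n x\<bar>) \<longlonglongrightarrow> \<bar>?Fl x\<bar>" by (intro tendsto_rabs) blast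
    then show ?case by (rule LIMSEQ_le_const2) (use b\<eta> in blast)
  qed
  have LF: "Lp M p (\<lambda>x. ?Fl x)"
    by (rule Lp_bound(1)[OF Luv _ _ _ p_nonneg, of _ "2 * C"]) (use meas0[OF m] b0 C in auto)
  have "Lp_null M p (\<lambda>n x. ?Fl x - ?F n x)"
  proof (rule Lp_null_dominated[OF Luv])
    show "(\<lambda>x. ?Fl x - ?F n x) \<in> borel_measurable M" for n
      using meas0[OF m] meas[OF m] by (intro borel_measurable_diff) auto
    show "AE x in M. norm (?Fl x - ?F n x) \<le> (4 * C) * norm (\<bar>u x\<bar> + \<bar>v x\<bar>)" for n
      using b0
    proof eventually_elim
      case (elim x)
      then have "\<bar>?Fl x - ?F n x\<bar> \<le> 2 * C * (\<bar>u x\<bar> + \<bar>v x\<bar>) + 2 * C * (\<bar>u x\<bar> + \<bar>v x\<bar>)"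
        using b\<eta>[of n x] by linarith
      then show ?case by simp
    qed
    show "AE x in M. (\<lambda>n. ?Fl x - ?F n x) \<longlonglongrightarrow> 0"
      using lim_ae
    proof eventually_elim
      case (elim x)
      then have "(\<lambda>n. ?Fl x - ?F n x) \<longlonglongrightarrow> ?Fl x - ?Fl x"
        by (intro tendsto_intros) blast
      then show ?case by simp
    qed
  qed (use C p_pos in auto)
  moreover have "Lp_null M p (\<lambda>n x. ?F n x - \<eta> n x)"
  proof (rule Lp_null_bound)
    show "Lp_null M p (\<lambda>n x. \<bar>u x - \<phi> n x\<bar> + \<bar>v x - \<psi> n x\<bar>)"
    proof (rule Lp_null_add[OF _ _ p_nonneg])
      show "Lp_null M p (\<lambda>n x. \<bar>u x - \<phi> n x\<bar>)"
        by (rule Lp_null_bound[OF \<phi>(2), of _ 1]) (use m mt p_nonneg in auto)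
      show "Lp_null M p (\<lambda>n x. \<bar>v x - \<psi> n x\<bar>)"
        by (rule Lp_null_bound[OF \<psi>(2), of _ 1]) (use m mt p_nonneg in auto)
    qed
    show "(\<lambda>x. ?F n x - \<eta> n x) \<in> borel_measurable M" for n
      unfolding \<eta>_def[abs_def]
      using meas[OF m] meas[OF mt(1,2)] by (intro borel_measurable_diff) auto
    show "AE x in M. norm (?F n x - \<eta> n x) \<le> (2 * C) * norm (\<bar>u x - \<phi> n x\<bar> + \<bar>v x - \<psi> n x\<bar>)" for n
      using lip by (intro AE_I2) (simp add: \<eta>_def)
  qed (use C p_nonneg in auto)
  ultimately have "Lp_null M p (\<lambda>n x. (?Fl x - ?F n x) + (?F n x - \<eta> n x))"
    by (rule Lp_null_add[OF _ _ p_nonneg])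
  then have null1: "Lp_null M p (\<lambda>n x. ?Fl x - \<eta> n x)" by simp
  have sA: "Lp_null M p (\<lambda>n x. ?Al x *\<^sub>R Su x - ?A n x *\<^sub>R grad (\<phi> n) x)"
      "Lp M p (\<lambda>x. ?Al x *\<^sub>R Su x)"
    by (rule Lp_null_scaleR[OF L(3) mt(3) \<phi>(3), where C = C];
        use meas0[OF m] meas[OF mt(1,2)] bound lim_ae in \<open>auto elim: eventually_mono\<close>)+
  have sB: "Lp_null M p (\<lambda>n x. ?Bl x *\<^sub>R Sv x - ?B n x *\<^sub>R grad (\<psi> n) x)"
      "Lp M p (\<lambda>x. ?Bl x *\<^sub>R Sv x)"
    by (rule Lp_null_scaleR[OF L(4) mt(4) \<psi>(3), where C = C];
        use meas0[OF m] meas[OF mt(1,2)] bound lim_ae in \<open>auto elim: eventually_mono\<close>)+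
  have null2: "Lp_null M p (\<lambda>n x. (?Al x *\<^sub>R Su x + ?Bl x *\<^sub>R Sv x) - grad (\<eta> n) x)"
    using Lp_null_add[OF sA(1) sB(1) p_nonneg] by (simp add: grad algebra_simps)
  show ?thesis
    unfolding W_def using LF Lp_add(1)[OF sA(2) sB(2) p_nonneg] test null1 null2 by blast
qed

lemma W_diff:
  assumes "W u Su" "W v Sv" "\<And>x. x \<in> \<Omega> \<Longrightarrow> 0 < u x \<and> 0 < v x"
  shows "W (\<lambda>x. u x - v x) (\<lambda>x. Su x - Sv x)"
proof -
  have "W (\<lambda>x. u x - v x) (\<lambda>x. 1 *\<^sub>R Su x + (-1) *\<^sub>R Sv x)"
    by (rule W_chain[OF assms, where F = "\<lambda>n a b. a - b" and A = "\<lambda>n a b. 1" and B = "\<lambda>n a b. -1"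
          and C = 1])
      (auto intro!: smooth_diff derivative_eq_intros tendsto_intros)
  then show ?thesis by simp
qed

text \<open>Subtracting ln e makes the regularised logarithm vanish at 0, so that it maps test
  functions to test functions. For fixed e > 0 its derivative a / (a^2 + e^2) is bounded.\<close>

lemma W_log:
  assumes "W u S" "\<And>x. x \<in> \<Omega> \<Longrightarrow> 0 < u x" and e: "0 < e"
  shows "W (\<lambda>x. ln ((u x)\<^sup>2 + e\<^sup>2) / 2 - ln e) (\<lambda>x. (u x / ((u x)\<^sup>2 + e\<^sup>2)) *\<^sub>R S x)"
proof -
  have pos: "0 < a\<^sup>2 + e\<^sup>2" for a using e by (simp add: add_nonneg_pos)
  have "W (\<lambda>x. ln ((u x)\<^sup>2 + e\<^sup>2) * (1 / 2) - ln e)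
      (\<lambda>x. (u x / ((u x)\<^sup>2 + e\<^sup>2)) *\<^sub>R S x + 0 *\<^sub>R S x)"
  \<comment> \<open>The chain rule is stated for two functions; u is used for both, with derivative
    0 in the second argument.\<close>
  proof (rule W_chain[OF assms(1,1), where F = "\<lambda>n a b. ln (a\<^sup>2 + e\<^sup>2) * (1 / 2) - ln e"
        and A = "\<lambda>n a b. a / (a\<^sup>2 + e\<^sup>2)" and B = "\<lambda>n a b. 0" and C = "1 / e"
        and ?F0.0 = "\<lambda>a b. ln (a\<^sup>2 + e\<^sup>2) * (1 / 2) - ln e" and ?A0.0 = "\<lambda>a b. a / (a\<^sup>2 + e\<^sup>2)"
        and ?B0.0 = "\<lambda>a b. 0"])
    show "smooth (\<lambda>x. ln ((f x)\<^sup>2 + e\<^sup>2) * (1 / 2) - ln e)" if "smooth f" for f :: "'a \<Rightarrow> real"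
      by (intro smooth_diff smooth_mult smooth_ln smooth_add smooth_power that smooth_const pos)
    show "ln (0\<^sup>2 + e\<^sup>2) * (1 / 2) - ln e = 0" using e by (simp add: ln_realpow)
    show "\<bar>a / (a\<^sup>2 + e\<^sup>2)\<bar> \<le> 1 / e" for a
    proof -
      have "\<bar>a\<bar> * e \<le> a\<^sup>2 + e\<^sup>2"
        using sum_squares_bound[of "\<bar>a\<bar>" e] e by (simp add: mult.assoc) (smt (verit) mult_nonneg_nonneg)
      then show ?thesis using pos[of a] e by (simp add: field_simps)
    qed
    show "((\<lambda>z. ln ((fst z)\<^sup>2 + e\<^sup>2) * (1 / 2) - ln e) has_derivative
        (\<lambda>h. fst z / ((fst z)\<^sup>2 + e\<^sup>2) * fst h + 0 * snd h)) (at z)" for z :: "real \<times> real"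
      using pos[of "fst z"]
      by (auto intro!: derivative_eq_intros ext simp: divide_simps)
    show "(\<lambda>n. ln ((r n)\<^sup>2 + e\<^sup>2) * (1 / 2) - ln e) \<longlonglongrightarrow> ln (a\<^sup>2 + e\<^sup>2) * (1 / 2) - ln e \<and>
        (\<lambda>n. r n / ((r n)\<^sup>2 + e\<^sup>2)) \<longlonglongrightarrow> a / (a\<^sup>2 + e\<^sup>2) \<and> (\<lambda>n. 0::real) \<longlonglongrightarrow> 0"
      if "r \<longlonglongrightarrow> a" for r a
      using pos[of a] that by (intro conjI tendsto_intros) auto
  qed (use assms(2) e in auto)
  then show ?thesis by simp
qed

end

section \<open>Means of order p and hidden convexity\<close>

lemma powr_above_tangent:
  fixes s c p :: real
  assumes p: "1 < p" and s: "0 \<le> s" and c: "0 < c" and ne: "s \<noteq> c"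
  shows "c powr p + p * c powr (p - 1) * (s - c) < s powr p"
proof -
  have cont: "continuous_on {l..r} (\<lambda>x. x powr p)" if "0 \<le> l" for l r :: real
    using p that by (intro continuous_on_powr' continuous_intros) auto
  have der: "((\<lambda>x. x powr p) has_derivative (\<lambda>h. h * (p * z powr (p - 1)))) (at z)" if "0 < z" for z
    by (rule has_derivative_eq_rhs[OF has_field_derivative_imp_has_derivative[OF
          has_real_derivative_powr[OF that]]]) (simp add: fun_eq_iff mult.commute)
  show ?thesis
  proof (cases "c < s")
    case True
    obtain z where z: "c < z" "z < s" "s powr p - c powr p = (s - c) * (p * z powr (p - 1))"
      using mvt[OF True cont der] c by auto
    have "(s - c) * (p * c powr (p - 1)) < (s - c) * (p * z powr (p - 1))"
      using z True p c by (intro mult_strict_left_mono powr_less_mono2) auto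
    then show ?thesis using z(3) by (simp add: algebra_simps)
  next
    case False
    then have "s < c" using ne by simp
    obtain z where z: "s < z" "z < c" "c powr p - s powr p = (c - s) * (p * z powr (p - 1))"
      using mvt[OF \<open>s < c\<close> cont der] s by auto
    have "(c - s) * (p * z powr (p - 1)) < (c - s) * (p * c powr (p - 1))"
      using z \<open>s < c\<close> p s by (intro mult_strict_left_mono powr_less_mono2) auto
    then show ?thesis using z(3) by (simp add: algebra_simps)
  qed
qed

text \<open>The triangle inequality is followed by Jensen's inequality for the p-th power, obtained
  from the tangent at the mean c of the norms. Equality forces both norms and the norm of the
  combination to be c; expanding the square then gives X \<bullet> Y = c^2, so X - Y has norm
  0.\<close>

lemma norm_convex_comb_powr:
  fixes X Y :: "'v::real_inner"
  assumes p: "1 < p" and l: "0 < l" and m: "0 < m" and lm: "l + m = 1"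
  shows "norm (l *\<^sub>R X + m *\<^sub>R Y) powr p \<le> l * norm X powr p + m * norm Y powr p"
    and "norm (l *\<^sub>R X + m *\<^sub>R Y) powr p = l * norm X powr p + m * norm Y powr p \<Longrightarrow> X = Y"
proof -
  define c where "c = l * norm X + m * norm Y"
  have tri: "norm (l *\<^sub>R X + m *\<^sub>R Y) \<le> c"
    unfolding c_def by (rule norm_triangle_le) (use l m in auto)
  have le1: "norm (l *\<^sub>R X + m *\<^sub>R Y) powr p \<le> c powr p"
    using p by (intro powr_mono2 tri) auto
  have jensen: "c powr p \<le> l * norm X powr p + m * norm Y powr p \<and>
      (c powr p = l * norm X powr p + m * norm Y powr p \<longrightarrow> norm X = c \<and> norm Y = c)"
  \<comment> \<open>The tangent exists only at c > 0; for c = 0 both vectors vanish.\<close>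
  proof (cases "c = 0")
    case True
    have "0 \<le> l * norm X" "0 \<le> m * norm Y" using l m by simp_all
    then have "l * norm X = 0" "m * norm Y = 0" using True unfolding c_def by linarith+
    then have "norm X = 0" "norm Y = 0" using l m by simp_all
    then show ?thesis using True p by simp
  next
    case False
    moreover have "0 \<le> c" unfolding c_def using l m by simp
    ultimately have c: "0 < c" by simp
    define T where "T s = c powr p + p * c powr (p - 1) * (s - c)" for s
    have T: "T s \<le> s powr p" "s \<noteq> c \<Longrightarrow> T s < s powr p" if "0 \<le> s" for s
      using powr_above_tangent[OF p that c] unfolding T_def by (cases "s = c"; force)+
    have "l * T (norm X) + m * T (norm Y) = (l + m) * c powr p + p * c powr (p - 1) * (c - (l + m) * c)"
      by (simp add: T_def c_def algebra_simps)
    then have eq: "l * T (norm X) + m * T (norm Y) = c powr p" by (simp add: lm)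
    have leX: "l * T (norm X) \<le> l * norm X powr p" and leY: "m * T (norm Y) \<le> m * norm Y powr p"
      using T(1) l m by simp_all
    have X: "l * T (norm X) < l * norm X powr p" if "norm X \<noteq> c" using T(2)[of "norm X"] that l by simp
    have Y: "m * T (norm Y) < m * norm Y powr p" if "norm Y \<noteq> c" using T(2)[of "norm Y"] that m by simp
    show ?thesis using eq leX leY X Y by linarith
  qed
  then show "norm (l *\<^sub>R X + m *\<^sub>R Y) powr p \<le> l * norm X powr p + m * norm Y powr p"
    using le1 by linarith
  assume "norm (l *\<^sub>R X + m *\<^sub>R Y) powr p = l * norm X powr p + m * norm Y powr p"
  then have eq: "norm (l *\<^sub>R X + m *\<^sub>R Y) powr p = c powr p" and XY: "norm X = c" "norm Y = c"
    using jensen le1 by linarith+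
  have n: "norm (l *\<^sub>R X + m *\<^sub>R Y) = c"
    using eq tri powr_less_mono2[of p "norm (l *\<^sub>R X + m *\<^sub>R Y)" c] p by fastforce
  have sq: "X \<bullet> X = c\<^sup>2" "Y \<bullet> Y = c\<^sup>2" by (simp_all add: dot_square_norm XY)
  have "(l *\<^sub>R X + m *\<^sub>R Y) \<bullet> (l *\<^sub>R X + m *\<^sub>R Y) =
      l\<^sup>2 * (X \<bullet> X) + m\<^sup>2 * (Y \<bullet> Y) + 2 * l * m * (X \<bullet> Y)"
    by (simp add: inner_add_left inner_add_right inner_commute[of Y X] power2_eq_square algebra_simps)
  then have "c\<^sup>2 = l\<^sup>2 * c\<^sup>2 + m\<^sup>2 * c\<^sup>2 + 2 * l * m * (X \<bullet> Y)"
    by (simp only: dot_square_norm[of "l *\<^sub>R X + m *\<^sub>R Y"] n sq)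
  moreover have "c\<^sup>2 = (l + m)\<^sup>2 * c\<^sup>2" by (simp add: lm)
  then have "c\<^sup>2 = l\<^sup>2 * c\<^sup>2 + m\<^sup>2 * c\<^sup>2 + 2 * l * m * c\<^sup>2"
    by (simp only: power2_sum distrib_right)
  ultimately have "(2 * l * m) * (X \<bullet> Y) = (2 * l * m) * c\<^sup>2" by linarith
  then have "X \<bullet> Y = c\<^sup>2" using l m by simp
  then have "(X - Y) \<bullet> (X - Y) = 0"
    using sq by (simp add: inner_diff_left inner_diff_right inner_commute[of Y X])
  then show "X = Y" by simp
qed

text \<open>This is the p-th power of the mean; the root is taken separately.\<close>

definition powr_mean :: "real \<Rightarrow> real \<Rightarrow> real \<Rightarrow> real \<Rightarrow> real" where
  "powr_mean p t a b = (1 - t) * a powr p + t * b powr p"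

lemma powr_mean_pos: "0 \<le> t \<Longrightarrow> t \<le> 1 \<Longrightarrow> 0 < a \<Longrightarrow> 0 < b \<Longrightarrow> 0 < powr_mean p t a b"
  unfolding powr_mean_def by (cases "t = 1") (auto intro!: add_pos_nonneg)

text \<open>\<open>mean_d1\<close> and \<open>mean_d2\<close> are the partial derivatives in a and
  in b of \<open>powr_mean p t a b powr (1 / p)\<close>.\<close>

definition mean_d1 :: "real \<Rightarrow> real \<Rightarrow> real \<Rightarrow> real \<Rightarrow> real" where
  "mean_d1 p t a b = (1 - t) * powr_mean p t a b powr (1 / p - 1) * a powr (p - 1)"

definition mean_d2 :: "real \<Rightarrow> real \<Rightarrow> real \<Rightarrow> real \<Rightarrow> real" where
  "mean_d2 p t a b = t * powr_mean p t a b powr (1 / p - 1) * b powr (p - 1)"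

text \<open>With m the p-th power of the mean, the weights l = (1-t) a^p / m and k = t b^p / m add
  up to 1, and the gradient of the mean is m^(1/p) (l x/a + k y/b). The inequality is therefore
  convexity of the p-th power of the norm at the logarithmic gradients x/a and y/b, and equality
  makes these coincide.\<close>

lemma hidden_convexity:
  fixes x y :: "'v::real_inner"
  assumes p: "1 < p" and t: "0 < t" "t < 1" and a: "0 < a" and b: "0 < b"
  shows "norm (mean_d1 p t a b *\<^sub>R x + mean_d2 p t a b *\<^sub>R y) powr p \<le>
      (1 - t) * norm x powr p + t * norm y powr p"
    and "norm (mean_d1 p t a b *\<^sub>R x + mean_d2 p t a b *\<^sub>R y) powr p =
      (1 - t) * norm x powr p + t * norm y powr p \<Longrightarrow> inverse a *\<^sub>R x = inverse b *\<^sub>R y"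
proof -
  define m where "m = powr_mean p t a b"
  have m: "0 < m" unfolding m_def using t a b by (intro powr_mean_pos) auto
  define l where "l = (1 - t) * a powr p / m"
  define k where "k = t * b powr p / m"
  have lk: "0 < l" "0 < k" unfolding l_def k_def using t a b m by simp_all
  have lk1: "l + k = 1"
    using m unfolding l_def k_def add_divide_distrib[symmetric] by (simp add: m_def powr_mean_def)
  let ?X = "inverse a *\<^sub>R x" and ?Y = "inverse b *\<^sub>R y"
  have d1: "mean_d1 p t a b = m powr (1 / p) * l * inverse a"
    using a m by (simp add: mean_d1_def m_def[symmetric] l_def powr_diff field_simps)
  have d2: "mean_d2 p t a b = m powr (1 / p) * k * inverse b"
    using b m by (simp add: mean_d2_def m_def[symmetric] k_def powr_diff field_simps)
  have z: "mean_d1 p t a b *\<^sub>R x + mean_d2 p t a b *\<^sub>R y = m powr (1 / p) *\<^sub>R (l *\<^sub>R ?X + k *\<^sub>R ?Y)"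
    by (simp add: d1 d2 scaleR_add_right mult.assoc)
  have nz: "norm (mean_d1 p t a b *\<^sub>R x + mean_d2 p t a b *\<^sub>R y) powr p = m * norm (l *\<^sub>R ?X + k *\<^sub>R ?Y) powr p"
    unfolding z using m p by (simp add: powr_mult powr_powr)
  have r: "m * (l * norm ?X powr p + k * norm ?Y powr p) = (1 - t) * norm x powr p + t * norm y powr p"
    using a b m by (simp add: l_def k_def powr_mult powr_divide divide_inverse[symmetric] field_simps norm_divide)
  show "norm (mean_d1 p t a b *\<^sub>R x + mean_d2 p t a b *\<^sub>R y) powr p \<le>
      (1 - t) * norm x powr p + t * norm y powr p"
    unfolding nz r[symmetric]
    by (rule mult_left_mono[OF norm_convex_comb_powr(1)[OF p lk lk1]]) (use m in simp)
  assume "norm (mean_d1 p t a b *\<^sub>R x + mean_d2 p t a b *\<^sub>R y) powr p =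
      (1 - t) * norm x powr p + t * norm y powr p"
  then have "m * norm (l *\<^sub>R ?X + k *\<^sub>R ?Y) powr p = m * (l * norm ?X powr p + k * norm ?Y powr p)"
    unfolding nz r by simp
  then have "norm (l *\<^sub>R ?X + k *\<^sub>R ?Y) powr p = l * norm ?X powr p + k * norm ?Y powr p"
    using m by simp
  then show "?X = ?Y" by (rule norm_convex_comb_powr(2)[OF p lk lk1])
qed

text \<open>Here \<alpha> stands for a^2 + d^2 and Q for the regularised \<open>powr_mean\<close>.
  The exponent 1/p - 1 is negative, so Q may be replaced by its single summand; the powers of
  \<alpha> then cancel, since (1/2 - p/2) + (p/2 - 1) + 1/2 = 0, and s^(1/p) \<le> 1
  remains.\<close>

lemma mean_partial_bound:
  fixes s Q \<alpha> a p :: real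
  assumes s: "0 < s" "s \<le> 1" and p: "1 < p" and \<alpha>: "0 < \<alpha>" "a\<^sup>2 \<le> \<alpha>" and Q: "s * \<alpha> powr (p / 2) \<le> Q"
  shows "\<bar>s * Q powr (1 / p - 1) * (\<alpha> powr (p / 2 - 1) * a)\<bar> \<le> 1"
proof -
  have q: "0 < s * \<alpha> powr (p / 2)" using s \<alpha> by simp
  have "\<bar>a\<bar> = (a\<^sup>2) powr (1 / 2)" by (simp add: powr_half_sqrt)
  also have "\<dots> \<le> \<alpha> powr (1 / 2)" using \<alpha> by (intro powr_mono2) auto
  finally have a: "\<bar>a\<bar> \<le> \<alpha> powr (1 / 2)" .
  have "Q powr (1 / p - 1) \<le> (s * \<alpha> powr (p / 2)) powr (1 / p - 1)"
    using p q Q by (intro powr_mono2') auto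
  also have "\<dots> = s powr (1 / p - 1) * \<alpha> powr (1 / 2 - p / 2)"
    using s \<alpha> p by (simp add: powr_mult powr_powr algebra_simps diff_divide_distrib)
  finally have Qb: "Q powr (1 / p - 1) \<le> s powr (1 / p - 1) * \<alpha> powr (1 / 2 - p / 2)" .
  have "\<bar>s * Q powr (1 / p - 1) * (\<alpha> powr (p / 2 - 1) * a)\<bar> =
      s * Q powr (1 / p - 1) * (\<alpha> powr (p / 2 - 1) * \<bar>a\<bar>)"
    using s by (simp add: abs_mult)
  also have "\<dots> \<le> s * (s powr (1 / p - 1) * \<alpha> powr (1 / 2 - p / 2)) * (\<alpha> powr (p / 2 - 1) * \<alpha> powr (1 / 2))"
    using s by (intro mult_mono Qb a) auto
  also have "\<dots> = (s powr 1 * s powr (1 / p - 1)) * (\<alpha> powr (1 / 2 - p / 2) * (\<alpha> powr (p / 2 - 1) * \<alpha> powr (1 / 2)))"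
    using s by simp
  also have "\<dots> = s powr (1 / p)"
    using \<alpha> unfolding powr_add[symmetric] by simp
  also have "\<dots> \<le> 1" using s p by (intro powr_le1) auto
  finally show ?thesis .
qed

context bounded_open
begin

text \<open>Replacing \<open>a\<close> by \<open>(a\<^sup>2 + d\<^sup>2)\<^bsup>1/2\<^esup>\<close> and subtracting \<open>d\<close> makes the mean smooth and zero at the
  origin, with partial derivatives bounded by 1 uniformly in \<open>d\<close>.\<close>

lemma W_mean:
  assumes t: "0 < t" "t < 1" and u: "W u Su" and v: "W v Sv"
    and pos: "\<And>x. x \<in> \<Omega> \<Longrightarrow> 0 < u x \<and> 0 < v x"
  shows "W (\<lambda>x. powr_mean p t (u x) (v x) powr (1 / p))
    (\<lambda>x. mean_d1 p t (u x) (v x) *\<^sub>R Su x + mean_d2 p t (u x) (v x) *\<^sub>R Sv x)"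
proof -
  define d where "d n = inverse (real (Suc n))" for n
  have d: "0 < d n" for n by (simp add: d_def)
  have d0: "d \<longlonglongrightarrow> 0" unfolding d_def[abs_def] by (rule LIMSEQ_inverse_real_of_nat)
  have sq: "0 < a\<^sup>2 + (d n)\<^sup>2" for a n using d[of n] by (simp add: add_nonneg_pos)
  define Q where "Q n a b = (1 - t) * (a\<^sup>2 + (d n)\<^sup>2) powr (p / 2) + t * (b\<^sup>2 + (d n)\<^sup>2) powr (p / 2)" for n a b
  have Qpos: "0 < Q n a b" for n a b
    unfolding Q_def using t sq[of a n] sq[of b n] d[of n] by (intro add_pos_pos mult_pos_pos) auto
  have sq_powr: "(x\<^sup>2) powr r = x powr (2 * r)" if "0 < x" for x r :: real
    using that by (simp add: powr_powr flip: powr_numeral)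
  have limQ: "(\<lambda>n. Q n (r n) (s n)) \<longlonglongrightarrow> powr_mean p t a b"
    if "0 < a" "0 < b" "r \<longlonglongrightarrow> a" "s \<longlonglongrightarrow> b" for r s a b
  proof -
    have "(\<lambda>n. Q n (r n) (s n)) \<longlonglongrightarrow> (1 - t) * (a\<^sup>2 + 0\<^sup>2) powr (p / 2) + t * (b\<^sup>2 + 0\<^sup>2) powr (p / 2)"
      unfolding Q_def using that by (intro tendsto_intros d0) auto
    then show ?thesis using that by (simp add: powr_mean_def sq_powr)
  qed
  let ?A = "\<lambda>n a b. (1 - t) * Q n a b powr (1 / p - 1) * ((a\<^sup>2 + (d n)\<^sup>2) powr (p / 2 - 1) * a)"
  let ?B = "\<lambda>n a b. t * Q n a b powr (1 / p - 1) * ((b\<^sup>2 + (d n)\<^sup>2) powr (p / 2 - 1) * b)"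
  show ?thesis
  proof (rule W_chain[OF u v pos, where
      F = "\<lambda>n a b. Q n a b powr (1 / p) - d n" and
      A = ?A and
      B = ?B and
      C = 1 and ?F0.0 = "\<lambda>a b. powr_mean p t a b powr (1 / p)" and
      ?A0.0 = "mean_d1 p t" and ?B0.0 = "mean_d2 p t"])
    show "smooth (\<lambda>x. Q n (f x) (g x) powr (1 / p) - d n)" if "smooth f" "smooth g" for n and f g :: "'a \<Rightarrow> real"
    proof -
      have "smooth (\<lambda>x. Q n (f x) (g x))"
        unfolding Q_def
        by (intro smooth_add smooth_mult smooth_const smooth_powr smooth_power that sq)
      then show ?thesis by (intro smooth_diff smooth_powr smooth_const Qpos)
    qed
    show "Q n 0 0 powr (1 / p) - d n = 0" for n
    proof -
      have "Q n 0 0 = (d n) powr p" using d[of n] by (simp add: Q_def sq_powr algebra_simps)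
      then show ?thesis using d[of n] p_gt_1 by (simp add: powr_powr)
    qed
    show "((\<lambda>z. Q n (fst z) (snd z) powr (1 / p) - d n) has_derivative
        (\<lambda>h. ?A n (fst z) (snd z) * fst h +
          ?B n (fst z) (snd z) * snd h)) (at z)"
      for n and z :: "real \<times> real"
    proof -
      have D: "((\<lambda>x. g x powr r) has_derivative (\<lambda>h. r * g x powr (r - 1) * g' h)) (at x)"
        if "(g has_derivative g') (at x)" "0 < g x" for g :: "real \<times> real \<Rightarrow> real" and g' x r
        using that by (auto intro!: derivative_eq_intros simp: powr_diff field_simps)
      have "((\<lambda>z. Q n (fst z) (snd z)) has_derivative
          (\<lambda>h. (1 - t) * (p / 2 * ((fst z)\<^sup>2 + (d n)\<^sup>2) powr (p / 2 - 1) * (2 * fst z * fst h)) +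
             t * (p / 2 * ((snd z)\<^sup>2 + (d n)\<^sup>2) powr (p / 2 - 1) * (2 * snd z * snd h)))) (at z)"
        unfolding Q_def
        by (intro has_derivative_add has_derivative_mult_right D sq)
          (auto intro!: derivative_eq_intros)
      from has_derivative_diff[OF D[OF this Qpos, of "1 / p"] has_derivative_const[of "d n"]]
      show ?thesis
        by (rule has_derivative_eq_rhs) (use p_pos in \<open>simp add: fun_eq_iff field_simps\<close>)
    qed
    show "\<bar>?A n a b\<bar> \<le> 1" for n a b
      using t p_gt_1 sq by (intro mean_partial_bound) (auto simp: Q_def)
    show "\<bar>?B n a b\<bar> \<le> 1" for n a b
      using t p_gt_1 sq by (intro mean_partial_bound) (auto simp: Q_def)
    show "(\<lambda>n. Q n (r n) (s n) powr (1 / p) - d n) \<longlonglongrightarrow> powr_mean p t a b powr (1 / p) \<and>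
        (\<lambda>n. ?A n (r n) (s n)) \<longlonglongrightarrow> mean_d1 p t a b \<and>
        (\<lambda>n. ?B n (r n) (s n)) \<longlonglongrightarrow> mean_d2 p t a b"
      if ab: "0 < a" "0 < b" and rs: "r \<longlonglongrightarrow> a" "s \<longlonglongrightarrow> b" for a b r s
    proof (intro conjI)
      have m: "powr_mean p t a b \<noteq> 0" using powr_mean_pos[of t a b p] t ab by simp
      note lQ = limQ[OF ab rs]
      have "(\<lambda>n. Q n (r n) (s n) powr (1 / p) - d n) \<longlonglongrightarrow> powr_mean p t a b powr (1 / p) - 0"
        using m by (intro tendsto_intros lQ d0) auto
      then show "(\<lambda>n. Q n (r n) (s n) powr (1 / p) - d n) \<longlonglongrightarrow> powr_mean p t a b powr (1 / p)" by simp
      have key: "(x\<^sup>2 + 0\<^sup>2) powr (p / 2 - 1) * x = x powr (p - 1)" if "0 < x" for x :: real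
        using that powr_add[of x "p - 2" 1] by (simp add: sq_powr algebra_simps)
      have "(\<lambda>n. ?A n (r n) (s n)) \<longlonglongrightarrow>
          (1 - t) * powr_mean p t a b powr (1 / p - 1) * ((a\<^sup>2 + 0\<^sup>2) powr (p / 2 - 1) * a)"
        using m ab by (intro tendsto_intros lQ d0 rs) auto
      then show "(\<lambda>n. ?A n (r n) (s n)) \<longlonglongrightarrow> mean_d1 p t a b"
        unfolding key[OF ab(1)] mean_d1_def .
      have "(\<lambda>n. ?B n (r n) (s n)) \<longlonglongrightarrow>
          t * powr_mean p t a b powr (1 / p - 1) * ((b\<^sup>2 + 0\<^sup>2) powr (p / 2 - 1) * b)"
        using m ab by (intro tendsto_intros lQ d0 rs) auto
      then show "(\<lambda>n. ?B n (r n) (s n)) \<longlonglongrightarrow> mean_d2 p t a b"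
        unfolding key[OF ab(2)] mean_d2_def .
    qed
  qed (simp_all add: Q_def powr_mean_def mean_d1_def[abs_def] mean_d2_def[abs_def])
qed

end

section \<open>Primitives of nondecreasing functions\<close>

locale nondecreasing_density =
  fixes h :: "real \<Rightarrow> real"
  assumes h_cont: "continuous_on {0..} h" and h_bounded: "bounded (h ` {0..})"
    and h_mono: "mono_on {0..} h" and h_nonneg: "\<And>t. 0 \<le> t \<Longrightarrow> 0 \<le> h t"
begin

abbreviation "H \<equiv> integral_from_0 h"

lemma h_integrable: "0 \<le> a \<Longrightarrow> h integrable_on {a..b}"
  by (rule integrable_continuous_real) (auto intro: continuous_on_subset[OF h_cont])

text \<open>The definition integrates over the open interval from 0 to t. Continuity of h on the
  closed interval makes the Lebesgue and gauge integrals agree, and the end points do not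
  contribute.\<close>

lemma H_eq_integral: "0 \<le> t \<Longrightarrow> H t = integral {0..t} h"
proof -
  assume t: "0 \<le> t"
  have "h absolutely_integrable_on {0..t}"
    by (rule absolutely_integrable_continuous_real) (auto intro: continuous_on_subset[OF h_cont])
  then have "h absolutely_integrable_on {0<..<t}"
    by (rule set_integrable_subset) auto
  then have "(LINT s:{0<..<t}|lebesgue. h s) = integral {0<..<t} h"
    by (rule set_lebesgue_integral_eq_integral(2))
  moreover have "einterval 0 (ereal t) = {0<..<t}"
    by (auto simp: einterval_def)
  ultimately show "H t = integral {0..t} h"
    using t by (simp add: integral_from_0_def interval_lebesgue_integral_def integral_open_interval_real)
qed

text \<open>On [a, b] the nondecreasing h lies between its end values. Convexity, monotonicity and
  Lipschitz continuity of H all come from these two bounds.\<close>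

lemma H_diff_bounds:
  assumes "0 \<le> a" "a \<le> b"
  shows "(b - a) * h a \<le> H b - H a" "H b - H a \<le> (b - a) * h b"
proof -
  have "H b = H a + integral {a..b} h"
    using Henstock_Kurzweil_Integration.integral_combine[OF assms h_integrable] assms
    by (simp add: H_eq_integral)
  then have eq: "H b - H a = integral {a..b} h" by simp
  have c: "integral {a..b} (\<lambda>x. c) = (b - a) * c" for c :: real
    using assms by simp
  have "integral {a..b} (\<lambda>x. h a) \<le> integral {a..b} h"
    by (rule integral_le) (use assms h_mono in \<open>auto intro: h_integrable simp: mono_on_def\<close>)
  then show "(b - a) * h a \<le> H b - H a" unfolding eq c .
  have "integral {a..b} h \<le> integral {a..b} (\<lambda>x. h b)"
    by (rule integral_le) (use assms h_mono in \<open>auto intro: h_integrable simp: mono_on_def\<close>)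
  then show "H b - H a \<le> (b - a) * h b" unfolding eq c .
qed

lemma H_subgradient:
  assumes "0 \<le> m" "0 \<le> x"
  shows "H m + h m * (x - m) \<le> H x"
proof (cases "m \<le> x")
  case True
  then show ?thesis using H_diff_bounds(1)[of m x] assms by (simp add: algebra_simps)
next
  case False
  then show ?thesis using H_diff_bounds(2)[of x m] assms by (simp add: algebra_simps)
qed

text \<open>The subgradient inequality is applied from m to the midpoint c and from c to x; on the
  second half the slope has changed strictly from h m to h c, in the favourable direction.\<close>

lemma H_subgradient_strict:
  assumes strict: "strict_mono_on {0..} h" and "0 \<le> m" "0 \<le> x" "x \<noteq> m"
  shows "H m + h m * (x - m) < H x"
proof -
  define c where "c = (m + x) / 2"
  have c: "0 \<le> c" using assms by (simp add: c_def)
  have "h m * (x - c) < h c * (x - c)"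
  proof (cases "m < x")
    case True
    then have "h m < h c" using strict assms c by (auto simp: strict_mono_on_def c_def)
    then show ?thesis using True by (simp add: c_def)
  next
    case False
    then have "h c < h m" using strict assms c by (auto simp: strict_mono_on_def c_def)
    then show ?thesis using False assms by (simp add: c_def mult_less_cancel_right)
  qed
  then show ?thesis
    using H_subgradient[OF c \<open>0 \<le> x\<close>] H_subgradient[OF \<open>0 \<le> m\<close> c] by (simp add: algebra_simps)
qed

lemma H_convex:
  assumes "0 \<le> a" "0 \<le> b" "0 \<le> t" "t \<le> 1"
  shows "H ((1 - t) * a + t * b) \<le> (1 - t) * H a + t * H b"
proof -
  let ?m = "(1 - t) * a + t * b"
  have m: "0 \<le> ?m" using assms by simp
  have "(1 - t) * (H ?m + h ?m * (a - ?m)) + t * (H ?m + h ?m * (b - ?m)) \<le> (1 - t) * H a + t * H b"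
    using assms H_subgradient[OF m] by (intro add_mono mult_left_mono) auto
  then show ?thesis by (simp add: algebra_simps)
qed

lemma H_midpoint_strict:
  assumes strict: "strict_mono_on {0..} h" and "0 \<le> a" "0 \<le> b" "a \<noteq> b"
  shows "H ((a + b) / 2) < (H a + H b) / 2"
proof -
  define m d where "m = (a + b) / 2" and "d = (b - a) / 2"
  have *: "a - m = - d" "b - m = d" unfolding m_def d_def by (simp_all add: field_simps)
  have "H m + h m * (a - m) < H a" "H m + h m * (b - m) < H b"
    using assms by (intro H_subgradient_strict; simp add: m_def)+
  then have "H m < (H a + H b) / 2" unfolding * by simp
  then show ?thesis by (simp add: m_def)
qed

lemma H_mono: "0 \<le> a \<Longrightarrow> a \<le> b \<Longrightarrow> H a \<le> H b"
  using H_diff_bounds(1)[of a b] h_nonneg[of a] mult_nonneg_nonneg[of "b - a" "h a"] by linarith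

lemma H_strict_mono:
  assumes "\<And>t. 0 < t \<Longrightarrow> 0 < h t" "0 \<le> a" "a < b"
  shows "H a < H b"
proof -
  \<comment> \<open>The midpoint is positive even if a = 0, where h may vanish.\<close>
  define c where "c = (a + b) / 2"
  have "0 < (b - c) * h c" using assms by (intro mult_pos_pos) (auto simp: c_def)
  moreover have "(b - c) * h c \<le> H b - H c" by (rule H_diff_bounds) (use assms in \<open>auto simp: c_def\<close>)
  moreover have "H a \<le> H c" by (rule H_mono) (use assms in \<open>auto simp: c_def\<close>)
  ultimately show ?thesis by linarith
qed

lemma H_0 [simp]: "H 0 = 0"
  by (simp add: H_eq_integral)

lemma h_upper_bound: "\<exists>B\<ge>0. \<forall>t\<ge>0. h t \<le> B"
proof -
  obtain B where B: "\<forall>y\<in>h ` {0..}. norm y \<le> B" using h_bounded unfolding bounded_iff by blast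
  have "h t \<le> B" if "0 \<le> t" for t
    using B[rule_format, of "h t"] that by auto
  then show ?thesis using h_nonneg[of 0] order_trans[of 0 "h 0" B] by blast
qed

text \<open>H is controlled only on the nonnegative half-line, so it is extended through max 0 t.
  The extension is Lipschitz, as h is bounded, and hence Borel; it agrees with H at the values of
  f.\<close>

lemma H_measurable:
  assumes f: "f \<in> borel_measurable N" and nonneg: "\<And>x. 0 \<le> f x"
  shows "(\<lambda>x. H (f x)) \<in> borel_measurable N"
proof -
  obtain B where B: "0 \<le> B" "\<And>t. 0 \<le> t \<Longrightarrow> h t \<le> B" using h_upper_bound by blast
  have le: "\<bar>H (max 0 y) - H (max 0 x)\<bar> \<le> B * \<bar>y - x\<bar>" if "x \<le> y" for x y
  proof -
    have "H (max 0 y) - H (max 0 x) \<le> (max 0 y - max 0 x) * h (max 0 y)"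
      using that by (intro H_diff_bounds) auto
    also have "\<dots> \<le> (y - x) * B"
      using B that h_nonneg by (intro mult_mono) auto
    finally show ?thesis
      using H_mono[of "max 0 x" "max 0 y"] that by (simp add: mult.commute)
  qed
  have "B-lipschitz_on UNIV (\<lambda>t. H (max 0 t))"
  proof (rule lipschitz_onI)
    show "dist (H (max 0 x)) (H (max 0 y)) \<le> B * dist x y" for x y
      using le[of x y] le[of y x] by (cases "x \<le> y") (auto simp: dist_real_def abs_minus_commute)
  qed (use B in simp)
  then have "(\<lambda>t. H (max 0 t)) \<in> borel_measurable borel"
    using lipschitz_on_continuous_on borel_measurable_continuous_onI by blast
  from measurable_compose[OF f this] show ?thesis
    using nonneg by (simp add: max_def)
qed

text \<open>Linear growth of H makes H(|S|^p) integrable for every p-integrable S.\<close>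

lemma H_bounds: "\<exists>B\<ge>0. \<forall>t\<ge>0. 0 \<le> H t \<and> H t \<le> B * t"
proof -
  obtain B where B: "0 \<le> B" "\<And>t. 0 \<le> t \<Longrightarrow> h t \<le> B" using h_upper_bound by blast
  have "0 \<le> H t \<and> H t \<le> B * t" if "0 \<le> t" for t
    using H_mono[of 0 t] H_diff_bounds(2)[of 0 t] B(2)[OF that] mult_right_mono[of "h t" B t] that
    by (simp add: mult.commute)
  then show ?thesis using B by blast
qed

end

section \<open>Functions with vanishing weak gradient\<close>

text \<open>The points of S where the functions differ form an open null set, which is
  empty.\<close>

lemma continuous_AE_eq_imp_eq:
  fixes u v :: "'a::euclidean_space \<Rightarrow> real"
  assumes "open S" "continuous_on S u" "continuous_on S v"
    and ae: "AE x in lebesgue. x \<in> S \<longrightarrow> u x = v x" and x: "x \<in> S"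
  shows "u x = v x"
proof (rule ccontr)
  assume ne: "u x \<noteq> v x"
  let ?N = "S \<inter> (\<lambda>y. u y - v y) -` (- {0})"
  have "continuous_on S (\<lambda>y. u y - v y)" by (intro continuous_intros assms)
  then have N: "open ?N"
    by (rule continuous_open_preimage[OF _ \<open>open S\<close>]) (simp add: open_Compl)
  moreover have "x \<in> ?N" using x ne by simp
  moreover have "AE y in lebesgue. y \<notin> ?N"
    using ae by eventually_elim auto
  then have "?N \<in> null_sets lebesgue"
    using AE_iff_null_sets[of ?N lebesgue] N by simp
  then have "negligible ?N" by (simp add: negligible_iff_null_sets)
  ultimately show False using open_not_negligible[OF N] by blast
qed


lemma continuous_imp_locally_integrable:
  fixes w :: "'a::euclidean_space \<Rightarrow> real"
  assumes "continuous_on S w" shows "locally_integrable S w"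
  unfolding locally_integrable_def
proof (intro allI impI)
  fix K assume K: "compact K \<and> K \<subseteq> S"
  then have "integrable lborel (\<lambda>x. indicator K x *\<^sub>R w x)"
    by (intro borel_integrable_compact) (auto intro: continuous_on_subset[OF assms])
  then show "set_integrable lebesgue K w"
    unfolding set_integrable_def
    by (subst integrable_completion[OF borel_measurable_integrable])
qed

context bounded_open
begin

text \<open>The derivative in s of the integral of w(x) f(x + s e) pairs w with the directional
  derivative of a translated test function, which is 0 by hypothesis as long as the translate is
  supported in the box. The closed box inside the domain lets the Leibniz rule apply to the merely
  continuous w.\<close>

lemma integral_translate_const:
  fixes w :: "'a \<Rightarrow> real"
  assumes w: "continuous_on \<Omega> w"
    and orth: "\<And>\<phi> i. test_function \<Omega> \<phi> \<Longrightarrow> i \<in> Basis \<Longrightarrow> (\<integral>x. w x * (grad \<phi> x \<bullet> i) \<partial>M) = 0"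
    and K: "cbox a b \<subseteq> \<Omega>" and f: "test_function (box a b) f"
    and tr: "\<And>s. s \<in> {0..1} \<Longrightarrow> test_function (box a b) (\<lambda>x. f (x + s *\<^sub>R e))"
  shows "integral (cbox a b) (\<lambda>x. w x * f (x + e)) = integral (cbox a b) (\<lambda>x. w x * f x)"
proof -
  let ?I = "\<lambda>s. integral (cbox a b) (\<lambda>x. w x * f (x + s *\<^sub>R e))"
  note sf = test_function_smooth[OF f]
  have wK: "continuous_on (cbox a b) w" using w K by (rule continuous_on_subset)
  have zero: "integral (cbox a b) (\<lambda>x. w x * (grad f (x + s *\<^sub>R e) \<bullet> e)) = 0" if s: "s \<in> {0..1}" for s
  proof -
    let ?g = "\<lambda>x. f (x + s *\<^sub>R e)"
    have gr: "grad ?g x = grad f (x + s *\<^sub>R e)" for x by (rule grad_translate[OF sf])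
    have sg: "smooth ?g" by (rule smooth_translate[OF sf])
    have tb: "test_function (box a b) ?g" by (rule tr[OF s])
    have t\<Omega>: "test_function \<Omega> ?g"
      using tb K box_subset_cbox[of a b] by (auto simp: test_function_def)
    obtain L where L: "compact L \<and> L \<subseteq> box a b \<and> (\<forall>x. x \<notin> L \<longrightarrow> ?g x = 0 \<and> grad ?g x = 0)"
      using test_function_support[OF tb] by blast
    have int: "(\<lambda>x. w x * (grad ?g x \<bullet> i)) integrable_on cbox a b" for i
      by (intro integrable_continuous continuous_intros wK continuous_on_grad sg)
    have zi: "integral (cbox a b) (\<lambda>x. w x * (grad ?g x \<bullet> i)) = 0" if i: "i \<in> Basis" for i
    proof -
      have ci: "continuous_on (cbox a b) (\<lambda>x. w x * (grad ?g x \<bullet> i))"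
        by (intro continuous_intros wK continuous_on_grad sg)
      have "integrable (lebesgue_on (cbox a b)) (\<lambda>x. w x * (grad ?g x \<bullet> i))"
        by (rule continuous_imp_integrable[OF ci])
      then have "integral (cbox a b) (\<lambda>x. w x * (grad ?g x \<bullet> i)) =
          (\<integral>x. w x * (grad ?g x \<bullet> i) \<partial>lebesgue_on (cbox a b))"
        by (intro lebesgue_integral_eq_integral[symmetric]) auto
      also have "\<dots> = (LINT x:cbox a b|lebesgue. w x * (grad ?g x \<bullet> i))"
        by (rule set_integral_lebesgue_on[symmetric]) simp
      also have "\<dots> = (LINT x:\<Omega>|lebesgue. w x * (grad ?g x \<bullet> i))"
        unfolding set_lebesgue_integral_def
      proof (rule Bochner_Integration.integral_cong[OF refl])
        fix x
        show "indicat_real (cbox a b) x *\<^sub>R (w x * (grad ?g x \<bullet> i)) =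
            indicat_real \<Omega> x *\<^sub>R (w x * (grad ?g x \<bullet> i))"
        proof (cases "x \<in> L")
          case True
          then have "x \<in> cbox a b" using L box_subset_cbox[of a b] by blast
          then show ?thesis using K by (auto simp: indicator_def)
        next
          case False
          then have "grad ?g x = 0" using L by blast
          then show ?thesis by simp
        qed
      qed
      also have "\<dots> = (\<integral>x. w x * (grad ?g x \<bullet> i) \<partial>M)"
        by (rule set_integral_lebesgue_on) simp
      also have "\<dots> = 0" by (rule orth[OF t\<Omega> i])
      finally show ?thesis .
    qed
    \<comment> \<open>Orthogonality is given for basis directions only, so the derivative in
      direction e is expanded in components.\<close>
    have eq: "w x * (grad f (x + s *\<^sub>R e) \<bullet> e) = (\<Sum>i\<in>Basis. (e \<bullet> i) * (w x * (grad ?g x \<bullet> i)))" for x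
      unfolding gr by (subst euclidean_inner) (simp add: sum_distrib_left algebra_simps)
    have "integral (cbox a b) (\<lambda>x. \<Sum>i\<in>Basis. (e \<bullet> i) * (w x * (grad ?g x \<bullet> i))) =
        (\<Sum>i\<in>Basis. integral (cbox a b) (\<lambda>x. (e \<bullet> i) * (w x * (grad ?g x \<bullet> i))))"
      using int by (intro Henstock_Kurzweil_Integration.integral_sum integrable_on_mult_right) auto
    also have "\<dots> = 0"
      by (intro sum.neutral ballI) (simp add: zi)
    finally show ?thesis unfolding eq .
  qed
  have D: "(?I has_field_derivative 0) (at s within {0..1})" if "s \<in> {0..1}" for s
    using DERIV_integral_translate[OF wK sf, of e s] zero[OF that]
    by (metis has_field_derivative_at_within)
  have "\<exists>c. \<forall>s\<in>{0..1}. ?I s = c"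
    using has_field_derivative_zero_constant[of "{0..1::real}" ?I] D by auto
  then obtain c where c: "\<And>s. s \<in> {0..1} \<Longrightarrow> ?I s = c" by blast
  show ?thesis using c[of 1] c[of 0] by simp
qed

text \<open>For a small vector e the functions w(x + e) and w(x) have the same integrals against
  test functions on a small ball, so by the fundamental lemma and continuity they agree there, in
  particular at the centre. Thus w is locally constant, and connectedness makes it constant.\<close>

lemma constant_if_orthogonal:
  fixes w :: "'a \<Rightarrow> real"
  assumes conn: "connected \<Omega>" and w: "continuous_on \<Omega> w"
    and orth: "\<And>\<phi> i. test_function \<Omega> \<phi> \<Longrightarrow> i \<in> Basis \<Longrightarrow> (\<integral>x. w x * (grad \<phi> x \<bullet> i) \<partial>M) = 0"
  shows "w constant_on \<Omega>"
proof -
  have local: "\<exists>r>0. ball x0 r \<subseteq> \<Omega> \<and> (\<forall>y\<in>ball x0 r. w y = w x0)" if x0: "x0 \<in> \<Omega>" for x0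
  proof -
    obtain a b where ab: "x0 \<in> box a b" "cbox a b \<subseteq> \<Omega>"
      by (rule open_contains_cbox[OF open_dom x0])
    have "open (box a b)" by (rule open_box)
    then obtain R where R: "0 < R" "ball x0 R \<subseteq> box a b" using ab(1) open_contains_ball by blast
    \<comment> \<open>Half the radius leaves room to move a point of the smaller ball by s e with
      |s| \<le> 1 without leaving the box.\<close>
    define r where "r = R / 2"
    let ?B = "ball x0 r"
    have r: "0 < r" using R by (simp add: r_def)
    have "w (x0 + e) = w x0" if e: "norm e < r" for e
    proof (rule continuous_AE_eq_imp_eq[of "?B" "\<lambda>x. w (x + e)" w])
      have in_box: "x + s *\<^sub>R e \<in> box a b" if "x \<in> ?B" "\<bar>s\<bar> \<le> 1" for x s
      proof -
        have "norm (s *\<^sub>R e) \<le> norm e" using that by (simp add: mult_left_le_one_le)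
        then have "dist x0 (x + s *\<^sub>R e) < R"
          using that e norm_triangle_ineq4[of "x0 - x" "s *\<^sub>R e"] by (simp add: dist_norm r_def algebra_simps)
        then show ?thesis using R by auto
      qed
      have sub: "?B \<subseteq> \<Omega>" using in_box[of _ 0] ab box_subset_cbox[of a b] by fastforce
      have sube: "x + e \<in> \<Omega>" if "x \<in> ?B" for x
        using in_box[OF that, of 1] ab box_subset_cbox[of a b] by auto
      show cw: "continuous_on (?B) w" by (rule continuous_on_subset[OF w sub])
      show cwe: "continuous_on (?B) (\<lambda>x. w (x + e))"
        by (rule continuous_on_compose2[OF w]) (auto intro!: continuous_intros sube)
      have "AE x in lebesgue. x \<in> ?B \<longrightarrow> w (x + e) - w x = 0"
      proof (rule AE_eq_0_if_orthogonal)
        have li: "locally_integrable (?B) w" "locally_integrable (?B) (\<lambda>x. w (x + e))"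
          by (intro continuous_imp_locally_integrable cw cwe)+
        have "continuous_on (?B) (\<lambda>x. w (x + e) - w x)" by (intro continuous_intros cw cwe)
        then show "locally_integrable (?B) (\<lambda>x. w (x + e) - w x)"
          by (rule continuous_imp_locally_integrable)
        fix f assume f: "test_function (?B) f"
        note sf = test_function_smooth[OF f]
        obtain L where L: "compact L \<and> L \<subseteq> ?B \<and> (\<forall>x. x \<notin> L \<longrightarrow> f x = 0 \<and> grad f x = 0)"
          using test_function_support[OF f] by blast
        have f0: "f x = 0" if "x \<notin> ?B" for x using L that by blast
        have abs: "(\<lambda>x. f x *\<^sub>R W x) absolutely_integrable_on ?B" if "locally_integrable (?B) W" for W :: "'a \<Rightarrow> real"
          by (rule locally_integrable_compact_support[OF that, of L]) (use L smooth_continuous_on[OF sf] in auto)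
        have to_ball: "integral UNIV (\<lambda>x. f x *\<^sub>R W x) = integral (?B) (\<lambda>x. f x *\<^sub>R W x)" for W :: "'a \<Rightarrow> real"
        proof (rule integral_spike_set)
          have "{x \<in> UNIV - ?B. f x *\<^sub>R W x \<noteq> 0} = {}" "{x \<in> ?B - UNIV. f x *\<^sub>R W x \<noteq> 0} = {}"
            using f0 by auto
          then show "negligible {x \<in> UNIV - ?B. f x *\<^sub>R W x \<noteq> 0}" "negligible {x \<in> ?B - UNIV. f x *\<^sub>R W x \<noteq> 0}"
            by (simp_all only: negligible_empty)
        qed
        have tr: "test_function (box a b) (\<lambda>x. f (x + s *\<^sub>R e))" if "\<bar>s\<bar> \<le> 1" for s
          by (rule test_function_translate[OF f]) (use in_box[of _ "- s"] that in auto)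
        \<comment> \<open>The path of translates starts at f(x - e) and ends at f. A change of
          variables afterwards moves the shift from f to w.\<close>
        have "integral (cbox a b) (\<lambda>x. w x * f (x + e + (- 1) *\<^sub>R e)) = integral (cbox a b) (\<lambda>x. w x * f (x + (- 1) *\<^sub>R e))"
        proof (rule integral_translate_const[OF w orth ab(2), where f = "\<lambda>x. f (x + (- 1) *\<^sub>R e)"])
          show "test_function (box a b) (\<lambda>x. f (x + (- 1) *\<^sub>R e))" by (rule tr) simp
          show "test_function (box a b) (\<lambda>x. f (x + s *\<^sub>R e + (- 1) *\<^sub>R e))" if "s \<in> {0..1}" for s
            using tr[of "s - 1"] that by (simp add: scaleR_diff_left algebra_simps)
        qed
        then have "integral (cbox a b) (\<lambda>x. w x * f x) = integral (cbox a b) (\<lambda>x. w x * f (x - e))"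
          by simp
        also have "integral (cbox a b) (\<lambda>x. w x * f x) = integral UNIV (\<lambda>x. f x *\<^sub>R w x)"
        proof -
          have "f x = 0" if "x \<notin> cbox a b" for x
            using f0[of x] in_box[of x 0] that box_subset_cbox[of a b] by fastforce
          then show ?thesis by (subst integral_cbox_eq_UNIV) (auto simp: mult.commute)
        qed
        also have "integral (cbox a b) (\<lambda>x. w x * f (x - e)) = integral (cbox (a - e) (b - e)) (\<lambda>x. w (x + e) * f x)"
          using integral_shift_cbox_plus[of "a - e" "b - e" "\<lambda>x. w x * f (x - e)" e] by (simp add: o_def add.commute)
        also have "\<dots> = integral UNIV (\<lambda>x. f x *\<^sub>R w (x + e))"
        proof -
          have "f x = 0" if "x \<notin> cbox (a - e) (b - e)" for x
          proof (rule f0, rule notI)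
            assume "x \<in> ?B"
            then have "x + e \<in> cbox a b" using in_box[of x 1] box_subset_cbox[of a b] by auto
            then show False using that by (auto simp: mem_box algebra_simps inner_simps)
          qed
          then show ?thesis by (subst integral_cbox_eq_UNIV) (auto simp: mult.commute)
        qed
        finally have eq: "integral (?B) (\<lambda>x. f x *\<^sub>R w x) = integral (?B) (\<lambda>x. f x *\<^sub>R w (x + e))"
          unfolding to_ball .
        have "(LINT x:?B|lebesgue. (w (x + e) - w x) * f x) =
            (LINT x:?B|lebesgue. f x *\<^sub>R w (x + e) - f x *\<^sub>R w x)"
          by (simp add: algebra_simps)
        also have "\<dots> = (LINT x:?B|lebesgue. f x *\<^sub>R w (x + e)) - (LINT x:?B|lebesgue. f x *\<^sub>R w x)"
          by (rule set_integral_diff(2)[OF abs[OF li(2)] abs[OF li(1)]])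
        also have "\<dots> = 0"
          using eq set_lebesgue_integral_eq_integral(2)[OF abs[OF li(2)]]
            set_lebesgue_integral_eq_integral(2)[OF abs[OF li(1)]] by linarith
        finally show "(LINT x:?B|lebesgue. (w (x + e) - w x) * f x) = 0" .
      qed simp
      then show "AE x in lebesgue. x \<in> ?B \<longrightarrow> w (x + e) = w x"
        by eventually_elim auto
    qed (use r in auto)
    moreover have "?B \<subseteq> \<Omega>"
      using R(2) ab(2) box_subset_cbox[of a b] subset_ball[of r R x0] R(1) by (auto simp: r_def)
    moreover have "w y = w x0" if "y \<in> ?B" for y
      using calculation(1)[of "y - x0"] that by (simp add: dist_norm norm_minus_commute)
    ultimately show ?thesis using r by blast
  qed
  have der: "(w has_derivative (\<lambda>h. 0)) (at x)" if x: "x \<in> \<Omega>" for x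
  proof -
    obtain r where r: "r > 0" "\<forall>y\<in>ball x r. w y = w x" using local[OF x] by blast
    show ?thesis
    proof (rule has_derivative_transform_within_open[where s = "ball x r", OF has_derivative_const[of "w x"]])
      show "x \<in> ball x r" using r(1) by simp
      show "w x = w y" if "y \<in> ball x r" for y using r(2) that by fastforce
    qed (rule open_ball)
  qed
  show ?thesis
    by (rule has_derivative_zero_connected_constant_on[OF conn open_dom finite.emptyI w])
      (use der has_derivative_at_withinI in blast)
qed

end

section \<open>Energy along the path of means\<close>

text \<open>A mean value estimate on [1/2, \<infinity>): there the derivative s x^(s-1) is at most
  (1/2)^(s-1) = 2^(1-s) \<le> 4 in absolute value.\<close>

lemma powr_near_1:
  fixes z s :: real
  assumes z: "1 / 2 \<le> z" and s: "- 1 \<le> s" "s \<le> 1"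
  shows "\<bar>z powr s - 1\<bar> \<le> 4 * \<bar>z - 1\<bar>"
proof -
  have "norm (z powr s - 1 powr s) \<le> 4 * norm (z - 1)"
  proof (rule field_differentiable_bound[of "{1/2..}" "\<lambda>x. x powr s" "\<lambda>x. s * x powr (s - 1)"])
    fix x :: real assume x: "x \<in> {1/2..}"
    then show "((\<lambda>z. z powr s) has_field_derivative s * x powr (s - 1)) (at x within {1/2..})"
      by (auto intro!: has_field_derivative_at_within[OF has_real_derivative_powr])
    have "x powr (s - 1) \<le> (1 / 2) powr (s - 1)"
      using x s by (intro powr_mono2') auto
    also have "\<dots> = 2 powr (1 - s)" by (simp add: powr_divide powr_minus[symmetric] powr_diff field_simps)
    also have "\<dots> \<le> 2 powr 2" using s by (intro powr_mono) auto
    finally have "x powr (s - 1) \<le> 4" by simp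
    then have "\<bar>s\<bar> * x powr (s - 1) \<le> 1 * 4" using s by (intro mult_mono) auto
    then show "norm (s * x powr (s - 1)) \<le> 4" by (simp add: abs_mult)
  qed (use z in auto)
  then show ?thesis by simp
qed

text \<open>Dividing by a reduces everything to r = b/a \<le> \<delta>: the p-th power of the mean
  is a^p z with z = 1 - t + t r^p. The bound t \<le> 1/2 keeps z \<ge> 1/2, and |z - 1| \<le> t
  \<delta>^p. In C the term 4 \<delta>^p comes from \<open>powr_near_1\<close>, and 2 absorbs the
  factor 1 - t in \<open>mean_d1\<close>.\<close>

lemma mean_near_first:
  fixes a b \<delta> t p :: real
  assumes p: "1 < p" and a: "0 < a" and b: "0 < b" and \<delta>: "1 \<le> \<delta>" "b \<le> \<delta> * a" and t: "0 < t" "t \<le> 1 / 2"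
  defines "C \<equiv> 4 * \<delta> powr p + 2"
  shows "\<bar>powr_mean p t a b powr (1 / p) - a\<bar> \<le> C * t * a"
    and "\<bar>mean_d1 p t a b - 1\<bar> \<le> C * t" and "\<bar>mean_d2 p t a b\<bar> \<le> C * t"
proof -
  define r where "r = b / a"
  have r: "0 < r" "r \<le> \<delta>" using a b \<delta> by (simp_all add: r_def field_simps)
  have rp: "r powr p \<le> \<delta> powr p" using r p by (intro powr_mono2) auto
  have d1: "1 \<le> \<delta> powr p" using \<delta> p by (intro ge_one_powr_ge_zero) auto
  define z where "z = (1 - t) + t * r powr p"
  have z: "1 / 2 \<le> z" using t by (simp add: z_def add_increasing2)
  have "z - 1 = t * (r powr p - 1)" by (simp add: z_def algebra_simps)
  then have "\<bar>z - 1\<bar> = t * \<bar>r powr p - 1\<bar>" using t by (simp add: abs_mult)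
  also have "\<dots> \<le> t * \<delta> powr p"
  proof (rule mult_left_mono)
    have "0 < r powr p" using r by simp
    then show "\<bar>r powr p - 1\<bar> \<le> \<delta> powr p" using rp d1 by linarith
  qed (use t in simp)
  finally have z1: "\<bar>z - 1\<bar> \<le> t * \<delta> powr p" .
  have mean: "powr_mean p t a b = a powr p * z"
    using a b by (simp add: powr_mean_def z_def r_def powr_divide field_simps)
  have near: "\<bar>z powr s - 1\<bar> \<le> 4 * \<delta> powr p * t" if "- 1 \<le> s" "s \<le> 1" for s
  proof -
    have "4 * \<bar>z - 1\<bar> \<le> 4 * (t * \<delta> powr p)" using z1 by simp
    then show ?thesis using powr_near_1[OF z that] by (simp add: mult.commute mult.left_commute)
  qed
  have ip: "0 < 1 / p" "1 / p \<le> 1" using p by simp_all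
  have "powr_mean p t a b powr (1 / p) = a * z powr (1 / p)"
    unfolding mean using a z p by (simp add: powr_mult powr_powr)
  then have "powr_mean p t a b powr (1 / p) - a = a * (z powr (1 / p) - 1)"
    by (simp add: right_diff_distrib)
  then have "\<bar>powr_mean p t a b powr (1 / p) - a\<bar> = a * \<bar>z powr (1 / p) - 1\<bar>"
    using a by (simp add: abs_mult)
  also have "\<dots> \<le> a * (4 * \<delta> powr p * t)"
    using near[of "1 / p"] ip a by (intro mult_left_mono) auto
  also have "\<dots> \<le> C * t * a" using a t by (simp add: C_def algebra_simps)
  finally show "\<bar>powr_mean p t a b powr (1 / p) - a\<bar> \<le> C * t * a" .
  have zs: "z powr (1 / p - 1) \<le> 2"
  proof -
    have "z powr (1 / p - 1) \<le> (1 / 2) powr (1 / p - 1)" using z ip by (intro powr_mono2') auto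
    also have "\<dots> = 2 powr (1 - 1 / p)" by (simp add: powr_divide powr_diff field_simps)
    also have "\<dots> \<le> 2 powr 1" using ip by (intro powr_mono) auto
    finally show ?thesis by simp
  qed
  have ap: "a powr (1 - p) * a powr (p - 1) = 1" using a by (simp add: powr_add[symmetric])
  have pm: "powr_mean p t a b powr (1 / p - 1) = a powr (1 - p) * z powr (1 / p - 1)"
    unfolding mean using a z p by (simp add: powr_mult powr_powr algebra_simps)
  have e1: "mean_d1 p t a b = (1 - t) * z powr (1 / p - 1)"
    unfolding mean_d1_def pm using ap by (simp add: mult.commute mult.left_commute)
  have "b powr (p - 1) = r powr (p - 1) * a powr (p - 1)"
    using a b by (simp add: r_def powr_divide)
  then have e2: "mean_d2 p t a b = t * (z powr (1 / p - 1) * r powr (p - 1))"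
    unfolding mean_d2_def pm using ap by (simp add: mult.commute mult.left_commute)
  have "mean_d1 p t a b - 1 = (z powr (1 / p - 1) - 1) - t * z powr (1 / p - 1)"
    unfolding e1 by (simp add: algebra_simps)
  then have "\<bar>mean_d1 p t a b - 1\<bar> \<le> \<bar>z powr (1 / p - 1) - 1\<bar> + t * z powr (1 / p - 1)"
    using t abs_triangle_ineq4[of "z powr (1 / p - 1) - 1" "t * z powr (1 / p - 1)"] by (simp add: abs_mult)
  also have "\<dots> \<le> 4 * \<delta> powr p * t + t * 2"
    using near[of "1 / p - 1"] ip zs t by (intro add_mono mult_left_mono) auto
  also have "\<dots> = C * t" by (simp add: C_def algebra_simps)
  finally show "\<bar>mean_d1 p t a b - 1\<bar> \<le> C * t" .
  have "r powr (p - 1) \<le> \<delta> powr (p - 1)" using r p by (intro powr_mono2) auto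
  also have "\<dots> \<le> \<delta> powr p" using \<delta> by (intro powr_mono) auto
  finally have "z powr (1 / p - 1) * r powr (p - 1) \<le> 2 * \<delta> powr p"
    using zs by (intro mult_mono) auto
  also have "\<dots> \<le> C" using d1 by (simp add: C_def)
  finally show "\<bar>mean_d2 p t a b\<bar> \<le> C * t"
    unfolding e2 using t by (simp add: abs_mult mult.commute)
qed

section \<open>Energy of positive functions and of their means\<close>

locale quasilinear = bounded_open \<Omega> p + nondecreasing_density h
  for \<Omega> :: "'a::euclidean_space set" and p :: real and h :: "real \<Rightarrow> real" +
  fixes g :: "'a \<Rightarrow> real \<Rightarrow> real"
  assumes G_integrable: "\<And>u. u \<in> sobolev0 p \<Omega> \<Longrightarrow> integrable M (\<lambda>x. integral_from_0 (g x) (u x))"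
    and G_concave: "\<And>x. x \<in> \<Omega> \<Longrightarrow> concave_on {0..} (\<lambda>t. integral_from_0 (g x) (t powr (1 / p)))"
begin

abbreviation "G x \<equiv> integral_from_0 (g x)"
abbreviation "D \<equiv> weak_grad \<Omega>"
abbreviation "H_grad u x \<equiv> H (norm (D u x) powr p)"
abbreviation "E \<equiv> energy p \<Omega> h g"

lemma integrable_H:
  assumes "Lp M p S"
  shows "integrable M (\<lambda>x. H (norm (S x) powr p))"
proof -
  obtain B where B: "0 \<le> B" "\<And>t. 0 \<le> t \<Longrightarrow> 0 \<le> H t \<and> H t \<le> B * t" using H_bounds by blast
  show ?thesis
  proof (rule Bochner_Integration.integrable_bound)
    show "integrable M (\<lambda>x. B * norm (S x) powr p)" using assms by (simp add: Lp_def)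
    show "(\<lambda>x. H (norm (S x) powr p)) \<in> borel_measurable M"
      by (rule H_measurable) (use assms in \<open>auto simp: Lp_def\<close>)
    show "AE x in M. norm (H (norm (S x) powr p)) \<le> norm (B * norm (S x) powr p)"
    proof (rule AE_I2)
      fix x
      show "norm (H (norm (S x) powr p)) \<le> norm (B * norm (S x) powr p)"
        using B(2)[of "norm (S x) powr p"] B(1) by (simp add: abs_mult)
    qed
  qed
qed

lemma energy_eq:
  assumes "W u S"
  shows "E u = (1 / p) * (\<integral>x. H (norm (S x) powr p) \<partial>M) - (\<integral>x. G x (u x) \<partial>M)"
proof -
  have hw: "has_weak_gradient \<Omega> u S" by (rule W_has_weak_gradient[OF assms])
  have S: "S \<in> borel_measurable M" using assms by (simp add: W_def Lp_def)
  note ae = weak_grad_eq[OF hw]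
  have ae': "AE x in M. S x = D u x" using ae by eventually_elim simp
  have wm: "D u \<in> borel_measurable M"
    by (rule borel_measurable_lebesgue_on_AE[OF sets_dom S ae'])
  have "(\<integral>x. H_grad u x \<partial>M) = (\<integral>x. H (norm (S x) powr p) \<partial>M)"
  proof (rule integral_cong_AE)
    show "(\<lambda>x. H_grad u x) \<in> borel_measurable M"
      by (rule H_measurable) (use wm in auto)
    show "(\<lambda>x. H (norm (S x) powr p)) \<in> borel_measurable M"
      by (rule H_measurable) (use S in auto)
    show "AE x in M. H_grad u x = H (norm (S x) powr p)"
      using ae by eventually_elim simp
  qed
  then show ?thesis
    by (simp add: energy_def potential_def set_integral_lebesgue_on)
qed

definition mean :: "real \<Rightarrow> ('a \<Rightarrow> real) \<Rightarrow> ('a \<Rightarrow> real) \<Rightarrow> 'a \<Rightarrow> real" where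
  "mean t u v x = powr_mean p t (u x) (v x) powr (1 / p)"

definition mean_grad :: "real \<Rightarrow> ('a \<Rightarrow> real) \<Rightarrow> ('a \<Rightarrow> real) \<Rightarrow> 'a \<Rightarrow> 'a" where
  "mean_grad t u v x = mean_d1 p t (u x) (v x) *\<^sub>R D u x + mean_d2 p t (u x) (v x) *\<^sub>R D v x"

definition admissible :: "('a \<Rightarrow> real) \<Rightarrow> bool" where
  "admissible u \<longleftrightarrow> u \<in> sobolev0 p \<Omega> \<and> (\<forall>x\<in>\<Omega>. 0 < u x)"

abbreviation "H_mean t u v x \<equiv> H (norm (mean_grad t u v x) powr p)"
abbreviation "H_midpoint_eq u v x \<equiv> H_mean (1 / 2) u v x = (H_grad u x + H_grad v x) / 2"

lemma admissible_W: "admissible u \<Longrightarrow> W u (D u)"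
  by (simp add: admissible_def sobolev0_imp_W)

lemma admissible_pos: "admissible u \<Longrightarrow> x \<in> \<Omega> \<Longrightarrow> 0 < u x"
  by (simp add: admissible_def)

lemma admissible_outside: "admissible u \<Longrightarrow> x \<notin> \<Omega> \<Longrightarrow> u x = 0"
  by (simp add: admissible_def sobolev0_def)

lemma mean_W:
  assumes "0 < t" "t < 1" "admissible u" "admissible v"
  shows "W (mean t u v) (mean_grad t u v)"
  unfolding mean_def[abs_def] mean_grad_def[abs_def]
  by (rule W_mean) (use assms in \<open>auto simp: admissible_W admissible_pos\<close>)

lemma mean_pos:
  assumes "0 < t" "t < 1" "admissible u" "admissible v" "x \<in> \<Omega>"
  shows "0 < mean t u v x"
  using powr_mean_pos[of t "u x" "v x" p] assms by (simp add: mean_def admissible_pos)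

lemma mean_outside:
  assumes "admissible u" "admissible v" "x \<notin> \<Omega>"
  shows "mean t u v x = 0"
  using assms by (simp add: mean_def powr_mean_def admissible_outside)

lemma mean_admissible:
  assumes "0 < t" "t < 1" "admissible u" "admissible v"
  shows "admissible (mean t u v)"
  unfolding admissible_def
  using W_imp_sobolev0[OF mean_W[OF assms] mean_outside[OF assms(3,4)]] mean_pos[OF assms] by blast

lemma norm_mean_grad_le:
  assumes "0 < t" "t < 1" "admissible u" "admissible v" "x \<in> \<Omega>"
  shows "norm (mean_grad t u v x) powr p \<le>
    (1 - t) * norm (D u x) powr p + t * norm (D v x) powr p"
  unfolding mean_grad_def
  by (rule hidden_convexity(1)) (use assms p_gt_1 in \<open>auto simp: admissible_pos\<close>)

lemma H_mean_grad_le: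
  assumes "0 < t" "t < 1" "admissible u" "admissible v" "x \<in> \<Omega>"
  shows "H_mean t u v x \<le>
    (1 - t) * H_grad u x + t * H_grad v x"
proof -
  have "H_mean t u v x \<le>
      H ((1 - t) * norm (D u x) powr p + t * norm (D v x) powr p)"
    by (rule H_mono[OF _ norm_mean_grad_le[OF assms]]) simp
  also have "\<dots> \<le> (1 - t) * H_grad u x + t * H_grad v x"
    by (rule H_convex) (use assms in auto)
  finally show ?thesis .
qed

text \<open>(H3) is concavity in the variable u^p, and in this variable the path of means is
  affine.\<close>

lemma G_mean_ge:
  assumes "0 < t" "t < 1" "admissible u" "admissible v" "x \<in> \<Omega>"
  shows "(1 - t) * G x (u x) + t * G x (v x) \<le> G x (mean t u v x)"
proof -
  have root: "(a powr p) powr (1 / p) = a" if "0 < a" for a :: real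
    using that p_gt_1 by (simp add: powr_powr)
  have "(1 - t) * G x ((u x powr p) powr (1 / p)) + t * G x ((v x powr p) powr (1 / p)) \<le>
      G x (((1 - t) *\<^sub>R (u x powr p) + t *\<^sub>R (v x powr p)) powr (1 / p))"
    by (rule concave_onD[OF G_concave[OF assms(5)]]) (use assms in auto)
  then show ?thesis
    using assms by (simp add: mean_def powr_mean_def root admissible_pos)
qed

text \<open>The gap between the two sides is the integral of a divided by p plus the integral of b,
  where a and b are the pointwise gaps for H and for G. Both are nonnegative, so a vanishing total
  gap forces each to vanish almost everywhere.\<close>

lemma energy_mean:
  assumes "0 < t" "t < 1" "admissible u" "admissible v"
  shows "E (mean t u v) \<le> (1 - t) * E u + t * E v"
    and "E (mean t u v) = (1 - t) * E u + t * E v \<Longrightarrow>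
      (AE x in M. H_mean t u v x =
         (1 - t) * H_grad u x + t * H_grad v x) \<and>
      (AE x in M. G x (mean t u v x) = (1 - t) * G x (u x) + t * G x (v x))"
proof -
  define a where "a x = (1 - t) * H_grad u x + t * H_grad v x
      - H_mean t u v x" for x
  define b where "b x = G x (mean t u v x) - ((1 - t) * G x (u x) + t * G x (v x))" for x
  note Wu = admissible_W[OF assms(3)] and Wv = admissible_W[OF assms(4)] and Wm = mean_W[OF assms]
  have iH: "integrable M (\<lambda>x. H_grad u x)"
    "integrable M (\<lambda>x. H_grad v x)"
    "integrable M (\<lambda>x. H_mean t u v x)"
    by (rule integrable_H, use Wu Wv Wm in \<open>simp add: W_def\<close>)+
  have iG: "integrable M (\<lambda>x. G x (u x))" "integrable M (\<lambda>x. G x (v x))" "integrable M (\<lambda>x. G x (mean t u v x))"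
    by (rule G_integrable, use assms mean_admissible[OF assms] in \<open>simp add: admissible_def\<close>)+
  have ia: "integrable M a" unfolding a_def[abs_def]
    by (intro Bochner_Integration.integrable_diff Bochner_Integration.integrable_add integrable_mult_right iH)
  have ib: "integrable M b" unfolding b_def[abs_def]
    by (intro Bochner_Integration.integrable_diff Bochner_Integration.integrable_add integrable_mult_right iG)
  have Ia: "integral\<^sup>L M a = (1 - t) * (\<integral>x. H_grad u x \<partial>M) +
      t * (\<integral>x. H_grad v x \<partial>M) - (\<integral>x. H_mean t u v x \<partial>M)"
    unfolding a_def[abs_def]
    by (simp only: Bochner_Integration.integral_diff Bochner_Integration.integral_add
        Bochner_Integration.integrable_add integrable_mult_right integral_mult_right_zero iH simp_thms)
  have Ib: "integral\<^sup>L M b = (\<integral>x. G x (mean t u v x) \<partial>M) - ((1 - t) * (\<integral>x. G x (u x) \<partial>M) + t * (\<integral>x. G x (v x) \<partial>M))"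
    unfolding b_def[abs_def]
    by (simp only: Bochner_Integration.integral_diff Bochner_Integration.integral_add
        Bochner_Integration.integrable_add integrable_mult_right integral_mult_right_zero iG simp_thms)
  have gap: "(1 - t) * E u + t * E v - E (mean t u v) = (1 / p) * integral\<^sup>L M a + integral\<^sup>L M b"
    unfolding energy_eq[OF Wu] energy_eq[OF Wv] energy_eq[OF Wm] Ia Ib by (simp add: algebra_simps add_divide_distrib diff_divide_distrib)
  have a0: "AE x in M. 0 \<le> a x" and b0: "AE x in M. 0 \<le> b x"
    using H_mean_grad_le[OF assms] G_mean_ge[OF assms] by (auto simp: a_def b_def)
  have na: "0 \<le> (1 / p) * integral\<^sup>L M a" and nb: "0 \<le> integral\<^sup>L M b"
    using integral_nonneg_AE[OF a0] integral_nonneg_AE[OF b0] p_pos by simp_all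
  show "E (mean t u v) \<le> (1 - t) * E u + t * E v" using gap na nb by linarith
  assume "E (mean t u v) = (1 - t) * E u + t * E v"
  then have "(1 / p) * integral\<^sup>L M a = 0" "integral\<^sup>L M b = 0" using gap na nb by linarith+
  then have "integral\<^sup>L M a = 0" "integral\<^sup>L M b = 0" using p_pos by simp_all
  then have "AE x in M. a x = 0" "AE x in M. b x = 0"
    using integral_nonneg_eq_0_iff_AE[OF ia a0] integral_nonneg_eq_0_iff_AE[OF ib b0] by simp_all
  then show "(AE x in M. H_mean t u v x =
         (1 - t) * H_grad u x + t * H_grad v x) \<and>
      (AE x in M. G x (mean t u v x) = (1 - t) * G x (u x) + t * G x (v x))"
    by (auto simp: a_def b_def elim: eventually_mono)
qed

text \<open>By \<open>mean_near_first\<close> the difference of the functions is at most C t |u| and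
  that of the gradients at most C t (|Du| + |Dv|). The one-sided bound of v by u is what makes C
  uniform in x.\<close>

lemma mean_path_Lipschitz:
  assumes u: "admissible u" and v: "admissible v" and \<delta>: "1 \<le> \<delta>" "\<And>x. x \<in> \<Omega> \<Longrightarrow> v x \<le> \<delta> * u x"
  shows "\<exists>C\<ge>0. \<forall>t. 0 < t \<and> t \<le> 1 / 2 \<longrightarrow> (\<lambda>x. mean t u v x - u x) \<in> sobolev0 p \<Omega> \<and>
    sobolev_norm p \<Omega> (\<lambda>x. mean t u v x - u x) \<le> C * t"
proof -
  let ?w = "\<lambda>t x. mean t u v x - u x"
  define C where "C = 4 * \<delta> powr p + 2"
  have C: "0 \<le> C" by (simp add: C_def)
  let ?U = "D u" and ?V = "D v"
  note Wu = admissible_W[OF u] and Wv = admissible_W[OF v]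
  have L: "Lp M p u" "Lp M p ?U" "Lp M p ?V" using Wu Wv by (simp_all add: W_def)
  have nL: "Lp M p (\<lambda>x. norm (?U x))" "Lp M p (\<lambda>x. norm (?V x))"
    using L by (auto simp: Lp_def)
  have UV: "Lp M p (\<lambda>x. norm (?U x) + norm (?V x))"
    by (rule Lp_add(1)[OF nL p_nonneg])
  \<comment> \<open>K collects the p-th means of the two majorants, so that the norm is at most C t
    times the p-th root of K.\<close>
  define K where "K = Lp_int M p u + (\<integral>x. norm (norm (?U x) + norm (?V x)) powr p \<partial>M)"
  have K: "0 \<le> K" by (simp add: K_def)
  have main: "(?w t) \<in> sobolev0 p \<Omega> \<and>
    sobolev_norm p \<Omega> (?w t) \<le> (C * K powr (1 / p)) * t" if t: "0 < t" "t \<le> 1 / 2" for t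
  proof -
    have t1: "t < 1" using t by simp
    note Wm = mean_W[OF t(1) t1 u v]
    have Wd: "W (?w t) (\<lambda>x. mean_grad t u v x - ?U x)"
      by (rule W_diff[OF Wm Wu]) (use mean_pos[OF t(1) t1 u v] u in \<open>auto simp: admissible_pos\<close>)
    have mem: "(?w t) \<in> sobolev0 p \<Omega>"
      by (rule W_imp_sobolev0[OF Wd]) (use mean_outside[OF u v] admissible_outside[OF u] in simp)
    have Ld: "Lp M p (?w t)" "Lp M p (\<lambda>x. mean_grad t u v x - ?U x)"
      using Wd by (simp_all add: W_def)
    have Ct: "0 \<le> C * t" using C t by simp
    have b1: "\<bar>mean t u v x - u x\<bar> \<le> (C * t) * norm (u x)" if "x \<in> \<Omega>" for x
      using mean_near_first(1)[OF p_gt_1 admissible_pos[OF u that] admissible_pos[OF v that] \<delta>(1) \<delta>(2)[OF that] t]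
        admissible_pos[OF u that] by (simp add: mean_def C_def)
    have b2: "norm (mean_grad t u v x - ?U x) \<le> (C * t) * (norm (?U x) + norm (?V x))" if "x \<in> \<Omega>" for x
    proof -
      note near = mean_near_first(2,3)[OF p_gt_1 admissible_pos[OF u that] admissible_pos[OF v that] \<delta>(1) \<delta>(2)[OF that] t]
      have "mean_grad t u v x - ?U x = (mean_d1 p t (u x) (v x) - 1) *\<^sub>R ?U x + mean_d2 p t (u x) (v x) *\<^sub>R ?V x"
        by (simp add: mean_grad_def algebra_simps)
      then have "norm (mean_grad t u v x - ?U x) \<le>
          \<bar>mean_d1 p t (u x) (v x) - 1\<bar> * norm (?U x) + \<bar>mean_d2 p t (u x) (v x)\<bar> * norm (?V x)"
        using norm_triangle_ineq[of "(mean_d1 p t (u x) (v x) - 1) *\<^sub>R ?U x" "mean_d2 p t (u x) (v x) *\<^sub>R ?V x"] by simp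
      also have "\<dots> \<le> (C * t) * norm (?U x) + (C * t) * norm (?V x)"
        using near unfolding C_def[symmetric] by (intro add_mono mult_right_mono) auto
      finally show ?thesis by (simp add: distrib_left)
    qed
    have i1: "(\<integral>x. norm (mean t u v x - u x) powr p \<partial>M) \<le> (C * t) powr p * Lp_int M p u"
      by (rule Lp_bound(2)[OF L(1) _ _ Ct p_nonneg]) (use Ld b1 in \<open>auto simp: Lp_def\<close>)
    have i2: "(\<integral>x. norm (mean_grad t u v x - ?U x) powr p \<partial>M) \<le>
        (C * t) powr p * (\<integral>x. norm (norm (?U x) + norm (?V x)) powr p \<partial>M)"
      by (rule Lp_bound(2)[OF UV _ _ Ct p_nonneg]) (use Ld b2 in \<open>auto simp: Lp_def\<close>)
    have "sobolev_norm p \<Omega> (?w t) =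
      ((\<integral>x. \<bar>mean t u v x - u x\<bar> powr p \<partial>M) + (\<integral>x. norm (mean_grad t u v x - ?U x) powr p \<partial>M)) powr (1 / p)"
      by (rule sobolev_norm_eq[OF W_has_weak_gradient[OF Wd]]) (use Ld in \<open>simp add: Lp_def\<close>)
    also have "\<dots> \<le> ((C * t) powr p * K) powr (1 / p)"
    proof (rule powr_mono2)
      show "(\<integral>x. \<bar>mean t u v x - u x\<bar> powr p \<partial>M) + (\<integral>x. norm (mean_grad t u v x - ?U x) powr p \<partial>M) \<le> (C * t) powr p * K"
        using i1 i2 unfolding K_def distrib_left real_norm_def by linarith
    qed (use p_pos in \<open>auto intro!: add_nonneg_nonneg integral_nonneg_AE\<close>)
    also have "\<dots> = (C * K powr (1 / p)) * t"
      using C t K p_pos by (simp add: powr_mult powr_powr)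
    finally show ?thesis using mem by blast
  qed
  then show ?thesis using C by (intro exI[of _ "C * K powr (1 / p)"]) auto
qed

text \<open>If E v lay below E u by \<eta> > 0, convexity would make E fall along the path by at
  least t \<eta>, while criticality allows a fall of at most \<epsilon> C t.\<close>

lemma critical_point_minimal:
  assumes crit: "critical_point p \<Omega> h g u" and u: "admissible u" and v: "admissible v"
    and \<delta>: "1 \<le> \<delta>" "\<And>x. x \<in> \<Omega> \<Longrightarrow> v x \<le> \<delta> * u x"
  shows "E u \<le> E v"
proof (rule ccontr)
  assume "\<not> E u \<le> E v"
  define \<eta> where "\<eta> = E u - E v"
  have \<eta>: "0 < \<eta>" using \<open>\<not> E u \<le> E v\<close> by (simp add: \<eta>_def)
  obtain C where C: "0 \<le> C" and path: "\<And>t. 0 < t \<Longrightarrow> t \<le> 1 / 2 \<Longrightarrow> (\<lambda>x. mean t u v x - u x) \<in> sobolev0 p \<Omega> \<and>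
      sobolev_norm p \<Omega> (\<lambda>x. mean t u v x - u x) \<le> C * t"
    using mean_path_Lipschitz[OF u v \<delta>] by blast
  \<comment> \<open>This choice gives \<epsilon> C < \<eta>; adding 1 covers the case C = 0.\<close>
  define \<epsilon> where "\<epsilon> = \<eta> / (2 * (C + 1))"
  have \<epsilon>: "0 < \<epsilon>" using \<eta> C by (simp add: \<epsilon>_def)
  have "has_frechet_derivative0 p \<Omega> E (\<lambda>v. 0) u" using crit by (simp add: critical_point_def)
  then obtain d where d: "0 < d" and deriv: "\<And>w. w \<in> sobolev0 p \<Omega> \<Longrightarrow> sobolev_norm p \<Omega> w < d \<Longrightarrow>
      \<bar>E (\<lambda>x. u x + w x) - E u - 0\<bar> \<le> \<epsilon> * sobolev_norm p \<Omega> w"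
    unfolding has_frechet_derivative0_def using \<epsilon> by blast
  \<comment> \<open>Small enough that C t \<le> d/2 < d, so that the first-order expansion applies
    to the point of the path at t.\<close>
  define t where "t = min (1 / 2) (d / (2 * (C + 1)))"
  have "0 < t" using d C by (simp add: t_def)
  moreover have "t \<le> 1 / 2" unfolding t_def by (rule min.cobounded1)
  ultimately have t: "0 < t" "t \<le> 1 / 2" by simp_all
  then have "t < 1" by simp
  note t = t this
  let ?w = "\<lambda>x. mean t u v x - u x"
  note w = path[OF t(1,2)]
  have "C * t \<le> (C + 1) * (d / (2 * (C + 1)))"
    using C t d by (intro mult_mono) (auto simp: t_def)
  also have "\<dots> = d / 2" using C by (simp add: field_simps)
  finally have "sobolev_norm p \<Omega> ?w < d" using w d by linarith
  then have "\<bar>E (\<lambda>x. u x + ?w x) - E u - 0\<bar> \<le> \<epsilon> * sobolev_norm p \<Omega> ?w"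
    using deriv w by blast
  also have "\<dots> \<le> \<epsilon> * (C * t)" using w \<epsilon> by (intro mult_left_mono) auto
  finally have "E u - \<epsilon> * (C * t) \<le> E (mean t u v)" by simp
  also have "\<dots> \<le> (1 - t) * E u + t * E v" by (rule energy_mean(1)[OF t(1,3) u v])
  also have "\<dots> = E u - t * \<eta>" by (simp add: \<eta>_def algebra_simps)
  finally have "t * \<eta> \<le> t * (\<epsilon> * C)" by (simp add: algebra_simps)
  then have "\<eta> \<le> \<epsilon> * C" using t by simp
  also have "\<dots> < \<epsilon> * (2 * (C + 1))" using \<epsilon> C by (intro mult_strict_left_mono) auto
  also have "\<dots> = \<eta>" using C by (simp add: \<epsilon>_def)
  finally show False by simp
qed

end

context bounded_open
begin

text \<open>The logarithms of \<open>u\<close> and \<open>v\<close> have the same weak gradient. They are approximated by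
  \<open>ln (u\<^sup>2 + e\<^sup>2) / 2\<close> as \<open>e\<close> tends to 0, because only the latter is a Lipschitz function of \<open>u\<close>.\<close>

lemma log_ratio_orthogonal:
  assumes u: "W u Su" and v: "W v Sv" and cu: "continuous_on \<Omega> u" and cv: "continuous_on \<Omega> v"
    and pos: "\<And>x. x \<in> \<Omega> \<Longrightarrow> 0 < u x \<and> 0 < v x"
    and eq: "AE x in M. inverse (u x) *\<^sub>R Su x = inverse (v x) *\<^sub>R Sv x"
    and \<phi>: "test_function \<Omega> \<phi>" and i: "i \<in> Basis"
  shows "(\<integral>x. (ln (u x) - ln (v x)) * (grad \<phi> x \<bullet> i) \<partial>M) = 0"
proof -
  define e where "e n = inverse (real (Suc n))" for n
  have e: "0 < e n" "e n \<le> 1" for n by (simp_all add: e_def inverse_le_1_iff)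
  have e0: "e \<longlonglongrightarrow> 0" unfolding e_def[abs_def] by (rule LIMSEQ_inverse_real_of_nat)
  define l where "l n a = ln (a\<^sup>2 + (e n)\<^sup>2) / 2" for n a
  define q where "q n a = a / (a\<^sup>2 + (e n)\<^sup>2)" for n a
  have sq: "0 < a\<^sup>2 + (e n)\<^sup>2" for a n using e[of n] by (simp add: add_nonneg_pos)
  note s = test_function_smooth[OF \<phi>]
  have cg: "continuous_on UNIV (\<lambda>x. grad \<phi> x \<bullet> i)" and c\<phi>: "continuous_on UNIV \<phi>"
    by (intro continuous_intros continuous_on_grad smooth_continuous_on s)+
  have mu: "u \<in> borel_measurable M" "v \<in> borel_measurable M" "Su \<in> borel_measurable M" "Sv \<in> borel_measurable M"
    using u v by (simp_all add: W_def Lp_def)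
  have mg: "(\<lambda>x. grad \<phi> x \<bullet> i) \<in> borel_measurable M" "\<phi> \<in> borel_measurable M"
    by (rule continuous_measurable[OF cg], rule continuous_measurable[OF c\<phi>])
  have Wu: "W (\<lambda>x. l n (u x) - ln (e n)) (\<lambda>x. q n (u x) *\<^sub>R Su x)" for n
    unfolding l_def q_def by (rule W_log[OF u _ e(1)]) (use pos in blast)
  have Wv: "W (\<lambda>x. l n (v x) - ln (e n)) (\<lambda>x. q n (v x) *\<^sub>R Sv x)" for n
    unfolding l_def q_def by (rule W_log[OF v _ e(1)]) (use pos in blast)
  obtain K where K: "compact K \<and> K \<subseteq> \<Omega> \<and> (\<forall>x. x \<notin> K \<longrightarrow> \<phi> x = 0 \<and> grad \<phi> x = 0)"
    using test_function_support[OF \<phi>] by blast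
  \<comment> \<open>Only the support K of \<phi> matters. There continuity and positivity bound u
    and v from both sides, which gives a majorant for the logarithms and for the reciprocal of
    u.\<close>
  have bounds: "\<exists>c C. 0 < c \<and> (\<forall>x\<in>K. c \<le> w x \<and> w x \<le> C)"
    if "continuous_on \<Omega> w" "\<And>x. x \<in> \<Omega> \<Longrightarrow> 0 < w x" for w :: "'a \<Rightarrow> real"
  proof (cases "K = {}")
    case False
    have cK: "continuous_on K w" using that(1) K continuous_on_subset by blast
    obtain x1 where "x1 \<in> K" "\<forall>y\<in>K. w x1 \<le> w y"
      using continuous_attains_inf[OF _ False cK] K by blast
    moreover obtain x2 where "x2 \<in> K" "\<forall>y\<in>K. w y \<le> w x2"
      using continuous_attains_sup[OF _ False cK] K by blast
    ultimately show ?thesis using that(2) K by blast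
  qed (auto intro: exI[of _ 1])
  obtain c1 C1 where b1: "0 < c1" "\<And>x. x \<in> K \<Longrightarrow> c1 \<le> u x \<and> u x \<le> C1"
    using bounds[OF cu] pos by blast
  obtain c2 C2 where b2: "0 < c2" "\<And>x. x \<in> K \<Longrightarrow> c2 \<le> v x \<and> v x \<le> C2"
    using bounds[OF cv] pos by blast
  have l_bound: "\<bar>l n a\<bar> \<le> \<bar>ln c\<bar> + \<bar>ln (C\<^sup>2 + 1)\<bar>" if "0 < c" "c \<le> a" "a \<le> C" for n a c C
  proof -
    have "ln (c\<^sup>2) \<le> ln (a\<^sup>2 + (e n)\<^sup>2)"
      using that sq[of a n] power_mono[of c a 2] by (intro ln_mono) (auto intro: add_increasing2)
    then have lo: "ln c \<le> l n a" using that by (simp add: l_def ln_realpow)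
    have "a\<^sup>2 + (e n)\<^sup>2 \<le> C\<^sup>2 + 1"
    proof (rule add_mono)
      show "a\<^sup>2 \<le> C\<^sup>2" using that by (intro power_mono) auto
      show "(e n)\<^sup>2 \<le> 1" using e[of n] by (intro power_le_one) auto
    qed
    then have "l n a \<le> ln (C\<^sup>2 + 1) / 2" using sq[of a n] by (simp add: l_def)
    then show ?thesis using lo by linarith
  qed
  define B where "B = \<bar>ln c1\<bar> + \<bar>ln (C1\<^sup>2 + 1)\<bar> + (\<bar>ln c2\<bar> + \<bar>ln (C2\<^sup>2 + 1)\<bar>)"
  have l_lim: "(\<lambda>n. l n a) \<longlonglongrightarrow> ln a" if "0 < a" for a
  proof -
    have "(\<lambda>n. ln (a\<^sup>2 + (e n)\<^sup>2) / 2) \<longlonglongrightarrow> ln (a\<^sup>2 + 0\<^sup>2) / 2"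
      using that by (intro tendsto_intros e0) auto
    then show ?thesis using that by (simp add: l_def ln_realpow)
  qed
  have q_lim: "(\<lambda>n. q n a * a) \<longlonglongrightarrow> 1" if "0 < a" for a
  proof -
    have "(\<lambda>n. a / (a\<^sup>2 + (e n)\<^sup>2) * a) \<longlonglongrightarrow> a / (a\<^sup>2 + 0\<^sup>2) * a"
      using that by (intro tendsto_intros e0) auto
    then show ?thesis using that by (simp add: q_def power2_eq_square)
  qed
  have q_bound: "\<bar>q n a * a\<bar> \<le> 1" for n a
    using sq[of a n] by (simp add: q_def power2_eq_square[symmetric])
  let ?L = "\<lambda>n x. (l n (u x) - l n (v x)) * (grad \<phi> x \<bullet> i)"
  let ?R = "\<lambda>n x. (q n (u x) * (Su x \<bullet> i) - q n (v x) * (Sv x \<bullet> i)) * \<phi> x"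
  \<comment> \<open>\<open>?T\<close> is \<open>?R\<close> rewritten with the common logarithmic
    gradient. The products q n(a) a are bounded by 1 and tend to 1, so their difference tends to
    0.\<close>
  let ?T = "\<lambda>n x. (q n (u x) * u x - q n (v x) * v x) * (inverse (u x) * (Su x \<bullet> i)) * \<phi> x"
  have parts: "(\<integral>x. ?L n x \<partial>M) = - (\<integral>x. ?R n x \<partial>M)" for n
  proof -
    have Ll: "Lp M p (\<lambda>x. l n (u x) - ln (e n))" "Lp M p (\<lambda>x. l n (v x) - ln (e n))"
      "Lp M p (\<lambda>x. q n (u x) *\<^sub>R Su x)" "Lp M p (\<lambda>x. q n (v x) *\<^sub>R Sv x)"
      using Wu[of n] Wv[of n] by (simp_all add: W_def)
    note j1 = Lp_mult_continuous_integrable[OF Ll(1) cg] and j2 = Lp_mult_continuous_integrable[OF Ll(2) cg]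
      and j3 = Lp_mult_continuous_integrable[OF Lp_inner[OF Ll(3)] c\<phi>, of i]
      and j4 = Lp_mult_continuous_integrable[OF Lp_inner[OF Ll(4)] c\<phi>, of i]
    \<comment> \<open>The constant ln (e n), required for the zero boundary values, is inserted for
      both functions and cancels in the difference.\<close>
    have "(\<integral>x. ?L n x \<partial>M) = (\<integral>x. (l n (u x) - ln (e n)) * (grad \<phi> x \<bullet> i) - (l n (v x) - ln (e n)) * (grad \<phi> x \<bullet> i) \<partial>M)"
      by (simp only: left_diff_distrib[symmetric]) simp
    also have "\<dots> = (\<integral>x. (l n (u x) - ln (e n)) * (grad \<phi> x \<bullet> i) \<partial>M) - (\<integral>x. (l n (v x) - ln (e n)) * (grad \<phi> x \<bullet> i) \<partial>M)"
      by (rule Bochner_Integration.integral_diff[OF j1 j2])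
    also have "\<dots> = - (\<integral>x. ((q n (u x) *\<^sub>R Su x) \<bullet> i) * \<phi> x \<partial>M) - - (\<integral>x. ((q n (v x) *\<^sub>R Sv x) \<bullet> i) * \<phi> x \<partial>M)"
      unfolding W_by_parts[OF Wu s] W_by_parts[OF Wv s] ..
    also have "\<dots> = - (\<integral>x. ((q n (u x) *\<^sub>R Su x) \<bullet> i) * \<phi> x - ((q n (v x) *\<^sub>R Sv x) \<bullet> i) * \<phi> x \<partial>M)"
      unfolding Bochner_Integration.integral_diff[OF j3 j4] by linarith
    also have "\<dots> = - (\<integral>x. ?R n x \<partial>M)"
      by (simp only: left_diff_distrib inner_scaleR_left)
    finally show ?thesis .
  qed
  have mL: "(\<lambda>x. l n (w x)) \<in> borel_measurable M" "(\<lambda>x. q n (w x)) \<in> borel_measurable M"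
    if [measurable]: "w \<in> borel_measurable M" for n and w :: "'a \<Rightarrow> real"
    unfolding l_def q_def by measurable
  have lim1: "(\<lambda>n. \<integral>x. ?L n x \<partial>M) \<longlonglongrightarrow> (\<integral>x. (ln (u x) - ln (v x)) * (grad \<phi> x \<bullet> i) \<partial>M)"
  proof (rule integral_dominated_convergence[where w = "\<lambda>x. B * \<bar>grad \<phi> x \<bullet> i\<bar>"])
    show "(\<lambda>x. (ln (u x) - ln (v x)) * (grad \<phi> x \<bullet> i)) \<in> borel_measurable M"
      by (intro borel_measurable_times borel_measurable_diff borel_measurable_ln mu mg)
    show "?L n \<in> borel_measurable M" for n
      by (intro borel_measurable_times borel_measurable_diff mL mu mg)
    have "Lp M p (\<lambda>x. \<bar>grad \<phi> x \<bullet> i\<bar>)"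
      by (intro continuous_Lp continuous_intros continuous_on_grad s)
    then show "integrable M (\<lambda>x. B * \<bar>grad \<phi> x \<bullet> i\<bar>)"
      by (intro integrable_mult_right Lp_imp_integrable[OF _ p_ge_1])
    show "AE x in M. (\<lambda>n. ?L n x) \<longlonglongrightarrow> (ln (u x) - ln (v x)) * (grad \<phi> x \<bullet> i)"
      using pos by (intro AE_I2 tendsto_intros l_lim) auto
    show "AE x in M. norm (?L n x) \<le> B * \<bar>grad \<phi> x \<bullet> i\<bar>" for n
    proof (rule AE_I2)
      fix x
      show "norm (?L n x) \<le> B * \<bar>grad \<phi> x \<bullet> i\<bar>"
      proof (cases "x \<in> K")
        case True
        have "\<bar>l n (u x) - l n (v x)\<bar> \<le> B"
          using l_bound[of c1 "u x" C1 n] l_bound[of c2 "v x" C2 n] b1(1) b1(2)[OF True] b2(1) b2(2)[OF True]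
          unfolding B_def by linarith
        then show ?thesis by (simp add: abs_mult mult_right_mono)
      next
        case False
        then have "grad \<phi> x = 0" using K by blast
        then show ?thesis by simp
      qed
    qed
  qed
  have lim2: "(\<lambda>n. \<integral>x. ?R n x \<partial>M) \<longlonglongrightarrow> (\<integral>x. 0 \<partial>M)"
  proof (rule integral_dominated_convergence[where w = "\<lambda>x. 2 * inverse c1 * norm (norm (Su x) * \<phi> x)"])
    show "?R n \<in> borel_measurable M" for n
      by (intro borel_measurable_times borel_measurable_diff mL mu mg borel_measurable_inner borel_measurable_const)
    have "Lp M p (\<lambda>x. norm (Su x))" using u by (auto simp: W_def Lp_def)
    then show "integrable M (\<lambda>x. 2 * inverse c1 * norm (norm (Su x) * \<phi> x))"
      by (intro integrable_mult_right integrable_norm Lp_mult_continuous_integrable c\<phi>)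
    have split: "AE x in M. x \<in> \<Omega> \<and> (\<forall>n. ?R n x = ?T n x)"
      using eq AE_space[of M]
    proof eventually_elim
      case (elim x)
      then have x: "0 < u x" "0 < v x" "x \<in> \<Omega>" using pos by auto
      have "inverse (u x) * (Su x \<bullet> i) = inverse (v x) * (Sv x \<bullet> i)"
        using arg_cong[OF elim(1), of "\<lambda>y. y \<bullet> i"] by simp
      then have "Sv x \<bullet> i = v x * (inverse (u x) * (Su x \<bullet> i))" "Su x \<bullet> i = u x * (inverse (u x) * (Su x \<bullet> i))"
        using x by (simp_all add: field_simps)
      then have "?R n x = (q n (u x) * (u x * (inverse (u x) * (Su x \<bullet> i))) - q n (v x) * (v x * (inverse (u x) * (Su x \<bullet> i)))) * \<phi> x" for n
        by presburger
      then show ?case using x by (simp add: algebra_simps)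
    qed
    show "AE x in M. (\<lambda>n. ?R n x) \<longlonglongrightarrow> 0"
      using split
    proof eventually_elim
      case (elim x)
      have "(\<lambda>n. ?T n x) \<longlonglongrightarrow>
          (1 - 1) * (inverse (u x) * (Su x \<bullet> i)) * \<phi> x"
        using elim pos by (intro tendsto_intros q_lim) auto
      moreover have "?R n x = ?T n x" for n
        using elim by blast
      ultimately show ?case by (simp only: diff_self mult_zero_left)
    qed
    show "AE x in M. norm (?R n x) \<le> 2 * inverse c1 * norm (norm (Su x) * \<phi> x)" for n
      using split
    proof eventually_elim
      case (elim x)
      show ?case
      proof (cases "x \<in> K")
        case True
        have 1: "\<bar>q n (u x) * u x - q n (v x) * v x\<bar> \<le> 2" using q_bound[of n "u x"] q_bound[of n "v x"] by linarith
        have "inverse (u x) \<le> inverse c1" using b1(1) b1(2)[OF True] by (intro le_imp_inverse_le) auto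
        then have "\<bar>inverse (u x) * (Su x \<bullet> i)\<bar> \<le> inverse c1 * norm (Su x)"
          using Basis_le_norm[OF i, of "Su x"] b1(1) b1(2)[OF True]
          unfolding abs_mult by (intro mult_mono) auto
        then have "\<bar>q n (u x) * u x - q n (v x) * v x\<bar> * \<bar>inverse (u x) * (Su x \<bullet> i)\<bar> \<le> 2 * (inverse c1 * norm (Su x))"
          by (rule mult_mono[OF 1]) auto
        then have "\<bar>q n (u x) * u x - q n (v x) * v x\<bar> * \<bar>inverse (u x) * (Su x \<bullet> i)\<bar> * \<bar>\<phi> x\<bar> \<le>
            2 * (inverse c1 * norm (Su x)) * \<bar>\<phi> x\<bar>"
          by (rule mult_right_mono) simp
        moreover have "?R n x = ?T n x"
          using elim by blast
        ultimately show ?thesis by (simp only: real_norm_def abs_mult abs_norm_cancel mult.assoc)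
      next
        case False
        then have "\<phi> x = 0" using K by blast
        then show ?thesis by simp
      qed
    qed
  qed simp
  have "(\<lambda>n. \<integral>x. ?L n x \<partial>M) \<longlonglongrightarrow> - (\<integral>x. 0 \<partial>M)"
    unfolding parts by (rule tendsto_minus[OF lim2])
  then have "(\<lambda>n. \<integral>x. ?L n x \<partial>M) \<longlonglongrightarrow> 0" by simp
  from LIMSEQ_unique[OF lim1 this] show ?thesis .
qed

end

context quasilinear
begin

section \<open>Equality cases\<close>

lemma critical_points_mean_equality:
  assumes cu: "critical_point p \<Omega> h g u" and cv: "critical_point p \<Omega> h g v"
    and u: "admissible u" and v: "admissible v" and comp: "comparable_on \<Omega> u v"
  shows "E u = E v"
    and "AE x in M. H_midpoint_eq u v x"
    and "AE x in M. G x (mean (1 / 2) u v x) = (G x (u x) + G x (v x)) / 2"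
proof -
  obtain \<delta> where \<delta>: "1 \<le> \<delta>" and "\<forall>x\<in>\<Omega>. inverse \<delta> * v x \<le> u x \<and> u x \<le> \<delta> * v x"
    using comp unfolding comparable_on_def by blast
  then have vu: "v x \<le> \<delta> * u x" and uv: "u x \<le> \<delta> * v x" if "x \<in> \<Omega>" for x
    using that by (auto simp: field_simps)
  have "E u \<le> E v" by (rule critical_point_minimal[OF cu u v \<delta> vu])
  moreover have "E v \<le> E u" by (rule critical_point_minimal[OF cv v u \<delta> uv])
  ultimately show eq: "E u = E v" by simp
  have half: "0 < (1 / 2 :: real)" "(1 / 2 :: real) < 1" by simp_all
  \<comment> \<open>Both u and v are at most \<delta> u, hence so is their mean, and minimality of u
    applies to the mean with the same \<delta>.\<close>
  have "mean (1 / 2) u v x \<le> \<delta> * u x" if x: "x \<in> \<Omega>" for x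
  proof -
    have ux: "0 < u x" and vx: "0 < v x" using u v x by (simp_all add: admissible_pos)
    have "u x powr p \<le> (\<delta> * u x) powr p" "v x powr p \<le> (\<delta> * u x) powr p"
      using ux vx vu[OF x] \<delta> p_nonneg by (auto intro!: powr_mono2)
    then have "powr_mean p (1 / 2) (u x) (v x) \<le> (\<delta> * u x) powr p"
      by (simp add: powr_mean_def)
    then have "mean (1 / 2) u v x \<le> ((\<delta> * u x) powr p) powr (1 / p)"
      unfolding mean_def using powr_mean_pos[of "1 / 2" "u x" "v x" p] ux vx p_pos
      by (intro powr_mono2) auto
    then show ?thesis using ux \<delta> p_pos by (simp add: powr_powr)
  qed
  then have "E u \<le> E (mean (1 / 2) u v)"
    by (rule critical_point_minimal[OF cu u mean_admissible[OF half u v] \<delta>])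
  then have "E (mean (1 / 2) u v) = (1 - 1 / 2) * E u + (1 / 2) * E v"
    using energy_mean(1)[OF half u v] eq by simp
  from energy_mean(2)[OF half u v this]
  have "AE x in M. H_mean (1 / 2) u v x =
      (1 - 1 / 2) * H_grad u x + (1 / 2) * H_grad v x"
    "AE x in M. G x (mean (1 / 2) u v x) = (1 - 1 / 2) * G x (u x) + (1 / 2) * G x (v x)"
    by blast+
  then show "AE x in M. H_midpoint_eq u v x"
    "AE x in M. G x (mean (1 / 2) u v x) = (G x (u x) + G x (v x)) / 2"
    by (simp_all add: add_divide_distrib)
qed

lemma equal_if_strictly_concave:
  assumes u: "admissible u" and v: "admissible v" and cu: "continuous_on \<Omega> u" and cv: "continuous_on \<Omega> v"
    and eq: "AE x in M. G x (mean (1 / 2) u v x) = (G x (u x) + G x (v x)) / 2"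
    and strict: "\<forall>x\<in>\<Omega>. strictly_concave_on {0..} (\<lambda>t. G x (t powr (1 / p)))"
  shows "u = v"
proof -
  have "AE x in M. u x = v x"
    using eq AE_space[of M]
  proof eventually_elim
    case (elim x)
    then have x: "x \<in> \<Omega>" by simp
    have ux: "0 < u x" and vx: "0 < v x" using u v x by (simp_all add: admissible_pos)
    have root: "(a powr p) powr (1 / p) = a" if "0 < a" for a :: real
      using that p_gt_1 by (simp add: powr_powr)
    show "u x = v x"
    proof (rule ccontr)
      assume "u x \<noteq> v x"
      then have "u x powr p \<noteq> v x powr p" using root[OF ux] root[OF vx] by metis
      then have "(1 - 1 / 2) * G x ((u x powr p) powr (1 / p)) + (1 / 2) * G x ((v x powr p) powr (1 / p)) <
          G x (((1 - 1 / 2) * u x powr p + (1 / 2) * v x powr p) powr (1 / p))"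
        using strict[rule_format, OF x, unfolded strictly_concave_on_def, THEN conjunct2,
            rule_format, of "u x powr p" "v x powr p" "1 / 2"] by simp
      then show False using elim root[OF ux] root[OF vx] by (simp add: mean_def powr_mean_def)
    qed
  qed
  then have ae: "AE x in lebesgue. x \<in> \<Omega> \<longrightarrow> u x = v x" by (simp add: AE_lebesgue_on)
  have "u x = v x" for x
    using continuous_AE_eq_imp_eq[OF open_dom cu cv ae] admissible_outside[OF u] admissible_outside[OF v]
    by (cases "x \<in> \<Omega>") auto
  then show ?thesis by blast
qed

text \<open>The value of H at the convex bound lies between the two sides of the midpoint equality
  and so equals both. Strict monotonicity of H gives equality in the hidden convexity. The second
  conclusion, equality in the convexity of H, is kept for the case of strictly increasing h.\<close>

lemma gradients_parallel:
  assumes u: "admissible u" and v: "admissible v"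
    and eq: "AE x in M. H_midpoint_eq u v x"
    and h_pos: "\<forall>t>0. 0 < h t"
  shows "AE x in M. inverse (u x) *\<^sub>R D u x = inverse (v x) *\<^sub>R D v x \<and>
    H ((norm (D u x) powr p + norm (D v x) powr p) / 2) =
      (H_grad u x + H_grad v x) / 2"
  using eq AE_space[of M]
proof eventually_elim
  case (elim x)
  then have x: "x \<in> \<Omega>" by simp
  let ?a = "norm (D u x) powr p" and ?b = "norm (D v x) powr p"
    and ?m = "norm (mean_grad (1 / 2) u v x) powr p"
  have half: "0 < (1 / 2 :: real)" "(1 / 2 :: real) < 1" by simp_all
  have le: "?m \<le> (?a + ?b) / 2" using norm_mean_grad_le[OF half u v x] by simp
  have "H ?m \<le> H ((?a + ?b) / 2)" by (rule H_mono[OF _ le]) simp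
  moreover have "H ((?a + ?b) / 2) \<le> (H ?a + H ?b) / 2"
    using H_convex[of ?a ?b "1 / 2"] by (simp add: add_divide_distrib)
  ultimately have Heq: "H ((?a + ?b) / 2) = (H ?a + H ?b) / 2" "H ?m = H ((?a + ?b) / 2)"
    using elim(1) by linarith+
  have "?m = (?a + ?b) / 2"
  proof (rule ccontr)
    assume "?m \<noteq> (?a + ?b) / 2"
    then have "?m < (?a + ?b) / 2" using le by simp
    then have "H ?m < H ((?a + ?b) / 2)" using h_pos by (intro H_strict_mono) auto
    then show False using Heq by simp
  qed
  then have "?m = (1 - 1 / 2) * ?a + (1 / 2) * ?b" by simp
  then have "inverse (u x) *\<^sub>R D u x = inverse (v x) *\<^sub>R D v x"
    unfolding mean_grad_def
    by (intro hidden_convexity(2)[OF p_gt_1 half admissible_pos[OF u x] admissible_pos[OF v x]])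
  then show ?case using Heq by blast
qed

text \<open>The difference of logarithms is continuous and orthogonal to all gradients of test
  functions, hence a constant k on the connected domain; then \<alpha> = exp k. Outside the domain
  both functions are 0.\<close>

lemma proportional:
  assumes conn: "connected \<Omega>" and u: "admissible u" and v: "admissible v"
    and cu: "continuous_on \<Omega> u" and cv: "continuous_on \<Omega> v"
    and par: "AE x in M. inverse (u x) *\<^sub>R D u x = inverse (v x) *\<^sub>R D v x"
  shows "\<exists>\<alpha>>0. u = (\<lambda>x. \<alpha> * v x)"
proof -
  have pos: "0 < u x \<and> 0 < v x" if "x \<in> \<Omega>" for x using u v that by (simp add: admissible_pos)
  have "(\<lambda>x. ln (u x) - ln (v x)) constant_on \<Omega>"
  proof (rule constant_if_orthogonal[OF conn])
    show "continuous_on \<Omega> (\<lambda>x. ln (u x) - ln (v x))"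
      by (intro continuous_intros cu cv) (use pos in force)+
    show "(\<integral>x. (ln (u x) - ln (v x)) * (grad \<phi> x \<bullet> i) \<partial>M) = 0"
      if "test_function \<Omega> \<phi>" "i \<in> Basis" for \<phi> i
      by (rule log_ratio_orthogonal[OF admissible_W[OF u] admissible_W[OF v] cu cv pos par that])
  qed
  then obtain k where k: "\<And>x. x \<in> \<Omega> \<Longrightarrow> ln (u x) - ln (v x) = k" unfolding constant_on_def by blast
  have "u x = exp k * v x" for x
  proof (cases "x \<in> \<Omega>")
    case True
    have "exp k = exp (ln (u x)) / exp (ln (v x))" using k[OF True] by (metis exp_diff)
    then show ?thesis using pos[OF True] by simp
  qed (simp add: admissible_outside[OF u] admissible_outside[OF v])
  then show ?thesis by (intro exI[of _ "exp k"]) auto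
qed

text \<open>Integration by parts against a coordinate function shows that the integral of \<open>v\<close> would vanish.\<close>

lemma weak_grad_not_AE_0:
  assumes nonempty: "\<Omega> \<noteq> {}" and v: "admissible v"
  shows "\<not> (AE x in M. D v x = 0)"
proof
  assume zero: "AE x in M. D v x = 0"
  obtain i :: 'a where i: "i \<in> Basis" using nonempty_Basis by blast
  have gi: "grad (\<lambda>x. x \<bullet> i) x = i" for x :: 'a
    by (rule grad_eqI) (auto intro!: derivative_eq_intros simp: inner_commute)
  have "(\<integral>x. v x * (grad (\<lambda>x. x \<bullet> i) x \<bullet> i) \<partial>M) = - (\<integral>x. (D v x \<bullet> i) * (x \<bullet> i) \<partial>M)"
    by (rule W_by_parts[OF admissible_W[OF v] smooth_inner_left])
  also have "(\<integral>x. (D v x \<bullet> i) * (x \<bullet> i) \<partial>M) = 0"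
    by (rule integral_eq_zero_AE) (use zero in \<open>eventually_elim, simp\<close>)
  finally have int0: "(\<integral>x. v x \<partial>M) = 0" using i by (simp add: gi inner_Basis)
  have "integrable M v"
    using admissible_W[OF v] by (intro Lp_imp_integrable[OF _ p_ge_1]) (simp add: W_def)
  moreover have "AE x in M. 0 \<le> v x"
    using admissible_pos[OF v] by (intro AE_I2) (auto intro: less_imp_le)
  ultimately have "AE x in M. v x = 0" using int0 by (simp add: integral_nonneg_eq_0_iff_AE)
  then have "AE x in lebesgue. x \<notin> \<Omega>"
    unfolding AE_lebesgue_on[OF sets_dom] by eventually_elim (use admissible_pos[OF v] in force)
  then have "\<Omega> \<in> null_sets lebesgue" by (simp add: AE_iff_null_sets)
  then have "negligible \<Omega>" by (simp add: negligible_iff_null_sets)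
  then show False using open_not_negligible[OF open_dom nonempty] by blast
qed

text \<open>Already u = \<alpha> v. Equality in the strictly convex H forces |Du|^p = |Dv|^p, that
  is \<alpha> |Dv| = |Dv| almost everywhere; with \<alpha> \<noteq> 1 this makes the gradient of v
  vanish, which \<open>weak_grad_not_AE_0\<close> excludes.\<close>

lemma equal_if_strict_mono:
  assumes conn: "connected \<Omega>" and nonempty: "\<Omega> \<noteq> {}" and u: "admissible u" and v: "admissible v"
    and cu: "continuous_on \<Omega> u" and cv: "continuous_on \<Omega> v"
    and eq: "AE x in M. H_midpoint_eq u v x"
    and strict: "strict_mono_on {0..} h"
  shows "u = v"
proof -
  have h_pos: "\<forall>t>0. 0 < h t"
  proof (intro allI impI)
    fix t :: real assume "0 < t"
    then show "0 < h t" using strict_mono_onD[OF strict, of 0 t] h_nonneg[of 0] by simp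
  qed
  note par = gradients_parallel[OF u v eq h_pos]
  have "AE x in M. inverse (u x) *\<^sub>R D u x = inverse (v x) *\<^sub>R D v x"
    using par by eventually_elim simp
  from proportional[OF conn u v cu cv this] obtain \<alpha> where \<alpha>: "0 < \<alpha>" "u = (\<lambda>x. \<alpha> * v x)" by blast
  have "\<alpha> = 1"
  proof (rule ccontr)
    assume ne: "\<alpha> \<noteq> 1"
    have "AE x in M. D v x = 0"
      using par AE_space[of M]
    proof eventually_elim
      case (elim x)
      then have vx: "0 < v x" and ux: "0 < u x" using u v by (simp_all add: admissible_pos)
      let ?S = "D u x" and ?T = "D v x"
      have "?S = u x *\<^sub>R (inverse (u x) *\<^sub>R ?S)" using ux by simp
      also have "\<dots> = \<alpha> *\<^sub>R ?T" using elim vx \<alpha>(2) by simp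
      finally have S: "norm ?S = \<alpha> * norm ?T" using \<alpha>(1) by simp
      have "norm ?S powr p = norm ?T powr p"
        using elim H_midpoint_strict[OF strict, of "norm ?S powr p" "norm ?T powr p"] by fastforce
      then have "norm ?S = norm ?T"
        using powr_less_mono2[of p "norm ?S" "norm ?T"] powr_less_mono2[of p "norm ?T" "norm ?S"] p_pos
        by (metis less_irrefl linorder_neqE_linordered_idom norm_ge_zero)
      then show "?T = 0" using S ne by simp
    qed
    then show False using weak_grad_not_AE_0[OF nonempty v] by blast
  qed
  then show ?thesis using \<alpha>(2) by simp
qed

end

theorem theorem4p1:
  fixes \<Omega> :: "'a::euclidean_space set" and p :: real
    and h :: "real \<Rightarrow> real" and g :: "'a \<Rightarrow> real \<Rightarrow> real"
  assumes domain: "smooth_domain \<Omega>" "bounded \<Omega>"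
    and p: "1 < p"
    and h_nonneg: "\<forall>t\<ge>0. 0 \<le> h t"
    and G_exists: "\<forall>x\<in>\<Omega>. \<forall>t. interval_lebesgue_integrable lebesgue 0 (ereal t) (g x)"
    and H1: "continuous_on {0..} h" "bounded (h ` {0..})" "mono_on {0..} h"
    and H2: "potential_differentiable p \<Omega> g"
    and H3: "\<forall>x\<in>\<Omega>. concave_on {0..} (\<lambda>t. integral_from_0 (g x) (t powr (1 / p)))"
  shows "((\<forall>u. critical_point p \<Omega> h g u \<and> (AE x in lebesgue. x \<in> \<Omega> \<longrightarrow> 0 \<le> u x)
             \<longrightarrow> in_C_closure \<Omega> u) \<and>
          (\<forall>u\<in>positive_critical_points p \<Omega> h g. \<forall>v\<in>positive_critical_points p \<Omega> h g.
             comparable_on \<Omega> u v) \<and>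
          positive_critical_points p \<Omega> h g \<noteq> {}
          \<longrightarrow>
            energy p \<Omega> h g constant_on positive_critical_points p \<Omega> h g \<and>
            (strict_mono_on {0..} h \<or>
             (\<forall>x\<in>\<Omega>. strictly_concave_on {0..} (\<lambda>t. integral_from_0 (g x) (t powr (1 / p))))
             \<longrightarrow> is_singleton (positive_critical_points p \<Omega> h g)) \<and>
            ((\<forall>t>0. 0 < h t)
             \<longrightarrow> (\<exists>u0\<in>positive_critical_points p \<Omega> h g.
                    positive_critical_points p \<Omega> h g \<subseteq> {(\<lambda>x. \<alpha> * u0 x) | \<alpha>. 0 < \<alpha>})))
       \<and> (\<forall>A' \<subseteq> positive_critical_points p \<Omega> h g.
            A' \<noteq> {} \<and> (\<forall>u\<in>A'. in_C_closure \<Omega> u) \<and> (\<forall>u\<in>A'. \<forall>v\<in>A'. comparable_on \<Omega> u v)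
            \<longrightarrow>
              energy p \<Omega> h g constant_on A' \<and>
              (strict_mono_on {0..} h \<or>
               (\<forall>x\<in>\<Omega>. strictly_concave_on {0..} (\<lambda>t. integral_from_0 (g x) (t powr (1 / p))))
               \<longrightarrow> is_singleton A') \<and>
              ((\<forall>t>0. 0 < h t)
               \<longrightarrow> (\<exists>u0\<in>A'. A' \<subseteq> {(\<lambda>x. \<alpha> * u0 x) | \<alpha>. 0 < \<alpha>})))"
proof -
  have dom: "open \<Omega>" "connected \<Omega>" "\<Omega> \<noteq> {}"
    using domain(1) by (simp_all add: smooth_domain_def)
  interpret bo: bounded_open \<Omega> p
    by unfold_locales (use dom domain p in auto)
  interpret quasilinear \<Omega> p h g
  proof unfold_locales
    show "continuous_on {0..} h" "bounded (h ` {0..})" "mono_on {0..} h" by (rule H1)+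
    show "0 \<le> h t" if "0 \<le> t" for t using h_nonneg that by blast
    show "integrable (lebesgue_on \<Omega>) (\<lambda>x. integral_from_0 (g x) (u x))" if "u \<in> sobolev0 p \<Omega>" for u
      using H2 that by (simp add: potential_differentiable_def set_integrable_lebesgue_on)
    show "concave_on {0..} (\<lambda>t. integral_from_0 (g x) (t powr (1 / p)))" if "x \<in> \<Omega>" for x
      using H3 that by blast
  qed
  let ?A = "positive_critical_points p \<Omega> h g"
  let ?strict = "strict_mono_on {0..} h \<or>
    (\<forall>x\<in>\<Omega>. strictly_concave_on {0..} (\<lambda>t. integral_from_0 (g x) (t powr (1 / p))))"
  \<comment> \<open>All claims are proved for a subset \<open>A'\<close> satisfying the restricted
    form of (H4); (i) to (iii) are the case where \<open>A'\<close> is the whole set.\<close>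
  have main: "energy p \<Omega> h g constant_on A' \<and> (?strict \<longrightarrow> is_singleton A') \<and>
      ((\<forall>t>0. 0 < h t) \<longrightarrow> (\<exists>u0\<in>A'. A' \<subseteq> {(\<lambda>x. \<alpha> * u0 x) | \<alpha>. 0 < \<alpha>}))"
    if sub: "A' \<subseteq> ?A" and ne: "A' \<noteq> {}" and reg: "\<forall>u\<in>A'. in_C_closure \<Omega> u"
      and comp: "\<forall>u\<in>A'. \<forall>v\<in>A'. comparable_on \<Omega> u v" for A'
  proof -
    have crit: "critical_point p \<Omega> h g u" and adm: "admissible u" and cont: "continuous_on \<Omega> u"
      if u: "u \<in> A'" for u
    proof -
      have uA: "critical_point p \<Omega> h g u" "regular_rep \<Omega> u" "\<forall>x\<in>\<Omega>. 0 < u x"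
        using sub u by (auto simp: positive_critical_points_def)
      show "critical_point p \<Omega> h g u" by (rule uA(1))
      show "admissible u" using uA by (simp add: admissible_def critical_point_def)
      obtain w where w: "continuous_on (closure \<Omega>) w" "AE x in lebesgue. x \<in> \<Omega> \<longrightarrow> u x = w x"
        using reg u unfolding in_C_closure_def by blast
      have "continuous_on \<Omega> w" by (rule continuous_on_subset[OF w(1) closure_subset])
      \<comment> \<open>(H4) gives continuity of some representative only;
        \<open>regular_rep\<close> makes u itself continuous, as pointwise equality
        requires.\<close>
      then show "continuous_on \<Omega> u" using uA(2) w(2) unfolding regular_rep_def by blast
    qed
    have equality: "E u = E v"
      "AE x in bo.M. H_midpoint_eq u v x"
      "AE x in bo.M. G x (mean (1 / 2) u v x) = (G x (u x) + G x (v x)) / 2"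
      if "u \<in> A'" "v \<in> A'" for u v
      by (rule critical_points_mean_equality[OF crit[OF that(1)] crit[OF that(2)] adm[OF that(1)] adm[OF that(2)]
          comp[rule_format, OF that]])+
    obtain u0 where u0: "u0 \<in> A'" using ne by blast
    have "energy p \<Omega> h g constant_on A'"
      unfolding constant_on_def using equality(1) u0 by blast
    moreover have "is_singleton A'" if strict: ?strict
    proof -
      have "u = u0" if u: "u \<in> A'" for u
        using strict
      proof
        assume "strict_mono_on {0..} h"
        then show "u = u0"
          by (rule equal_if_strict_mono[OF dom(2,3) adm[OF u] adm[OF u0] cont[OF u] cont[OF u0] equality(2)[OF u u0]])
      next
        assume "\<forall>x\<in>\<Omega>. strictly_concave_on {0..} (\<lambda>t. integral_from_0 (g x) (t powr (1 / p)))"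
        then show "u = u0"
          by (rule equal_if_strictly_concave[OF adm[OF u] adm[OF u0] cont[OF u] cont[OF u0] equality(3)[OF u u0]])
      qed
      then have "A' = {u0}" using u0 by blast
      then show ?thesis by simp
    qed
    moreover have "\<exists>u0\<in>A'. A' \<subseteq> {(\<lambda>x. \<alpha> * u0 x) | \<alpha>. 0 < \<alpha>}" if h_pos: "\<forall>t>0. 0 < h t"
    proof (intro bexI[OF _ u0] subsetI)
      fix u assume u: "u \<in> A'"
      have "AE x in bo.M. inverse (u x) *\<^sub>R weak_grad \<Omega> u x = inverse (u0 x) *\<^sub>R weak_grad \<Omega> u0 x"
        using gradients_parallel[OF adm[OF u] adm[OF u0] equality(2)[OF u u0] h_pos]
        by eventually_elim simp
      from proportional[OF dom(2) adm[OF u] adm[OF u0] cont[OF u] cont[OF u0] this]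
      show "u \<in> {(\<lambda>x. \<alpha> * u0 x) | \<alpha>. 0 < \<alpha>}" by blast
    qed
    ultimately show ?thesis by blast
  qed
  \<comment> \<open>The regularity part of (H4) speaks of nonnegative critical points, and positive
    ones are among them.\<close>
  have "in_C_closure \<Omega> u"
    if "\<forall>u. critical_point p \<Omega> h g u \<and> (AE x in lebesgue. x \<in> \<Omega> \<longrightarrow> 0 \<le> u x) \<longrightarrow> in_C_closure \<Omega> u"
      "u \<in> ?A" for u
  proof -
    have "AE x in lebesgue. x \<in> \<Omega> \<longrightarrow> 0 \<le> u x"
      using that(2) by (intro AE_I2) (auto simp: positive_critical_points_def less_imp_le)
    then show ?thesis using that by (simp add: positive_critical_points_def)
  qed
  then show ?thesis
    using main[of ?A] main by blast
qed

end
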